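(* Let $\Omega=(0,1)^d$, $1\le p<\infty$, $k\in\mathbb{N}$ with $k\ge1$. Let $\sigma\in W^{k,1}_{\mathrm{loc}}(\mathbb{R})$ be an activation function and $\varphi$ a norm function for $\sigma$ with $\lim_{x\to\infty}\varphi(x)=\infty$. Put $\varphi_m(x)=\varphi(x)/(1+\mathrm{ReLU}(x))^m$, where $\mathrm{ReLU}(x)=\max(0,x)$, and assume that there is a constant $C>0$ with $|\partial_x^m\sigma(x)|\le C\varphi_m(|x|)$ for $0\le m\le k$ and that $\varphi_k$ is non-decreasing and positive. Let $f\in B_\sigma^\varphi$, and let $\{f_n\}_{n=1}^\infty$, $f_n\in\mathcal{F}_n(\sigma)$, with discrete representing measures $\rho_n$, satisfy $\|f-f_n\|_{L^p(\Omega)}\le r_n$ and $c_{\sigma,\rho_n}^\varphi(f_n)\le c_{\sigma,\rho}^\varphi(f)$ for some representing measure $\rho\in\mathcal{M}^\varphi(\mathbb{R}^{d+1})$ of $f$. Let $f^\delta\in L^p(\Omega)$ satisfy $\|f-f^\delta\|_{L^p(\Omega)}\le\delta$, and let $f_{n,\lambda}^\delta$ be any minimizer over $\mathcal{F}_n(\sigma)$ of $$J_\lambda(g)=\|g-f^\delta\|_{L^p(\Omega)}^p+\lambda\,\mathcal{R}(g).$$ If the regularization parameter $\lambda>0$ is chosen such that $\delta+r_n\asymp\lambda^{1/p}$, then there exists a constant $C_1$, independent of $\delta$, $n$ and $\lambda$, such that for $0\le m\le k$, $$\|f-f_{n,\lambda}^\delta\|_{W^{m,p}(\Omega)}\le 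C_1(\delta+r_n)^{\frac{k-m}{k}}.$$
   Context: An activation function is a Borel-measurable map $\sigma:\mathbb{R}\to\mathbb{C}$. A function $\varphi:[0,\infty)\to(0,\infty)$ is a norm function for $\sigma$ if $\varphi$ is (positive and) non-decreasing and there is a constant $C>0$ with $|\sigma(x)|\le C\varphi(|x|)$ for all $x\in\mathbb{R}$. $\mathcal{M}^\varphi(\mathbb{R}^{d+1})$ is the set of finite complex Radon measures $\rho$ on $\mathbb{R}^{d+1}$ (points $(w,b)$, $w\in\mathbb{R}^d$, $b\in\mathbb{R}$) with $\int\varphi(\|w\|_1+|b|)\,\mathrm{d}|\rho|<\infty$. The generalized Barron space $B_\sigma^\varphi=B_\sigma^\varphi(\Omega)$ is the set of measurable $f:\Omega\to\mathbb{C}$ (identified when equal a.e.) for which there is $\rho\in\mathcal{M}^\varphi(\mathbb{R}^{d+1})$ with $f(x)=\int_{\mathbb{R}^{d+1}}\sigma(w\cdot x+b)\,\mathrm{d}\rho(w,b)$ for a.e. $x\in\Omega$ (a representing measure of $f$). For such $\rho$, $c_{\sigma,\rho}^\varphi(f):=\int_{\mathbb{R}^{d+1}}\varphi(\|w\|_1+|b|)\,\mathrm{d}|\rho|$. $\mathcal{F}_n(\sigma)$ is the set of networks $g(x)=\sum_{i=1}^na_i\,\sigma(w_i\cdot x+b_i)$ (given with their parameters: scalars $a_i$, $w_i\in\mathbb{R}^d$, $b_i\in\mathbb{R}$). For such a network, with discrete representing measure $\rho_n=\sum_ia_i\delta_{(w_i,b_i)}$, $c_{\sigma,\rho_n}^\varphi(g)=\sum_{i=1}^n|a_i|\varphi(\|w_i\|_1+|b_i|)$,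 and the regularizer is $\mathcal{R}(g)=[c_{\sigma,\rho_n}^\varphi(g)]^p$. Minimization of $J_\lambda$ over $\mathcal{F}_n(\sigma)$ is over the network parameters. The representing measure $\rho$ of $f$ is fixed, the same for all $n$. $A\asymp B$ means $c\,B\le A\le c'B$ with constants $c,c'>0$ independent of $\delta,n,\lambda$. *)

theory Defs
  imports "HOL-Analysis.Analysis" "HOL-Library.Multiset"
begin

text \<open>
  Throughout, an arbitrary type \<open>'a\<close> of class \<open>euclidean_space\<close> plays the role of
  $R^d$ with $d = DIM('a) \ge 1$; the coordinates of \<open>x\<close> are \<open>x \<bullet> b\<close> for \<open>b \<in> Basis\<close>.
\<close>

section \<open>Lebesgue spaces\<close>

definition Lp_space :: "real \<Rightarrow> 'a::euclidean_space set \<Rightarrow> ('a \<Rightarrow> complex) set" where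
  "Lp_space p \<Omega> = {u \<in> borel_measurable (lebesgue_on \<Omega>).
      integrable (lebesgue_on \<Omega>) (\<lambda>x. norm (u x) powr p)}"

text \<open>Only meaningful for members of \<open>Lp_space\<close>: the integral of a non-integrable function is 0.\<close>

definition Lp_norm :: "real \<Rightarrow> 'a::euclidean_space set \<Rightarrow> ('a \<Rightarrow> complex) \<Rightarrow> real" where
  "Lp_norm p \<Omega> u = (LINT x|lebesgue_on \<Omega>. norm (u x) powr p) powr (1 / p)"

definition locally_integrable :: "'a::euclidean_space set \<Rightarrow> ('a \<Rightarrow> complex) \<Rightarrow> bool" where
  "locally_integrable \<Omega> u \<longleftrightarrow> (\<forall>K. compact K \<and> K \<subseteq> \<Omega> \<longrightarrow> u absolutely_integrable_on K)"

section \<open>Classical and weak partial derivatives\<close>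

primrec iter_partial :: "'a::euclidean_space list \<Rightarrow> ('a \<Rightarrow> real) \<Rightarrow> 'a \<Rightarrow> real" where
  "iter_partial [] \<psi> = \<psi>"
| "iter_partial (b # bs) \<psi> = (\<lambda>x. frechet_derivative (iter_partial bs \<psi>) (at x) b)"

text \<open>Differentiability of all iterated partial derivatives is the same as being infinitely
  often differentiable.\<close>

definition test_function :: "'a::euclidean_space set \<Rightarrow> ('a \<Rightarrow> real) \<Rightarrow> bool" where
  "test_function \<Omega> \<psi> \<longleftrightarrow>
     (\<forall>bs. set bs \<subseteq> Basis \<longrightarrow> (\<forall>x. iter_partial bs \<psi> differentiable (at x))) \<and>
     compact (closure {x. \<psi> x \<noteq> 0}) \<and> closure {x. \<psi> x \<noteq> 0} \<subseteq> \<Omega>"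

text \<open>A multi-index is encoded as the multiset over \<open>Basis\<close> in which \<open>b\<close> occurs as often as one
  differentiates in direction \<open>b\<close>; its order is its size.\<close>

definition multi_indices :: "nat \<Rightarrow> 'a::euclidean_space multiset set" where
  "multi_indices m = {\<alpha>. set_mset \<alpha> \<subseteq> Basis \<and> size \<alpha> \<le> m}"

text \<open>By the symmetry of higher derivatives the chosen order of differentiation is irrelevant
  for smooth functions.\<close>

definition partial_deriv :: "'a::euclidean_space multiset \<Rightarrow> ('a \<Rightarrow> real) \<Rightarrow> 'a \<Rightarrow> real" where
  "partial_deriv \<alpha> \<psi> = iter_partial (SOME bs. mset bs = \<alpha>) \<psi>"

definition has_weak_deriv ::
  "'a::euclidean_space set \<Rightarrow> 'a multiset \<Rightarrow> ('a \<Rightarrow> complex) \<Rightarrow> ('a \<Rightarrow> complex) \<Rightarrow> bool" where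
  "has_weak_deriv \<Omega> \<alpha> u v \<longleftrightarrow> locally_integrable \<Omega> u \<and> locally_integrable \<Omega> v \<and>
     (\<forall>\<psi>. test_function \<Omega> \<psi> \<longrightarrow>
        (LINT x|lebesgue_on \<Omega>. partial_deriv \<alpha> \<psi> x *\<^sub>R u x) =
        (-1) ^ size \<alpha> * (LINT x|lebesgue_on \<Omega>. \<psi> x *\<^sub>R v x))"

text \<open>Weak derivatives are unique up to null sets, so the choice of the representative does not
  affect norms or almost-everywhere statements.\<close>

definition weak_deriv ::
  "'a::euclidean_space set \<Rightarrow> 'a multiset \<Rightarrow> ('a \<Rightarrow> complex) \<Rightarrow> 'a \<Rightarrow> complex" where
  "weak_deriv \<Omega> \<alpha> u = (SOME v. has_weak_deriv \<Omega> \<alpha> u v)"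

section \<open>Sobolev spaces\<close>

definition sobolev_space :: "nat \<Rightarrow> real \<Rightarrow> 'a::euclidean_space set \<Rightarrow> ('a \<Rightarrow> complex) set" where
  "sobolev_space m p \<Omega> = {u \<in> Lp_space p \<Omega>.
     \<forall>\<alpha>\<in>multi_indices m. \<exists>v\<in>Lp_space p \<Omega>. has_weak_deriv \<Omega> \<alpha> u v}"

definition sobolev_norm ::
  "nat \<Rightarrow> real \<Rightarrow> 'a::euclidean_space set \<Rightarrow> ('a \<Rightarrow> complex) \<Rightarrow> real" where
  "sobolev_norm m p \<Omega> u =
     (\<Sum>\<alpha>\<in>multi_indices m. Lp_norm p \<Omega> (weak_deriv \<Omega> \<alpha> u) powr p) powr (1 / p)"

text \<open>The space $W^{k,1}_{loc}$: local integrability of the derivatives is part of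
  \<open>has_weak_deriv\<close>.\<close>

definition sobolev_loc1 :: "nat \<Rightarrow> 'a::euclidean_space set \<Rightarrow> ('a \<Rightarrow> complex) set" where
  "sobolev_loc1 k \<Omega> = {u. \<forall>\<alpha>\<in>multi_indices k. \<exists>v. has_weak_deriv \<Omega> \<alpha> u v}"

text \<open>The weak derivative of order \<open>m\<close> on the real line, where \<open>Basis = {1}\<close>.\<close>

abbreviation weak_deriv_real :: "nat \<Rightarrow> (real \<Rightarrow> complex) \<Rightarrow> real \<Rightarrow> complex" where
  "weak_deriv_real m \<sigma> \<equiv> weak_deriv UNIV (replicate_mset m 1) \<sigma>"

section \<open>Complex measures\<close>

text \<open>Finite complex Borel measures as countably additive set functions (taking all \<open>A n\<close> empty
  gives \<open>\<rho> {} = 0\<close>). On a Euclidean space they are automatically Radon measures.\<close>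

definition complex_measure :: "('b::euclidean_space set \<Rightarrow> complex) \<Rightarrow> bool" where
  "complex_measure \<rho> \<longleftrightarrow>
     (\<forall>A::nat \<Rightarrow> 'b set. range A \<subseteq> sets borel \<and> disjoint_family A
        \<longrightarrow> (\<lambda>n. \<rho> (A n)) sums \<rho> (\<Union>n. A n))"

definition total_variation :: "('b::euclidean_space set \<Rightarrow> complex) \<Rightarrow> 'b measure" where
  "total_variation \<rho> = measure_of UNIV (sets borel)
     (\<lambda>E. SUP A\<in>{A::nat \<Rightarrow> 'b set. range A \<subseteq> sets borel \<and> disjoint_family A \<and> (\<Union>n. A n) = E}.
        (\<Sum>n. ennreal (norm (\<rho> (A n)))))"

text \<open>The positive part in the Jordan decomposition of a finite signed measure; \<open>ennreal\<close> maps
  negative reals to 0, which is harmless since the empty set takes part in the supremum.\<close>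

definition upper_variation :: "('b::euclidean_space set \<Rightarrow> real) \<Rightarrow> 'b measure" where
  "upper_variation \<nu> = measure_of UNIV (sets borel)
     (\<lambda>E. SUP A\<in>{A \<in> sets borel. A \<subseteq> E}. ennreal (\<nu> A))"

definition signed_integral ::
  "('b::euclidean_space set \<Rightarrow> real) \<Rightarrow> ('b \<Rightarrow> complex) \<Rightarrow> complex" where
  "signed_integral \<nu> h =
     (LINT z|upper_variation \<nu>. h z) - (LINT z|upper_variation (\<lambda>A. - \<nu> A). h z)"

definition complex_integral ::
  "('b::euclidean_space set \<Rightarrow> complex) \<Rightarrow> ('b \<Rightarrow> complex) \<Rightarrow> complex" where
  "complex_integral \<rho> h =
     signed_integral (\<lambda>A. Re (\<rho> A)) h + \<i> * signed_integral (\<lambda>A. Im (\<rho> A)) h"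

section \<open>Norm functions and generalized Barron spaces\<close>

text \<open>Functions on $[0,\infty)$ are represented by functions on the reals whose values at negative
  arguments are irrelevant.\<close>

definition norm_function :: "(real \<Rightarrow> complex) \<Rightarrow> (real \<Rightarrow> real) \<Rightarrow> bool" where
  "norm_function \<sigma> \<phi> \<longleftrightarrow> (\<forall>x\<ge>0. 0 < \<phi> x) \<and> mono_on {0..} \<phi> \<and>
     (\<exists>C>0. \<forall>x. norm (\<sigma> x) \<le> C * \<phi> \<bar>x\<bar>)"

definition damped :: "(real \<Rightarrow> real) \<Rightarrow> nat \<Rightarrow> real \<Rightarrow> real" where
  "damped \<phi> m x = \<phi> x / (1 + max 0 x) ^ m"

definition l1_norm :: "'a::euclidean_space \<Rightarrow> real" where
  "l1_norm w = (\<Sum>b\<in>Basis. \<bar>w \<bullet> b\<bar>)"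

definition barron_measures ::
  "(real \<Rightarrow> real) \<Rightarrow> (('a::euclidean_space \<times> real) set \<Rightarrow> complex) set" where
  "barron_measures \<phi> = {\<rho>. complex_measure \<rho> \<and>
     integrable (total_variation \<rho>) (\<lambda>(w, b). \<phi> (l1_norm w + \<bar>b\<bar>))}"

definition representing_measure ::
  "(real \<Rightarrow> complex) \<Rightarrow> (real \<Rightarrow> real) \<Rightarrow> 'a::euclidean_space set \<Rightarrow>
   (('a \<times> real) set \<Rightarrow> complex) \<Rightarrow> ('a \<Rightarrow> complex) \<Rightarrow> bool" where
  "representing_measure \<sigma> \<phi> \<Omega> \<rho> f \<longleftrightarrow> \<rho> \<in> barron_measures \<phi> \<and>
     (AE x in lebesgue_on \<Omega>. f x = complex_integral \<rho> (\<lambda>(w, b). \<sigma> (w \<bullet> x + b)))"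

definition barron_space ::
  "(real \<Rightarrow> complex) \<Rightarrow> (real \<Rightarrow> real) \<Rightarrow> 'a::euclidean_space set \<Rightarrow> ('a \<Rightarrow> complex) set" where
  "barron_space \<sigma> \<phi> \<Omega> = {f \<in> borel_measurable (lebesgue_on \<Omega>).
     \<exists>\<rho>. representing_measure \<sigma> \<phi> \<Omega> \<rho> f}"

definition barron_cost ::
  "(real \<Rightarrow> real) \<Rightarrow> (('a::euclidean_space \<times> real) set \<Rightarrow> complex) \<Rightarrow> real" where
  "barron_cost \<phi> \<rho> = (LINT (w, b)|total_variation \<rho>. \<phi> (l1_norm w + \<bar>b\<bar>))"

section \<open>Shallow networks\<close>

text \<open>A network with \<open>n\<close> neurons is given by its parameters, a list of \<open>n\<close> triples \<open>(a, w, b)\<close>.\<close>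

type_synonym 'a network = "(complex \<times> 'a \<times> real) list"

definition networks :: "nat \<Rightarrow> 'a::euclidean_space network set" where
  "networks n = {\<theta>. length \<theta> = n}"

definition realize :: "(real \<Rightarrow> complex) \<Rightarrow> 'a::euclidean_space network \<Rightarrow> 'a \<Rightarrow> complex" where
  "realize \<sigma> \<theta> x = (\<Sum>(a, w, b)\<leftarrow>\<theta>. a * \<sigma> (w \<bullet> x + b))"

definition network_cost :: "(real \<Rightarrow> real) \<Rightarrow> 'a::euclidean_space network \<Rightarrow> real" where
  "network_cost \<phi> \<theta> = (\<Sum>(a, w, b)\<leftarrow>\<theta>. norm a * \<phi> (l1_norm w + \<bar>b\<bar>))"

definition regularizer :: "(real \<Rightarrow> real) \<Rightarrow> real \<Rightarrow> 'a::euclidean_space network \<Rightarrow> real" where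
  "regularizer \<phi> p \<theta> = network_cost \<phi> \<theta> powr p"

definition tikhonov ::
  "(real \<Rightarrow> complex) \<Rightarrow> (real \<Rightarrow> real) \<Rightarrow> real \<Rightarrow> 'a::euclidean_space set \<Rightarrow> real \<Rightarrow>
   ('a \<Rightarrow> complex) \<Rightarrow> 'a network \<Rightarrow> real" where
  "tikhonov \<sigma> \<phi> p \<Omega> lam f\<^sub>\<delta> \<theta> =
     Lp_norm p \<Omega> (\<lambda>x. realize \<sigma> \<theta> x - f\<^sub>\<delta> x) powr p + lam * regularizer \<phi> p \<theta>"

abbreviation unit_cube :: "'a::euclidean_space set" where
  "unit_cube \<equiv> box 0 One"

end

theory Submission
  imports Defs
begin

text \<open>
  The minimizer \<open>\<theta>\<close> competes with \<open>fn n\<close>. Comparing the two values of the functional gives, up to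
  constants, \<open>L\<^sup>p\<close> distance at most \<open>\<delta> + r n\<close> between \<open>\<theta>\<close> and \<open>f\<close>, and, since \<open>\<delta> + r n\<close> is
  comparable with \<open>lam powr (1 / p)\<close>, a bound on the cost of \<open>\<theta>\<close> that depends on \<open>c'\<close> and the cost of
  \<open>\<rho>\<close> only. A bounded cost is a bound on all derivatives up to order \<open>k\<close>: differentiating
  \<open>\<sigma> (w \<bullet> x + b)\<close> \<open>m\<close> times brings down at most \<open>(l1_norm w) ^ m\<close>, and this factor is absorbed by
  the denominator of \<open>damped \<phi> m\<close>, so that on the cube every derivative of a neuron is at most
  \<open>C * \<phi> (l1_norm w + \<bar>b\<bar>)\<close>; the cost is the integral of just this quantity (\<open>N_bound\<close>,
  \<open>barron_smooth_family\<close>, \<open>network_smooth_family\<close>). The rate is then interpolation for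
  \<open>u = f - realize \<sigma> \<theta>\<close> between the small \<open>L\<^sup>p\<close> norm and the bounded derivatives of order \<open>k\<close>
  (\<open>interpolation\<close>, \<open>interpolation_rate\<close>).

  The interpolation inequality rests on finite differences. A one-sided difference formula that is
  exact on polynomials of degree less than \<open>r\<close> recovers a first partial derivative from function
  values at distance \<open>\<epsilon>\<close>, up to an error of order \<open>\<epsilon> ^ r\<close>. Stepping from each point into
  the half of the cube with more room keeps the nodes inside the cube, and translation invariance turns the
  pointwise formula into one for \<open>p\<close>-th powers of norms. Iterating over the directions of a
  multi-index, with the order of the formula matched to the derivatives still available, gives
  \<open>\<epsilon> ^ m * norm (D\<^sup>\<alpha> u) \<le> A * (norm u + \<epsilon> ^ k * M)\<close> for \<open>m = size \<alpha> < k\<close>, and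
  \<open>\<epsilon>\<close> proportional to \<open>(\<delta> + r n) powr (1 / k)\<close> balances the two terms.

  To have Taylor's formula at all points, the weak derivatives of \<open>\<sigma>\<close> of order below \<open>k\<close> are replaced by
  continuous representatives, each the primitive of the next one (\<open>activation_representatives\<close>, by way
  of \<open>du_Bois_Reymond\<close>). Neurons then have explicit derivatives, which are weak derivatives by
  \<open>integral_by_parts_direction\<close>. What superpositions of neurons inherit from single ones is collected in the
  predicate \<open>smooth_family\<close>. For \<open>f\<close> the superposition is an integral against a complex measure, which
  \<open>complex_integral_decomposition\<close> splits into four positive measures dominated by the total
  variation. Finally the weak derivative chosen in the Sobolev norm agrees with the explicit one by the
  fundamental lemma of the calculus of variations, which requires the construction of enough test functions.
\<close>

section \<open>Smooth functions and bump functions\<close>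

definition smooth :: "('a::euclidean_space \<Rightarrow> real) \<Rightarrow> bool" where
  "smooth \<psi> \<longleftrightarrow> (\<forall>bs. set bs \<subseteq> Basis \<longrightarrow> (\<forall>x. iter_partial bs \<psi> differentiable (at x)))"

lemma iter_partial_append:
  "iter_partial (bs @ cs) \<psi> = iter_partial bs (iter_partial cs \<psi>)"
  by (induction bs) auto

lemma smooth_iter_partial:
  assumes "smooth \<psi>" "set cs \<subseteq> Basis"
  shows "smooth (iter_partial cs \<psi>)"
  using assms unfolding smooth_def by (metis iter_partial_append le_sup_iff set_append)

lemma smooth_partial:
  assumes "smooth \<psi>" "b \<in> Basis"
  shows "smooth (\<lambda>x. frechet_derivative \<psi> (at x) b)"
  using smooth_iter_partial[of \<psi> "[b]"] assms by simp

lemma smooth_differentiable: "smooth \<psi> \<Longrightarrow> \<psi> differentiable (at x)"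
  unfolding smooth_def by (metis empty_set empty_subsetI iter_partial.simps(1))

text \<open>Iterated derivatives of concrete functions have no manageable closed form. Smoothness is
  read off instead from a class of functions that differentiation does not leave.\<close>

lemma smooth_coinduct:
  assumes "\<psi> \<in> F"
    and diff: "\<And>g x. g \<in> F \<Longrightarrow> g differentiable (at x)"
    and closed: "\<And>g b. g \<in> F \<Longrightarrow> b \<in> Basis \<Longrightarrow> (\<lambda>x. frechet_derivative g (at x) b) \<in> F"
  shows "smooth \<psi>"
proof -
  have "iter_partial bs \<psi> \<in> F" if "set bs \<subseteq> Basis" for bs
    using that by (induction bs) (auto simp: assms(1) closed)
  then show ?thesis
    unfolding smooth_def using diff by blast
qed

lemma smooth_lincomb:
  fixes \<psi> \<theta> :: "'a::euclidean_space \<Rightarrow> real"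
  assumes "smooth \<psi>" "smooth \<theta>"
  shows "smooth (\<lambda>x. a * \<psi> x + c * \<theta> x)"
proof (rule smooth_coinduct)
  let ?F = "{\<lambda>x::'a. a * \<psi> x + c * \<theta> x |\<psi> \<theta>. smooth \<psi> \<and> smooth \<theta>}"
  show "(\<lambda>x. a * \<psi> x + c * \<theta> x) \<in> ?F"
    using assms by blast
  show "g differentiable (at x)" if "g \<in> ?F" for g x
    using that smooth_differentiable by (auto intro!: derivative_intros)
  show "(\<lambda>x. frechet_derivative g (at x) b) \<in> ?F" if "g \<in> ?F" "b \<in> Basis" for g b
  proof -
    obtain \<psi> \<theta> where g: "g = (\<lambda>x. a * \<psi> x + c * \<theta> x)" and s: "smooth \<psi>" "smooth \<theta>"
      using \<open>g \<in> ?F\<close> by blast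
    have "(g has_derivative (\<lambda>h. a * frechet_derivative \<psi> (at x) h + c * frechet_derivative \<theta> (at x) h)) (at x)" for x
      unfolding g using s[THEN smooth_differentiable] frechet_derivative_works
      by (auto intro!: derivative_eq_intros)
    then have "frechet_derivative g (at x) = (\<lambda>h. a * frechet_derivative \<psi> (at x) h + c * frechet_derivative \<theta> (at x) h)" for x
      using frechet_derivative_at by metis
    then show ?thesis
      using s[THEN smooth_partial, OF \<open>b \<in> Basis\<close>] by auto
  qed
qed

text \<open>The classical flat function is the case \<open>m = 0\<close>. The powers of \<open>1 / x\<close> are included because
  all its derivatives are linear combinations of these functions.\<close>

definition flat :: "nat \<Rightarrow> real \<Rightarrow> real" where
  "flat m x = (if 0 < x then exp (- inverse x) * inverse x ^ m else 0)"

lemma power_le_fact_exp: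
  assumes "0 \<le> (x::real)"
  shows "x ^ n \<le> fact n * exp x"
proof -
  have "x ^ n /\<^sub>R fact n = (\<Sum>i\<in>{n}. x ^ i /\<^sub>R fact i)" by simp
  also have "\<dots> \<le> (\<Sum>i. x ^ i /\<^sub>R fact i)"
    using assms exp_converges[of x] by (intro sum_le_suminf) (auto simp: sums_iff)
  also have "\<dots> = exp x"
    using exp_converges[of x] by (simp add: sums_iff)
  finally show ?thesis by (simp add: field_simps)
qed

text \<open>Comparing the exponential with a single term of its series already gives decay of second order,
  which is what the difference quotient at 0 requires.\<close>

lemma flat_le_square:
  assumes "0 < x"
  shows "flat m x \<le> fact (m + 2) * x ^ 2"
proof -
  have "inverse x ^ (m + 2) \<le> fact (m + 2) * exp (inverse x)"
    using assms by (intro power_le_fact_exp) simp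
  then have "inverse x ^ (m + 2) * (exp (- inverse x) * x ^ 2) \<le>
      fact (m + 2) * exp (inverse x) * (exp (- inverse x) * x ^ 2)"
    by (intro mult_right_mono) auto
  also have "\<dots> = fact (m + 2) * x ^ 2"
    by (simp add: exp_minus)
  also have "inverse x ^ (m + 2) * (exp (- inverse x) * x ^ 2) = flat m x"
    using assms by (simp add: flat_def power2_eq_square field_simps)
  finally show ?thesis .
qed

lemma flat_has_derivative:
  "(flat m has_field_derivative flat (m + 2) x - m * flat (m + 1) x) (at x)"
proof -
  consider "x < 0" | "x = 0" | "0 < x" by linarith
  then show ?thesis
  proof cases
    case 1
    have "((\<lambda>x. 0) has_field_derivative flat (m + 2) x - m * flat (m + 1) x) (at x)"
      using 1 by (simp add: flat_def)
    then show ?thesis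
      by (rule has_field_derivative_transform_within_open[where S="{..<0}"])
        (use 1 in \<open>auto simp: flat_def\<close>)
  next
    case 3
    have "((\<lambda>x. exp (- inverse x) * inverse x ^ m) has_field_derivative
        exp (- inverse x) * (inverse x * inverse x) * inverse x ^ m +
        exp (- inverse x) * (real m * inverse x ^ (m - 1) * (- (inverse x * inverse x)))) (at x)"
      using 3 by (auto intro!: derivative_eq_intros)
    moreover have "real m * inverse x ^ (m - 1) * (inverse x * inverse x) = real m * inverse x ^ (m + 1)"
      by (cases m) auto
    then have "exp (- inverse x) * (inverse x * inverse x) * inverse x ^ m +
        exp (- inverse x) * (real m * inverse x ^ (m - 1) * (- (inverse x * inverse x))) =
        flat (m + 2) x - m * flat (m + 1) x"
      using 3 by (auto simp: flat_def algebra_simps)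
    ultimately have "((\<lambda>x. exp (- inverse x) * inverse x ^ m) has_field_derivative
        flat (m + 2) x - m * flat (m + 1) x) (at x)"
      by simp
    then show ?thesis
      by (rule has_field_derivative_transform_within_open[where S="{0<..}"])
        (use 3 in \<open>auto simp: flat_def\<close>)
  next
    case 2
    have "\<bar>flat m h / h\<bar> \<le> fact (m + 2) * \<bar>h\<bar>" for h
    proof (cases "h > 0")
      case True
      moreover have "0 \<le> flat m h" by (simp add: flat_def)
      ultimately show ?thesis
        using flat_le_square[OF True, of m] by (simp add: field_simps power2_eq_square)
    next
      case False
      then have "flat m h / h = 0" by (simp add: flat_def)
      moreover have "0 \<le> fact (m + 2) * \<bar>h\<bar>"
        by (intro mult_nonneg_nonneg fact_ge_zero abs_ge_zero)
      ultimately show ?thesis by (metis abs_zero)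
    qed
    then have "\<forall>\<^sub>F h in at 0. norm (flat m h / h) \<le> fact (m + 2) * \<bar>h\<bar>"
      by (intro always_eventually allI) (simp only: real_norm_def)
    moreover have "((\<lambda>h::real. fact (m + 2) * \<bar>h\<bar>) \<longlongrightarrow> fact (m + 2) * \<bar>0\<bar>) (at 0)"
      by (intro tendsto_intros)
    ultimately have "((\<lambda>h. flat m h / h) \<longlongrightarrow> 0) (at 0)"
      using Lim_null_comparison by (simp only: abs_zero mult_zero_right)
    then show ?thesis
      using 2 by (simp add: DERIV_def flat_def)
  qed
qed

text \<open>Products are included for bumps in several variables, sums because the product rule produces
  them; the class is then closed under differentiation.\<close>

inductive_set flat_algebra :: "('a::euclidean_space \<Rightarrow> real) set" where
  const: "(\<lambda>x. c) \<in> flat_algebra"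
| flat: "(\<lambda>x. flat m (u \<bullet> x + c)) \<in> flat_algebra"
| add: "f \<in> flat_algebra \<Longrightarrow> g \<in> flat_algebra \<Longrightarrow> (\<lambda>x. f x + g x) \<in> flat_algebra"
| mult: "f \<in> flat_algebra \<Longrightarrow> g \<in> flat_algebra \<Longrightarrow> (\<lambda>x. f x * g x) \<in> flat_algebra"

lemma flat_algebra_derivative:
  "f \<in> flat_algebra \<Longrightarrow> \<exists>f'. (\<forall>x. (f has_derivative f' x) (at x)) \<and> (\<forall>b. (\<lambda>x. f' x b) \<in> flat_algebra)"
proof (induction rule: flat_algebra.induct)
  case (const c)
  show ?case
    by (rule exI[where x="\<lambda>x b. 0"]) (auto intro: flat_algebra.const)
next
  case (flat m u c)
  let ?D = "\<lambda>x b. (flat (m + 2) (u \<bullet> x + c) + (- real m) * flat (m + 1) (u \<bullet> x + c)) * (u \<bullet> b)"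
  have "((\<lambda>x. flat m (u \<bullet> x + c)) has_derivative ?D x) (at x)" for x
  proof -
    have "((\<lambda>x. u \<bullet> x + c) has_derivative (\<lambda>b. u \<bullet> b)) (at x)"
      by (auto intro!: derivative_eq_intros)
    from has_derivative_compose[OF this flat_has_derivative[of m, unfolded has_field_derivative_def]]
    show ?thesis by (simp add: algebra_simps)
  qed
  moreover have "(\<lambda>x. ?D x b) \<in> flat_algebra" for b
    by (intro flat_algebra.intros)
  ultimately show ?case
    by (intro exI[where x="?D"]) blast
next
  case (add f g)
  then obtain f' g' where "\<And>x. (f has_derivative f' x) (at x)" "\<And>b. (\<lambda>x. f' x b) \<in> flat_algebra"
    "\<And>x. (g has_derivative g' x) (at x)" "\<And>b. (\<lambda>x. g' x b) \<in> flat_algebra"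
    by blast
  then show ?case
    by (intro exI[where x="\<lambda>x b. f' x b + g' x b"]) (simp add: has_derivative_add flat_algebra.add)
next
  case (mult f g)
  then obtain f' g' where fg: "\<And>x. (f has_derivative f' x) (at x)" "\<And>b. (\<lambda>x. f' x b) \<in> flat_algebra"
    "\<And>x. (g has_derivative g' x) (at x)" "\<And>b. (\<lambda>x. g' x b) \<in> flat_algebra"
    by blast
  have "((\<lambda>x. f x * g x) has_derivative (\<lambda>b. f x * g' x b + f' x b * g x)) (at x)" for x
    by (rule has_derivative_mult[OF fg(1) fg(3)])
  moreover have "(\<lambda>x. f x * g' x b + f' x b * g x) \<in> flat_algebra" for b
    by (intro flat_algebra.add flat_algebra.mult fg mult.hyps)
  ultimately show ?case
    by (intro exI[where x="\<lambda>x b. f x * g' x b + f' x b * g x"]) auto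
qed

lemma flat_algebra_smooth:
  assumes "f \<in> flat_algebra"
  shows "smooth f"
proof (rule smooth_coinduct[where F=flat_algebra])
  show "g differentiable (at x)" if "g \<in> flat_algebra" for g :: "'a \<Rightarrow> real" and x
    using flat_algebra_derivative[OF that] by (auto simp: differentiable_def)
  show "(\<lambda>x. frechet_derivative g (at x) b) \<in> flat_algebra" if g: "g \<in> flat_algebra" for g :: "'a \<Rightarrow> real" and b
  proof -
    obtain g' where g': "\<And>x. (g has_derivative g' x) (at x)" "\<And>b. (\<lambda>x. g' x b) \<in> flat_algebra"
      using flat_algebra_derivative[OF g] by blast
    have "frechet_derivative g (at x) = g' x" for x
      by (rule frechet_derivative_at[OF g'(1), symmetric])
    then show ?thesis using g'(2) by simp
  qed
qed fact

lemma flat_algebra_prod: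
  assumes "finite A" "\<And>i. i \<in> A \<Longrightarrow> f i \<in> flat_algebra"
  shows "(\<lambda>x. \<Prod>i\<in>A. f i x) \<in> flat_algebra"
  using assms by (induction A rule: finite_induct) (simp_all add: flat_algebra.const flat_algebra.mult)

text \<open>Each factor has the form \<open>exp (- 1 / (n * y))\<close> with \<open>y > 0\<close> inside the box, so it tends to 1 as
  \<open>n\<close> grows, and the bumps approximate the indicator of the open box from below.\<close>

definition box_bump :: "'a::euclidean_space \<Rightarrow> 'a \<Rightarrow> nat \<Rightarrow> 'a \<Rightarrow> real" where
  "box_bump a d n x = (\<Prod>b\<in>Basis. flat 0 (real n * (x \<bullet> b - a \<bullet> b)) * flat 0 (real n * (d \<bullet> b - x \<bullet> b)))"

lemma smooth_box_bump: "smooth (box_bump a d n)"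
proof (rule flat_algebra_smooth)
  have "flat 0 (real n * (x \<bullet> b - a \<bullet> b)) = flat 0 ((real n *\<^sub>R b) \<bullet> x + (- real n * (a \<bullet> b)))"
    "flat 0 (real n * (d \<bullet> b - x \<bullet> b)) = flat 0 ((- real n *\<^sub>R b) \<bullet> x + (real n * (d \<bullet> b)))" for x b :: 'a
    by (simp_all add: inner_commute algebra_simps)
  then show "box_bump a d n \<in> flat_algebra"
    unfolding box_bump_def[abs_def] by (simp only:) (intro flat_algebra_prod flat_algebra.intros finite_Basis)
qed

lemma flat0_bounds: "0 \<le> flat 0 y" "flat 0 y \<le> 1"
  by (auto simp: flat_def)

lemma box_bump_bounds: "0 \<le> box_bump a d n x" "box_bump a d n x \<le> 1"
  unfolding box_bump_def by (auto intro!: prod_nonneg prod_le_1 mult_le_one simp: flat0_bounds)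

lemma box_bump_eq_0:
  assumes "x \<notin> box a d"
  shows "box_bump a d n x = 0"
proof -
  obtain b where b: "b \<in> Basis" "\<not> (a \<bullet> b < x \<bullet> b \<and> x \<bullet> b < d \<bullet> b)"
    using assms by (auto simp: mem_box)
  then have "flat 0 (real n * (x \<bullet> b - a \<bullet> b)) * flat 0 (real n * (d \<bullet> b - x \<bullet> b)) = 0"
    by (auto simp: flat_def zero_less_mult_iff)
  then show ?thesis
    unfolding box_bump_def using b(1) by (auto intro!: prod_zero)
qed

lemma test_function_iff:
  "test_function \<Omega> \<psi> \<longleftrightarrow> smooth \<psi> \<and> compact (closure {x. \<psi> x \<noteq> 0}) \<and> closure {x. \<psi> x \<noteq> 0} \<subseteq> \<Omega>"
  by (simp add: test_function_def smooth_def)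

lemma test_function_box_bump:
  assumes "cbox a d \<subseteq> \<Omega>"
  shows "test_function \<Omega> (box_bump a d n)"
proof -
  have "{x. box_bump a d n x \<noteq> 0} \<subseteq> cbox a d"
    using box_bump_eq_0 box_subset_cbox by blast
  then have *: "closure {x. box_bump a d n x \<noteq> 0} \<subseteq> cbox a d"
    by (intro closure_minimal) auto
  then have "bounded (closure {x. box_bump a d n x \<noteq> 0})"
    using bounded_cbox bounded_subset by blast
  then show ?thesis
    using * assms smooth_box_bump unfolding test_function_iff
    by (auto simp: compact_eq_bounded_closed)
qed

lemma box_bump_tendsto: "(\<lambda>n. box_bump a d n x) \<longlonglongrightarrow> indicator (box a d) x"
proof (cases "x \<in> box a d")
  case True
  have *: "(\<lambda>n. flat 0 (real n * y)) \<longlonglongrightarrow> 1" if "0 < y" for y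
  proof -
    have "(\<lambda>n. - (inverse y * inverse (real n))) \<longlonglongrightarrow> - (inverse y * 0)"
      by (intro tendsto_intros lim_inverse_n)
    then have "(\<lambda>n. exp (- (inverse y * inverse (real n)))) \<longlonglongrightarrow> exp 0"
      by (intro tendsto_exp) simp
    moreover have "eventually (\<lambda>n. exp (- (inverse y * inverse (real n))) = flat 0 (real n * y)) sequentially"
      using eventually_gt_at_top[of 0] by eventually_elim (use that in \<open>simp add: flat_def field_simps\<close>)
    ultimately show ?thesis
      by (simp add: tendsto_cong)
  qed
  have "(\<lambda>n. box_bump a d n x) \<longlonglongrightarrow> (\<Prod>b\<in>(Basis::'a set). 1 * 1)"
    unfolding box_bump_def using True by (intro tendsto_intros *) (auto simp: mem_box)
  then show ?thesis
    using True by simp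
qed (simp add: box_bump_eq_0)

lemma smooth_continuous: "smooth \<psi> \<Longrightarrow> continuous_on S \<psi>"
  using smooth_differentiable differentiable_imp_continuous_within
  by (metis continuous_at_imp_continuous_on)


section \<open>The fundamental lemma of the calculus of variations\<close>

lemma lebesgue_borel_version:
  fixes g :: "'a::euclidean_space \<Rightarrow> complex"
  assumes "g \<in> borel_measurable lebesgue"
  obtains g' where "g' \<in> borel_measurable borel" "AE x in lebesgue. g x = g' x"
proof -
  have "(\<lambda>x. Re (g x)) \<in> borel_measurable (completion lborel)" "(\<lambda>x. Im (g x)) \<in> borel_measurable (completion lborel)"
    using assms by auto
  then obtain r i where ri: "r \<in> borel_measurable lborel" "i \<in> borel_measurable lborel"
    "AE x in lborel. Re (g x) = r x" "AE x in lborel. Im (g x) = i x"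
    using completion_ex_borel_measurable_real by metis
  have "AE x in lebesgue. g x = Complex (r x) (i x)"
    using AE_completion[OF ri(3)] AE_completion[OF ri(4)] by eventually_elim (simp add: complex_eq_iff)
  moreover have "(\<lambda>x. Complex (r x) (i x)) \<in> borel_measurable borel"
    using ri(1,2) by (simp add: Complex_eq)
  ultimately show ?thesis using that by blast
qed

lemma AE_cbox_box: "AE x in lebesgue. x \<in> cbox a b \<longrightarrow> x \<in> box a (b::'a::euclidean_space)"
proof -
  have "cbox a b - box a b \<in> null_sets lebesgue"
    using negligible_iff_null_sets negligible_frontier_interval by blast
  from AE_not_in[OF this] show ?thesis
    by eventually_elim auto
qed

text \<open>The bumps of a closed box inside \<open>\<Omega>\<close> are test functions, and they converge boundedly to
  the indicator of its interior.\<close>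

lemma integral_box_eq_0:
  fixes v :: "'a::euclidean_space \<Rightarrow> complex"
  assumes v: "locally_integrable \<Omega> v" and \<Omega>: "\<Omega> \<in> sets lebesgue"
    and test: "\<And>\<psi>. test_function \<Omega> \<psi> \<Longrightarrow> (LINT x|lebesgue_on \<Omega>. \<psi> x *\<^sub>R v x) = 0"
    and sub: "cbox a d \<subseteq> \<Omega>"
  shows "(LINT x|lebesgue. indicator (box a d) x *\<^sub>R v x) = 0"
proof -
  let ?w = "\<lambda>x. indicator (cbox a d) x *\<^sub>R v x"
  have w: "integrable lebesgue ?w"
    using v sub unfolding locally_integrable_def set_integrable_def by auto
  have "(LINT x|lebesgue. box_bump a d n x *\<^sub>R ?w x) = 0" for n
  proof -
    have "(LINT x|lebesgue. box_bump a d n x *\<^sub>R ?w x) =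
        (LINT x|lebesgue. indicator \<Omega> x *\<^sub>R (box_bump a d n x *\<^sub>R v x))"
    proof (rule Bochner_Integration.integral_cong)
      fix x
      show "box_bump a d n x *\<^sub>R ?w x = indicator \<Omega> x *\<^sub>R (box_bump a d n x *\<^sub>R v x)"
        using box_bump_eq_0[of x a d n] box_subset_cbox[of a d] sub
        by (cases "x \<in> box a d") (auto simp: indicator_def)
    qed simp
    also have "\<dots> = (LINT x|lebesgue_on \<Omega>. box_bump a d n x *\<^sub>R v x)"
      using \<Omega> by (subst integral_restrict_space) auto
    finally show ?thesis
      using test[OF test_function_box_bump[OF sub]] by simp
  qed
  moreover have "(\<lambda>n. LINT x|lebesgue. box_bump a d n x *\<^sub>R ?w x) \<longlonglongrightarrow>
      (LINT x|lebesgue. indicator (box a d) x *\<^sub>R ?w x)"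
  proof (rule integral_dominated_convergence[where w="\<lambda>x. norm (?w x)"])
    have "box_bump a d n \<in> borel_measurable borel" for n
      by (intro borel_measurable_continuous_onI smooth_continuous smooth_box_bump)
    then have [measurable]: "box_bump a d n \<in> borel_measurable lebesgue" for n
      by (simp add: borel_measurable_if_I measurable_completion)
    have wm: "?w \<in> borel_measurable lebesgue" by (rule borel_measurable_integrable[OF w])
    show "(\<lambda>x. indicator (box a d) x *\<^sub>R ?w x) \<in> borel_measurable lebesgue"
      by (rule borel_measurable_scaleR[OF _ wm]) (auto intro!: borel_measurable_indicator)
    show "(\<lambda>x. box_bump a d n x *\<^sub>R ?w x) \<in> borel_measurable lebesgue" for n
      by (rule borel_measurable_scaleR[OF _ wm]) (auto intro!: borel_measurable_indicator)
    show "AE x in lebesgue. (\<lambda>n. box_bump a d n x *\<^sub>R ?w x) \<longlonglongrightarrow> indicator (box a d) x *\<^sub>R ?w x"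
      by (intro AE_I2 tendsto_intros box_bump_tendsto)
    show "AE x in lebesgue. norm (box_bump a d n x *\<^sub>R ?w x) \<le> norm (?w x)" for n
    proof (rule AE_I2)
      fix x
      show "norm (box_bump a d n x *\<^sub>R ?w x) \<le> norm (?w x)"
        unfolding norm_scaleR[of "box_bump a d n x"]
        by (rule mult_left_le_one_le) (simp_all add: box_bump_bounds)
    qed
    show "integrable lebesgue (\<lambda>x. norm (?w x))"
      using w by (rule integrable_norm)
  qed
  ultimately have "(LINT x|lebesgue. indicator (box a d) x *\<^sub>R ?w x) = 0"
    by (simp add: LIMSEQ_const_iff)
  moreover have "indicator (box a d) x *\<^sub>R ?w x = indicator (box a d) x *\<^sub>R v x" for x
    using box_subset_cbox[of a d] by (auto simp: indicator_def)
  ultimately show ?thesis by (simp only:)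
qed

text \<open>Open boxes form an intersection-stable generator of the Borel sets, so the integral of \<open>F\<close>
  vanishes over every Borel set.\<close>

lemma integral_boxes_eq_0_imp_AE_0:
  fixes F :: "'a::euclidean_space \<Rightarrow> complex"
  assumes F: "integrable lborel F"
    and F0: "integral\<^sup>L lborel F = 0"
    and box: "\<And>c e. (LINT x|lborel. indicator (box c e) x *\<^sub>R F x) = 0"
  shows "AE x in lborel. F x = 0"
proof (rule sigma_finite_measure.density_zero[OF sigma_finite_lborel F])
  fix A assume "A \<in> sets (lborel :: 'a measure)"
  then have A: "A \<in> sigma_sets UNIV (range (\<lambda>(a, b). box a b :: 'a set))"
    by (simp add: borel_eq_box)
  have si: "set_integrable lborel A F" if "A \<in> sigma_sets UNIV (range (\<lambda>(a, b). box a b :: 'a set))" for A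
  proof -
    have "A \<in> sets borel" using that by (simp add: borel_eq_box)
    then show ?thesis
      unfolding set_integrable_def by (intro integrable_mult_indicator[OF _ F]) simp
  qed
  have stable: "Int_stable (range (\<lambda>(a, b). box a b :: 'a set))"
    by (auto simp: Int_stable_def box_Int_box)
  show "set_lebesgue_integral lborel A F = 0"
    using stable subset_Pow_Union[of "range (\<lambda>(a, b). box a b :: 'a set)", THEN subset_trans, OF Pow_mono[OF subset_UNIV]] A
  proof (induction rule: sigma_sets_induct_disjoint)
    case (basic A)
    then show ?case using box by (auto simp: set_lebesgue_integral_def)
  next
    case empty
    show ?case by (simp add: set_lebesgue_integral_def)
  next
    case (compl A)
    have "set_lebesgue_integral lborel (UNIV - A) F = (LINT x|lborel. F x - indicator A x *\<^sub>R F x)"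
      unfolding set_lebesgue_integral_def
      by (intro Bochner_Integration.integral_cong) (auto simp: indicator_def)
    also have "\<dots> = 0"
      using compl si[OF compl(1)] F F0
      by (subst Bochner_Integration.integral_diff) (auto simp: set_integrable_def set_lebesgue_integral_def)
    finally show ?case .
  next
    case (union A)
    have "A i \<in> sets lborel" for i
      using union(2) by (auto simp: borel_eq_box)
    moreover have "set_integrable lborel (\<Union>i. A i) F"
      using union(2) by (intro si) (rule sigma_sets.Union, auto)
    ultimately have "set_lebesgue_integral lborel (\<Union>i. A i) F = (\<Sum>i. set_lebesgue_integral lborel (A i) F)"
      using union(1) by (intro lebesgue_integral_countable_add) (auto simp: disjoint_family_on_def)
    then show ?case using union(3) by simp
  qed
qed

text \<open>Countably many closed boxes inside \<open>\<Omega>\<close> cover it. On each of them the previous two lemmas apply,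
  because the intersection with any further box is again a box inside \<open>\<Omega>\<close>.\<close>

theorem fundamental_lemma:
  fixes v :: "'a::euclidean_space \<Rightarrow> complex"
  assumes v: "locally_integrable \<Omega> v" and \<Omega>: "open \<Omega>"
    and test: "\<And>\<psi>. test_function \<Omega> \<psi> \<Longrightarrow> (LINT x|lebesgue_on \<Omega>. \<psi> x *\<^sub>R v x) = 0"
  shows "AE x in lebesgue. x \<in> \<Omega> \<longrightarrow> v x = 0"
proof -
  have \<Omega>L: "\<Omega> \<in> sets lebesgue" using \<Omega> by auto
  have *: "AE x in lebesgue. x \<in> cbox a d \<longrightarrow> v x = 0" if sub: "cbox a d \<subseteq> \<Omega>" for a d
  proof -
    let ?F = "\<lambda>x. indicator (box a d) x *\<^sub>R v x"
    have "integrable lebesgue (\<lambda>x. indicator (cbox a d) x *\<^sub>R v x)"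
      using v sub unfolding locally_integrable_def set_integrable_def by auto
    then have "integrable lebesgue (\<lambda>x. indicator (box a d) x *\<^sub>R (indicator (cbox a d) x *\<^sub>R v x))"
      by (rule integrable_mult_indicator[rotated]) auto
    also have "(\<lambda>x. indicator (box a d) x *\<^sub>R (indicator (cbox a d) x *\<^sub>R v x)) = ?F"
      using box_subset_cbox[of a d] by (intro ext) (auto simp: indicator_def)
    finally have F: "integrable lebesgue ?F" .
    obtain F' where F': "F' \<in> borel_measurable borel" "AE x in lebesgue. ?F x = F' x"
      by (rule lebesgue_borel_version[OF borel_measurable_integrable[OF F]])
    have F'L: "F' \<in> borel_measurable lebesgue"
      using F'(1) by (simp add: measurable_completion)
    have "integrable lebesgue F'"
      using F F' F'L by (subst integrable_cong_AE[of _ _ ?F]) auto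
    then have F'i: "integrable lborel F'"
      using F'(1) by (simp add: integrable_completion)
    have eq: "(LINT x|lborel. indicator A x *\<^sub>R F' x) = (LINT x|lebesgue. indicator A x *\<^sub>R ?F x)"
      if "A \<in> sets borel" for A
    proof -
      have [measurable]: "A \<in> sets lebesgue" using that by auto
      have "(LINT x|lborel. indicator A x *\<^sub>R F' x) = (LINT x|lebesgue. indicator A x *\<^sub>R F' x)"
        using that F' by (intro integral_completion[symmetric]) (auto intro!: borel_measurable_scaleR)
      also have "\<dots> = (LINT x|lebesgue. indicator A x *\<^sub>R ?F x)"
      proof (rule integral_cong_AE)
        show "(\<lambda>x. indicator A x *\<^sub>R F' x) \<in> borel_measurable lebesgue"
          by (rule borel_measurable_scaleR[OF _ F'L]) (auto intro!: borel_measurable_indicator)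
        show "(\<lambda>x. indicator A x *\<^sub>R ?F x) \<in> borel_measurable lebesgue"
          by (rule borel_measurable_scaleR[OF _ borel_measurable_integrable[OF F]])
            (auto intro!: borel_measurable_indicator)
        show "AE x in lebesgue. indicator A x *\<^sub>R F' x = indicator A x *\<^sub>R ?F x"
          using F'(2) by eventually_elim (simp only:)
      qed
      finally show ?thesis .
    qed
    have "AE x in lborel. F' x = 0"
    proof (rule integral_boxes_eq_0_imp_AE_0[OF F'i])
      show "integral\<^sup>L lborel F' = 0"
        using eq[of UNIV] integral_box_eq_0[OF v \<Omega>L test sub] by simp
      fix c e
      let ?a = "\<Sum>i\<in>Basis. max (c \<bullet> i) (a \<bullet> i) *\<^sub>R i" and ?d = "\<Sum>i\<in>Basis. min (e \<bullet> i) (d \<bullet> i) *\<^sub>R i"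
      have "cbox ?a ?d = cbox c e \<inter> cbox a d" by (simp add: Int_interval)
      then have "(LINT x|lebesgue. indicator (box ?a ?d) x *\<^sub>R v x) = 0"
        using sub by (intro integral_box_eq_0[OF v \<Omega>L test]) auto
      moreover have "box ?a ?d = box c e \<inter> box a d" by (simp add: box_Int_box)
      ultimately have "(LINT x|lebesgue. indicator (box c e) x *\<^sub>R ?F x) = 0"
        by (simp add: indicator_inter_arith)
      then show "(LINT x|lborel. indicator (box c e) x *\<^sub>R F' x) = 0"
        using eq by simp
    qed
    from AE_completion[OF this] F'(2) AE_cbox_box show ?thesis
      by eventually_elim (auto simp: indicator_def split: if_splits)
  qed
  obtain D where D: "countable D" "D \<subseteq> Pow \<Omega>" "\<And>X. X \<in> D \<Longrightarrow> \<exists>a b. X = cbox a b" "\<Union>D = \<Omega>"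
    using open_countable_Union_open_cbox[OF \<Omega>] by metis
  have "AE x in lebesgue. \<forall>X\<in>D. x \<in> X \<longrightarrow> v x = 0"
  proof (subst AE_ball_countable[OF D(1)], intro ballI)
    fix X assume "X \<in> D"
    then obtain a b where "X = cbox a b" "cbox a b \<subseteq> \<Omega>" using D by blast
    then show "AE x in lebesgue. x \<in> X \<longrightarrow> v x = 0" using * by blast
  qed
  then show ?thesis
    by eventually_elim (use D(4) in auto)
qed

section \<open>Integration by parts along a direction\<close>

lemma lborel_integral_translate:
  fixes g :: "'a::euclidean_space \<Rightarrow> 'b::{banach,second_countable_topology}"
  assumes "g \<in> borel_measurable borel"
  shows "(LINT x|lborel. g (x + h)) = integral\<^sup>L lborel g"
proof -
  have "integral\<^sup>L lborel g = integral\<^sup>L (distr lborel borel ((+) h)) g"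
    by (simp add: lborel_distr_plus)
  also have "\<dots> = (LINT x|lborel. g (h + x))"
    using assms by (intro integral_distr) auto
  finally show ?thesis by (simp add: add.commute)
qed

lemma integrable_bounded_support:
  fixes f :: "'a::euclidean_space \<Rightarrow> 'b::{banach,second_countable_topology}"
  assumes f: "f \<in> borel_measurable borel" and b: "\<And>z. norm (f z) \<le> B"
    and supp: "\<And>z. r < norm z \<Longrightarrow> f z = 0"
  shows "integrable lborel f"
proof (rule Bochner_Integration.integrable_bound)
  show "integrable lborel (\<lambda>z. B * indicator (cball (0::'a) r) z)"
    by (intro integrable_mult_right integrable_real_indicator emeasure_bounded_finite) auto
  show "AE x in lborel. norm (f x) \<le> norm (B * indicator (cball 0 r) x)"
  proof (rule AE_I2)
    fix x
    show "norm (f x) \<le> norm (B * indicator (cball 0 r) x)"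
      using b[of x] supp[of x] by (cases "norm x \<le> r") auto
  qed
qed (use f in auto)

lemma compact_support_radius:
  fixes \<psi> :: "'a::euclidean_space \<Rightarrow> real"
  assumes "compact (closure {x. \<psi> x \<noteq> 0})"
  obtains r where "0 < r" "\<And>x. r < norm x \<Longrightarrow> \<psi> x = 0"
proof -
  obtain r where "0 < r" "\<forall>x\<in>closure {x. \<psi> x \<noteq> 0}. norm x \<le> r"
    using compact_imp_bounded[OF assms] bounded_pos by blast
  moreover from this have "\<psi> x = 0" if "r < norm x" for x
    using that closure_subset[of "{x. \<psi> x \<noteq> 0}"] by force
  ultimately show ?thesis using that by blast
qed

lemma frechet_derivative_outside_support:
  fixes \<psi> :: "'a::euclidean_space \<Rightarrow> real"
  assumes "\<And>x. r < norm x \<Longrightarrow> \<psi> x = 0" "r < norm x"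
  shows "frechet_derivative \<psi> (at x) b = 0"
proof -
  have "open {x::'a. r < norm x}"
    by (intro open_Collect_less continuous_intros)
  then have "(\<psi> has_derivative (\<lambda>_. 0)) (at x)"
    using assms by (intro has_derivative_transform_within_open[OF has_derivative_const[of 0]]) auto
  then show ?thesis
    using frechet_derivative_at by metis
qed

lemma continuous_bounded_support:
  fixes g :: "'a::euclidean_space \<Rightarrow> real"
  assumes "continuous_on UNIV g" "\<And>x. r < norm x \<Longrightarrow> g x = 0"
  obtains M where "0 \<le> M" "\<And>x. \<bar>g x\<bar> \<le> M"
proof -
  have "bounded (g ` cball 0 r)"
    using assms(1) by (intro compact_imp_bounded compact_continuous_image)
      (auto intro: continuous_on_subset)
  then obtain M where "0 < M" "\<forall>y\<in>g ` cball 0 r. norm y \<le> M"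
    using bounded_pos by metis
  then have "\<bar>g x\<bar> \<le> M" for x
    using assms(2)[of x] by (cases "norm x \<le> r") auto
  then show ?thesis using that \<open>0 < M\<close> by (meson less_imp_le)
qed

definition locally_bounded :: "('a::real_normed_vector \<Rightarrow> 'b::real_normed_vector) \<Rightarrow> bool" where
  "locally_bounded K \<longleftrightarrow> (\<forall>r. \<exists>B\<ge>0. \<forall>x. norm x \<le> r \<longrightarrow> norm (K x) \<le> B)"

lemma line_has_derivative:
  fixes \<psi> :: "'a::euclidean_space \<Rightarrow> real"
  assumes "smooth \<psi>"
  shows "((\<lambda>t. \<psi> (x + t *\<^sub>R e)) has_field_derivative frechet_derivative \<psi> (at (x + t *\<^sub>R e)) e) (at t)"
proof -
  have d: "(\<psi> has_derivative frechet_derivative \<psi> (at y)) (at y)" for y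
    using smooth_differentiable[OF assms] frechet_derivative_works by blast
  have "((\<lambda>t. x + t *\<^sub>R e) has_derivative (\<lambda>h. h *\<^sub>R e)) (at t)"
    by (auto intro!: derivative_eq_intros)
  from has_derivative_compose[OF this d]
  have "((\<lambda>t. \<psi> (x + t *\<^sub>R e)) has_derivative (\<lambda>h. frechet_derivative \<psi> (at (x + t *\<^sub>R e)) (h *\<^sub>R e))) (at t)" .
  moreover have "frechet_derivative \<psi> (at (x + t *\<^sub>R e)) (h *\<^sub>R e) = frechet_derivative \<psi> (at (x + t *\<^sub>R e)) e * h" for h
    using linear_cmul[OF has_derivative_linear[OF d]] by (simp add: mult.commute)
  ultimately show ?thesis
    by (simp add: has_field_derivative_def)
qed

text \<open>The difference quotients of \<open>\<psi>\<close> are tested against \<open>K\<close>. Translation invariance of the Lebesgue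
  measure moves the difference over to \<open>K\<close>, where by \<open>line\<close> it is an average of \<open>L\<close>, and both sides
  converge by dominated convergence. Only increments of \<open>K\<close> enter, so \<open>L\<close> may be discontinuous.\<close>

lemma integral_by_parts_direction:
  fixes K L :: "'a::euclidean_space \<Rightarrow> complex" and \<psi> :: "'a \<Rightarrow> real"
  assumes K [measurable]: "K \<in> borel_measurable borel" and L [measurable]: "L \<in> borel_measurable borel"
    and bK: "locally_bounded K" and bL: "locally_bounded L"
    and line: "\<And>x h. K (x + h *\<^sub>R e) - K x = h *\<^sub>R (LINT s|lborel. indicator {0..1} s *\<^sub>R L (x + (s * h) *\<^sub>R e))"
    and \<psi>: "smooth \<psi>" "compact (closure {x. \<psi> x \<noteq> 0})" and e: "e \<in> Basis"
  shows "(LINT x|lborel. frechet_derivative \<psi> (at x) e *\<^sub>R K x) = - (LINT x|lborel. \<psi> x *\<^sub>R L x)"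
proof -
  define D where "D = (\<lambda>x. frechet_derivative \<psi> (at x) e)"
  have sD: "smooth D" unfolding D_def by (rule smooth_partial[OF \<psi>(1) e])
  have cont: "continuous_on UNIV \<psi>" "continuous_on UNIV D"
    using \<psi>(1) sD smooth_continuous by blast+
  note [measurable] = cont[THEN borel_measurable_continuous_onI]
  obtain r where r: "0 < r" "\<And>x. r < norm x \<Longrightarrow> \<psi> x = 0"
    using compact_support_radius[OF \<psi>(2)] by blast
  have rD: "D x = 0" if "r < norm x" for x
    unfolding D_def by (rule frechet_derivative_outside_support[of r \<psi>, OF r(2) that])
  obtain M0 where M0: "0 \<le> M0" "\<And>x. \<bar>\<psi> x\<bar> \<le> M0"
    using continuous_bounded_support[OF cont(1) r(2)] by blast
  obtain M1 where M1: "0 \<le> M1" "\<And>x. \<bar>D x\<bar> \<le> M1"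
    using continuous_bounded_support[OF cont(2) rD] by blast
  obtain BK where BK: "0 \<le> BK" "\<And>x. norm x \<le> r + 1 \<Longrightarrow> norm (K x) \<le> BK"
    using bK unfolding locally_bounded_def by meson
  obtain BL where BL: "0 \<le> BL" "\<And>x. norm x \<le> r + 2 \<Longrightarrow> norm (L x) \<le> BL"
    using bL unfolding locally_bounded_def by meson
  define h where "h = (\<lambda>n. inverse (real (Suc n)))"
  have h: "0 < h n" "h n \<le> 1" for n
    unfolding h_def by (auto simp: field_simps)
  have h0: "h \<longlonglongrightarrow> 0"
    unfolding h_def by (rule LIMSEQ_inverse_real_of_nat)
  have ne: "norm e = 1" using e by simp
  have shift: "norm x \<le> norm (x + t *\<^sub>R e) + 1" if "\<bar>t\<bar> \<le> 1" for x t
    using norm_triangle_ineq4[of "x + t *\<^sub>R e" "t *\<^sub>R e"] that by (simp add: ne)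
  have shift': "norm (x + t *\<^sub>R e) \<le> norm x + 1" if "\<bar>t\<bar> \<le> 1" for x t
    using norm_triangle_ineq[of x "t *\<^sub>R e"] that by (simp add: ne)
  define q where "q = (\<lambda>n x. (\<psi> (x + h n *\<^sub>R e) - \<psi> x) / h n)"
  have [measurable]: "q n \<in> borel_measurable borel" for n
    unfolding q_def by measurable
  have q_bound: "\<bar>q n x\<bar> \<le> M1" for n x
  proof -
    obtain z where "\<psi> (x + h n *\<^sub>R e) - \<psi> (x + 0 *\<^sub>R e) = (h n - 0) * D (x + z *\<^sub>R e)"
      using MVT2[OF h(1)[of n], of "\<lambda>t. \<psi> (x + t *\<^sub>R e)" "\<lambda>t. D (x + t *\<^sub>R e)"]
        line_has_derivative[OF \<psi>(1)] unfolding D_def by blast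
    then have "q n x = D (x + z *\<^sub>R e)"
      using h(1)[of n] by (simp add: q_def)
    then show ?thesis using M1(2) by simp
  qed
  have q_supp: "q n x = 0" if "r + 1 < norm x" for n x
  proof -
    have "r < norm (x + h n *\<^sub>R e)" "r < norm x"
      using shift[of "h n" x] h[of n] that by auto
    then show ?thesis using r(2) by (simp add: q_def)
  qed
  have q_lim: "(\<lambda>n. q n x) \<longlonglongrightarrow> D x" for x
  proof -
    have "((\<lambda>t. (\<psi> (x + (0 + t) *\<^sub>R e) - \<psi> (x + 0 *\<^sub>R e)) / t) \<longlongrightarrow> D x) (at 0)"
      using line_has_derivative[OF \<psi>(1), of x e 0] unfolding D_def DERIV_def by simp
    moreover have "filterlim h (at 0) sequentially"
      using h0 h(1) by (auto simp: filterlim_at less_imp_neq[symmetric] eventually_sequentially)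
    ultimately have "(\<lambda>n. (\<psi> (x + (0 + h n) *\<^sub>R e) - \<psi> (x + 0 *\<^sub>R e)) / h n) \<longlonglongrightarrow> D x"
      by (rule filterlim_compose)
    then show ?thesis by (simp add: q_def)
  qed
  have lim1: "(\<lambda>n. LINT x|lborel. q n x *\<^sub>R K x) \<longlonglongrightarrow> (LINT x|lborel. D x *\<^sub>R K x)"
  proof (rule integral_dominated_convergence)
    show "integrable lborel (\<lambda>x. M1 * BK * indicator (cball (0::'a) (r + 1)) x)"
      by (intro integrable_mult_right integrable_real_indicator emeasure_bounded_finite) auto
    show "AE x in lborel. (\<lambda>n. q n x *\<^sub>R K x) \<longlonglongrightarrow> D x *\<^sub>R K x"
      by (intro AE_I2 tendsto_intros q_lim)
    show "AE x in lborel. norm (q n x *\<^sub>R K x) \<le> M1 * BK * indicator (cball (0::'a) (r + 1)) x" for n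
    proof (rule AE_I2)
      fix x
      show "norm (q n x *\<^sub>R K x) \<le> M1 * BK * indicator (cball (0::'a) (r + 1)) x"
        using q_bound[of n x] q_supp[of x n] BK M1(1)
        by (cases "norm x \<le> r + 1") (auto intro!: mult_mono)
    qed
  qed measurable
  \<comment> \<open>After moving the shift from \<open>K\<close> to \<open>L\<close>, the quotient tested against \<open>K\<close> becomes the integral of \<open>F n\<close>;
    \<open>G n\<close> arises from it by the translation that removes the shift from \<open>L\<close>, so that only the
    continuous \<open>\<psi>\<close> depends on \<open>n\<close>.\<close>
  define G where "G = (\<lambda>n x s. indicator {0..1::real} s *\<^sub>R (\<psi> (x + ((1 - s) * h n) *\<^sub>R e) *\<^sub>R L x))"
  define F where "F = (\<lambda>n x s. indicator {0..1::real} s *\<^sub>R (\<psi> (x + h n *\<^sub>R e) *\<^sub>R L (x + (s * h n) *\<^sub>R e)))"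
  have small: "\<bar>(1 - s) * h n\<bar> \<le> 1" "\<bar>s * h n\<bar> \<le> 1" if "0 \<le> s" "s \<le> 1" for s n
    using that h[of n] by (auto simp: abs_mult intro!: mult_le_one)
  have Lb: "norm (\<psi> y *\<^sub>R L x) \<le> M0 * BL" if "norm x \<le> norm y + 1 \<or> norm x \<le> r + 2" for x y
  proof (cases "norm y \<le> r")
    case True
    then have "norm (L x) \<le> BL" using that by (intro BL(2)) auto
    then show ?thesis using M0 BL(1) by (auto intro!: mult_mono)
  qed (use r M0 BL in auto)
  have F_bound: "norm (F n x s) \<le> M0 * BL" for n x s
  proof (cases "s \<in> {0..1}")
    case True
    have "norm (x + (s * h n) *\<^sub>R e) \<le> norm (x + h n *\<^sub>R e) + 1"
    proof -
      have "x + h n *\<^sub>R e = (x + (s * h n) *\<^sub>R e) + ((1 - s) * h n) *\<^sub>R e"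
        by (simp add: algebra_simps)
      moreover have "\<bar>(1 - s) * h n\<bar> \<le> 1" using small True by auto
      ultimately show ?thesis using shift[of "(1 - s) * h n" "x + (s * h n) *\<^sub>R e"] by (simp only:)
    qed
    then have "norm (\<psi> (x + h n *\<^sub>R e) *\<^sub>R L (x + (s * h n) *\<^sub>R e)) \<le> M0 * BL"
      by (intro Lb) auto
    then show ?thesis using True by (simp add: F_def)
  qed (simp add: F_def M0 BL)
  have G_bound: "norm (G n x s) \<le> M0 * BL" for n x s
  proof (cases "s \<in> {0..1}")
    case True
    then have "norm (\<psi> (x + ((1 - s) * h n) *\<^sub>R e) *\<^sub>R L x) \<le> M0 * BL"
      using shift small by (intro Lb) auto
    then show ?thesis using True by (simp add: G_def)
  qed (simp add: G_def M0 BL)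
  have supp0: "\<not> (r + 2 < norm (x, s) \<and> s \<in> {0..1} \<and> norm x \<le> r + 1)" for x :: 'a and s :: real
    using norm_Pair_le[of x s] by auto
  have F_supp: "F n x s = 0" and G_supp: "G n x s = 0" if "r + 2 < norm (x, s)" for n x s
  proof -
    have *: "s \<notin> {0..1} \<or> r + 1 < norm x" using supp0[of x s] that by auto
    have zero: "\<psi> (x + t *\<^sub>R e) = 0" if "r + 1 < norm x" "\<bar>t\<bar> \<le> 1" for t
      using shift[of t x] that by (intro r(2)) auto
    show "F n x s = 0" "G n x s = 0"
    proof -
      have "\<psi> (x + ((1 - s) * h n) *\<^sub>R e) = 0" "\<psi> (x + h n *\<^sub>R e) = 0" if "s \<in> {0..1}"
        using * that small(1)[of s n] h[of n] by (intro zero; simp)+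
      then show "F n x s = 0" "G n x s = 0"
        by (auto simp: F_def G_def indicator_def)
    qed
  qed
  have [measurable]: "(\<lambda>z. F n (fst z) (snd z)) \<in> borel_measurable borel"
    "(\<lambda>z. G n (fst z) (snd z)) \<in> borel_measurable borel" for n
    unfolding F_def G_def borel_prod[symmetric] by measurable
  have Fi: "integrable (lborel \<Otimes>\<^sub>M lborel) (\<lambda>(x, s). F n x s)" for n
    unfolding lborel_prod case_prod_beta
    using F_bound F_supp by (intro integrable_bounded_support[where r="r + 2"]) auto
  have Gi: "integrable (lborel \<Otimes>\<^sub>M lborel) (\<lambda>(x, s). G n x s)" for n
    unfolding lborel_prod case_prod_beta
    using G_bound G_supp by (intro integrable_bounded_support[where r="r + 2"]) auto
  have ibd: "integrable lborel (\<lambda>x. \<psi> (x + t *\<^sub>R e) *\<^sub>R K x)" if "\<bar>t\<bar> \<le> 1" for t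
  proof (rule integrable_bounded_support[where r="r + 1" and B="M0 * BK"])
    fix x
    have z: "\<psi> (x + t *\<^sub>R e) = 0" if "r + 1 < norm x"
      using shift[OF \<open>\<bar>t\<bar> \<le> 1\<close>, of x] that by (intro r(2)) auto
    then show "r + 1 < norm x \<Longrightarrow> \<psi> (x + t *\<^sub>R e) *\<^sub>R K x = 0" by simp
    show "norm (\<psi> (x + t *\<^sub>R e) *\<^sub>R K x) \<le> M0 * BK"
      using z BK M0 by (cases "norm x \<le> r + 1") (auto intro!: mult_mono)
  qed measurable
  have eq: "(LINT x|lborel. q n x *\<^sub>R K x) = - (LINT z|lborel. G n (fst z) (snd z))" for n
  proof -
    let ?e = "h n *\<^sub>R e"
    have i1: "integrable lborel (\<lambda>x. \<psi> (x + ?e) *\<^sub>R K x)" "integrable lborel (\<lambda>x. \<psi> x *\<^sub>R K x)"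
      using ibd[of "h n"] ibd[of 0] h[of n] by auto
    have i2: "integrable lborel (\<lambda>x. \<psi> (x + ?e) *\<^sub>R K (x + ?e))"
    proof (rule integrable_bounded_support[where r="r + 1" and B="M0 * BK"])
      fix x
      have z: "\<psi> (x + ?e) = 0" if "r < norm (x + ?e)"
        using that by (intro r(2)) auto
      then show "r + 1 < norm x \<Longrightarrow> \<psi> (x + ?e) *\<^sub>R K (x + ?e) = 0"
        using shift[of "h n" x] h[of n] by auto
      show "norm (\<psi> (x + ?e) *\<^sub>R K (x + ?e)) \<le> M0 * BK"
        using z BK M0 by (cases "norm (x + ?e) \<le> r") (auto intro!: mult_mono)
    qed measurable
    have "(LINT x|lborel. q n x *\<^sub>R K x) = (LINT x|lborel. (1 / h n) *\<^sub>R (\<psi> (x + ?e) *\<^sub>R K x - \<psi> x *\<^sub>R K x))"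
      by (intro Bochner_Integration.integral_cong) (auto simp: q_def algebra_simps divide_inverse scaleR_diff_left)
    also have "\<dots> = (1 / h n) *\<^sub>R ((LINT x|lborel. \<psi> (x + ?e) *\<^sub>R K x) - (LINT x|lborel. \<psi> x *\<^sub>R K x))"
      using i1 by (simp only: integral_scaleR_right Bochner_Integration.integral_diff)
    also have "(LINT x|lborel. \<psi> x *\<^sub>R K x) = (LINT x|lborel. \<psi> (x + ?e) *\<^sub>R K (x + ?e))"
      by (rule lborel_integral_translate[symmetric]) measurable
    also have "(LINT x|lborel. \<psi> (x + ?e) *\<^sub>R K x) - \<dots> = (LINT x|lborel. \<psi> (x + ?e) *\<^sub>R K x - \<psi> (x + ?e) *\<^sub>R K (x + ?e))"
      using i1 i2 by (simp only: Bochner_Integration.integral_diff)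
    also have "\<dots> = (LINT x|lborel. (- h n) *\<^sub>R (LINT s|lborel. F n x s))"
    proof (intro Bochner_Integration.integral_cong refl)
      fix x
      have "\<psi> (x + ?e) *\<^sub>R K x - \<psi> (x + ?e) *\<^sub>R K (x + ?e) = - (\<psi> (x + ?e) *\<^sub>R (K (x + ?e) - K x))"
        by (simp add: algebra_simps)
      also have "\<dots> = (- h n) *\<^sub>R (\<psi> (x + ?e) *\<^sub>R (LINT s|lborel. indicator {0..1} s *\<^sub>R L (x + (s * h n) *\<^sub>R e)))"
        unfolding line by simp
      also have "\<psi> (x + ?e) *\<^sub>R (LINT s|lborel. indicator {0..1} s *\<^sub>R L (x + (s * h n) *\<^sub>R e)) = (LINT s|lborel. F n x s)"
        unfolding F_def integral_scaleR_right[symmetric]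
        by (intro Bochner_Integration.integral_cong) (auto simp: mult.commute)
      finally show "\<psi> (x + ?e) *\<^sub>R K x - \<psi> (x + ?e) *\<^sub>R K (x + ?e) = (- h n) *\<^sub>R (LINT s|lborel. F n x s)" .
    qed
    also have "\<dots> = (- h n) *\<^sub>R (LINT x|lborel. LINT s|lborel. F n x s)"
      by (rule integral_scaleR_right)
    also have "(1 / h n) *\<^sub>R ((- h n) *\<^sub>R (LINT x|lborel. LINT s|lborel. F n x s)) = - (LINT x|lborel. LINT s|lborel. F n x s)"
      using h(1)[of n] by simp
    also have "(LINT x|lborel. LINT s|lborel. F n x s) = (LINT s|lborel. LINT x|lborel. F n x s)"
      by (rule lborel_pair.Fubini_integral[OF Fi, symmetric])
    also have "\<dots> = (LINT s|lborel. LINT x|lborel. G n x s)"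
    proof (rule Bochner_Integration.integral_cong[OF refl])
      fix s :: real
      have "(\<lambda>y. G n y s) \<in> borel_measurable borel"
        unfolding G_def by measurable
      from lborel_integral_translate[OF this, of "(s * h n) *\<^sub>R e"]
      have "(LINT x|lborel. G n (x + (s * h n) *\<^sub>R e) s) = (LINT x|lborel. G n x s)" .
      moreover have "F n x s = G n (x + (s * h n) *\<^sub>R e) s" for x
      proof -
        have "x + (s * h n) *\<^sub>R e + ((1 - s) * h n) *\<^sub>R e = x + h n *\<^sub>R e"
          by (simp add: algebra_simps)
        then show ?thesis by (simp only: F_def G_def)
      qed
      ultimately show "(LINT x|lborel. F n x s) = (LINT x|lborel. G n x s)"
        by simp
    qed
    also have "\<dots> = (LINT z|lborel. G n (fst z) (snd z))"
      using lborel_pair.integral_snd[OF Gi[of n]] by (simp add: lborel_prod case_prod_unfold)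
    finally show ?thesis .
  qed
  have lim2: "(\<lambda>n. LINT z|lborel. G n (fst z) (snd z)) \<longlonglongrightarrow>
     (LINT z|lborel. indicator {0..1::real} (snd z) *\<^sub>R (\<psi> (fst z) *\<^sub>R L (fst z)))"
  proof (rule integral_dominated_convergence)
    show "integrable lborel (\<lambda>z::'a\<times>real. M0 * BL * indicator (cball 0 (r + 2)) z)"
      by (intro integrable_mult_right integrable_real_indicator emeasure_bounded_finite) auto
    show "AE z in lborel. (\<lambda>n. G n (fst z) (snd z)) \<longlonglongrightarrow> indicator {0..1::real} (snd z) *\<^sub>R (\<psi> (fst z) *\<^sub>R L (fst z))"
    proof (rule AE_I2)
      fix z :: "'a \<times> real"
      have "(\<lambda>n. fst z + ((1 - snd z) * h n) *\<^sub>R e) \<longlonglongrightarrow> fst z + ((1 - snd z) * 0) *\<^sub>R e"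
        by (intro tendsto_intros h0)
      then have "(\<lambda>n. \<psi> (fst z + ((1 - snd z) * h n) *\<^sub>R e)) \<longlonglongrightarrow> \<psi> (fst z)"
        using cont(1) by (intro continuous_on_tendsto_compose[OF cont(1)]) auto
      then show "(\<lambda>n. G n (fst z) (snd z)) \<longlonglongrightarrow> indicator {0..1::real} (snd z) *\<^sub>R (\<psi> (fst z) *\<^sub>R L (fst z))"
        unfolding G_def by (intro tendsto_intros)
    qed
    show "AE z in lborel. norm (G n (fst z) (snd z)) \<le> M0 * BL * indicator (cball 0 (r + 2)) z" for n
    proof (rule AE_I2)
      fix z :: "'a \<times> real"
      show "norm (G n (fst z) (snd z)) \<le> M0 * BL * indicator (cball 0 (r + 2)) z"
        using G_bound[of n "fst z" "snd z"] G_supp[of "fst z" "snd z" n]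
        by (cases "norm z \<le> r + 2") auto
    qed
    show "(\<lambda>z. indicator {0..1::real} (snd z) *\<^sub>R (\<psi> (fst z) *\<^sub>R L (fst z))) \<in> borel_measurable lborel"
      unfolding lborel_prod[symmetric] by measurable
  qed measurable
  have "(LINT z|lborel. indicator {0..1::real} (snd z) *\<^sub>R (\<psi> (fst z) *\<^sub>R L (fst z))) = (LINT x|lborel. \<psi> x *\<^sub>R L x)"
  proof -
    have "integrable lborel (\<lambda>z. indicator {0..1::real} (snd z) *\<^sub>R (\<psi> (fst z) *\<^sub>R L (fst z)))"
    proof (rule integrable_bounded_support[where r="r + 2" and B="M0 * BL"])
      show "(\<lambda>z. indicator {0..1::real} (snd z) *\<^sub>R (\<psi> (fst z) *\<^sub>R L (fst z))) \<in> borel_measurable borel"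
        unfolding borel_prod[symmetric] by measurable
      fix z :: "'a \<times> real"
      have *: "norm (\<psi> (fst z) *\<^sub>R L (fst z)) \<le> M0 * BL"
        by (rule Lb) simp
      then show "norm (indicator {0..1::real} (snd z) *\<^sub>R (\<psi> (fst z) *\<^sub>R L (fst z))) \<le> M0 * BL"
        using M0 BL unfolding norm_scaleR[of "indicator _ _"] by (auto simp: indicator_def)
      show "indicator {0..1::real} (snd z) *\<^sub>R (\<psi> (fst z) *\<^sub>R L (fst z)) = 0" if "r + 2 < norm z"
        using supp0[of "fst z" "snd z"] that r(2)[of "fst z"] by (auto simp: indicator_def)
    qed
    then have i: "integrable (lborel \<Otimes>\<^sub>M lborel) (\<lambda>(x, s). indicator {0..1::real} s *\<^sub>R (\<psi> x *\<^sub>R L x))"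
      by (simp add: lborel_prod case_prod_unfold)
    have "(LINT z|lborel. indicator {0..1::real} (snd z) *\<^sub>R (\<psi> (fst z) *\<^sub>R L (fst z))) =
        (LINT s|lborel. LINT x|lborel. indicator {0..1::real} s *\<^sub>R (\<psi> x *\<^sub>R L x))"
      using lborel_pair.integral_snd[OF i] by (simp add: lborel_prod case_prod_unfold)
    also have "\<dots> = (LINT s|lborel. indicator {0..1::real} s *\<^sub>R (LINT x|lborel. \<psi> x *\<^sub>R L x))"
      by (simp only: integral_scaleR_right)
    also have "\<dots> = (LINT x|lborel. \<psi> x *\<^sub>R L x)"
      by simp
    finally show ?thesis .
  qed
  then have "(\<lambda>n. LINT x|lborel. q n x *\<^sub>R K x) \<longlonglongrightarrow> - (LINT x|lborel. \<psi> x *\<^sub>R L x)"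
    using tendsto_minus[OF lim2] by (simp add: eq)
  with lim1 show ?thesis
    using LIMSEQ_unique unfolding D_def by blast
qed

section \<open>Absolutely continuous representatives on the line\<close>

lemma locally_integrable_mult_test:
  fixes g :: "'a::euclidean_space \<Rightarrow> complex"
  assumes g: "locally_integrable \<Omega> g" and \<psi>: "continuous_on UNIV \<psi>"
    and K: "compact (closure {x. \<psi> x \<noteq> 0})" "closure {x. \<psi> x \<noteq> 0} \<subseteq> \<Omega>"
  shows "integrable lebesgue (\<lambda>x. \<psi> x *\<^sub>R g x)"
proof -
  let ?K = "closure {x. \<psi> x \<noteq> 0}"
  have i: "integrable lebesgue (\<lambda>x. indicator ?K x *\<^sub>R g x)"
    using g K unfolding locally_integrable_def set_integrable_def by blast
  obtain r where r: "0 < r" "\<And>x. r < norm x \<Longrightarrow> \<psi> x = 0"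
    using compact_support_radius[OF K(1)] by blast
  obtain M where M: "0 \<le> M" "\<And>x. \<bar>\<psi> x\<bar> \<le> M"
    using continuous_bounded_support[OF \<psi> r(2)] by blast
  have "\<psi> \<in> borel_measurable borel"
    by (rule borel_measurable_continuous_onI[OF \<psi>])
  then have m: "\<psi> \<in> borel_measurable lebesgue"
    by (simp add: measurable_completion)
  have z: "\<psi> x *\<^sub>R (indicator ?K x *\<^sub>R g x) = \<psi> x *\<^sub>R g x" for x
    using closure_subset[of "{x. \<psi> x \<noteq> 0}"] by (cases "\<psi> x = 0") auto
  have "integrable lebesgue (\<lambda>x. \<psi> x *\<^sub>R (indicator ?K x *\<^sub>R g x))"
  proof (rule Bochner_Integration.integrable_bound)
    show "integrable lebesgue (\<lambda>x. M *\<^sub>R (indicator ?K x *\<^sub>R g x))"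
      by (rule integrable_scaleR_right[OF i])
    show "(\<lambda>x. \<psi> x *\<^sub>R (indicator ?K x *\<^sub>R g x)) \<in> borel_measurable lebesgue"
      by (rule borel_measurable_scaleR[OF m borel_measurable_integrable[OF i]])
    show "AE x in lebesgue. norm (\<psi> x *\<^sub>R (indicator ?K x *\<^sub>R g x)) \<le> norm (M *\<^sub>R (indicator ?K x *\<^sub>R g x))"
    proof (rule AE_I2)
      fix x
      have "\<bar>\<psi> x\<bar> * norm (indicator ?K x *\<^sub>R g x) \<le> \<bar>M\<bar> * norm (indicator ?K x *\<^sub>R g x)"
        using M by (intro mult_right_mono) auto
      then show "norm (\<psi> x *\<^sub>R (indicator ?K x *\<^sub>R g x)) \<le> norm (M *\<^sub>R (indicator ?K x *\<^sub>R g x))"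
        by (simp only: norm_scaleR)
    qed
  qed
  then show ?thesis by (simp only: z)
qed

text \<open>The antiderivative that vanishes to the left of the support also vanishes to the right of it,
  because \<open>\<tau>\<close> has integral 0.\<close>

lemma test_function_antiderivative:
  fixes \<tau> :: "real \<Rightarrow> real"
  assumes \<tau>: "smooth \<tau>" and r: "\<And>x. r < norm x \<Longrightarrow> \<tau> x = 0" and int0: "integral\<^sup>L lborel \<tau> = 0"
  obtains \<eta> where "test_function UNIV \<eta>" "\<And>x. frechet_derivative \<eta> (at x) 1 = \<tau> x"
proof -
  define R where "R = \<bar>r\<bar>"
  have R: "\<tau> x = 0" if "R < \<bar>x\<bar>" for x
    using that r by (auto simp: R_def)
  have c: "continuous_on UNIV \<tau>" by (rule smooth_continuous[OF \<tau>])
  have "\<exists>F. \<forall>x::real. - \<infinity> < ereal x \<longrightarrow> ereal x < \<infinity> \<longrightarrow> (F has_vector_derivative \<tau> x) (at x)"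
    using c by (intro einterval_antiderivative) (auto simp: continuous_on_eq_continuous_at)
  then obtain F where F: "\<And>x. (F has_vector_derivative \<tau> x) (at x)" by auto
  define \<eta> where "\<eta> x = F x - F (- R - 1)" for x
  have d: "(\<eta> has_field_derivative \<tau> x) (at x)" for x
    unfolding \<eta>_def has_real_derivative_iff_has_vector_derivative
    using F by (auto intro!: derivative_eq_intros)
  have ftc: "(LINT t|lborel. indicator {x..y} t *\<^sub>R \<tau> t) = \<eta> y - \<eta> x" if "x \<le> y" for x y
    using that d continuous_on_subset[OF c]
    by (intro integral_FTC_Icc) (auto simp: has_real_derivative_iff_has_vector_derivative
        intro: has_vector_derivative_at_within)
  have \<eta>0: "\<eta> x = 0" if x: "R + 1 < \<bar>x\<bar>" for x
  proof (cases "x < 0")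
    case True
    have "indicator {x..-R-1} t *\<^sub>R \<tau> t = 0" for t
      using R[of t] by (auto simp: indicator_def)
    then have "\<eta> (-R-1) - \<eta> x = 0"
      using ftc[of x "-R-1"] True x by (simp only: integral_zero)
    then show ?thesis by (simp add: \<eta>_def)
  next
    case False
    have "indicator {-R-1..x} t *\<^sub>R \<tau> t = \<tau> t" for t
      using R[of t] x False by (cases "\<bar>t\<bar> \<le> R") (auto simp: indicator_def)
    then have "(LINT t|lborel. indicator {-R-1..x} t *\<^sub>R \<tau> t) = 0"
      using int0 by (simp only:)
    then have "\<eta> x - \<eta> (-R-1) = 0"
      using ftc[of "-R-1" x] False x by (simp add: R_def)
    then show ?thesis by (simp add: \<eta>_def)
  qed
  have f1: "frechet_derivative \<eta> (at x) 1 = \<tau> x" for x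
    using frechet_derivative_at[OF d[of x, unfolded has_field_derivative_def]] by (metis mult.right_neutral)
  have "smooth \<eta>"
    unfolding smooth_def
  proof (intro allI impI)
    fix bs :: "real list" and x assume bs: "set bs \<subseteq> Basis"
    show "iter_partial bs \<eta> differentiable (at x)"
    proof (cases bs rule: rev_cases)
      case Nil
      then show ?thesis using d real_differentiable_def by auto
    next
      case (snoc cs b)
      then have "b = 1" "set cs \<subseteq> Basis" using bs by auto
      then show ?thesis
        using snoc \<tau> by (simp add: iter_partial_append f1 smooth_def)
    qed
  qed
  moreover have "closure {x. \<eta> x \<noteq> 0} \<subseteq> {-R-1..R+1}"
  proof (rule closure_minimal)
    show "{x. \<eta> x \<noteq> 0} \<subseteq> {-R-1..R+1}"
      using \<eta>0 by (force simp: not_less)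
  qed simp
  then have "compact (closure {x. \<eta> x \<noteq> 0})"
    by (metis closed_closure compact_Icc compact_Int_closed inf.absorb_iff2)
  ultimately have "test_function UNIV \<eta>"
    by (simp add: test_function_iff)
  then show ?thesis using that f1 by blast
qed

text \<open>Every test function differs from a multiple of one fixed bump by the derivative of a test
  function. Hence \<open>g\<close> acts on test functions like the constant that it yields on that bump.\<close>

lemma du_Bois_Reymond:
  fixes g :: "real \<Rightarrow> complex"
  assumes g: "locally_integrable UNIV g"
    and test: "\<And>\<eta>. test_function UNIV \<eta> \<Longrightarrow> (LINT x|lebesgue. frechet_derivative \<eta> (at x) 1 *\<^sub>R g x) = 0"
  shows "\<exists>c. AE x in lebesgue. g x = c"
proof -
  let ?\<theta> = "box_bump 0 (1::real) 1"
  have t\<theta>: "test_function UNIV ?\<theta>" by (rule test_function_box_bump) simp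
  have test_facts: "continuous_on UNIV \<psi>" "integrable lborel \<psi>" "integrable lebesgue (\<lambda>x. \<psi> x *\<^sub>R g x)"
    "\<exists>r. \<forall>x. r < norm x \<longrightarrow> \<psi> x = 0" "integral\<^sup>L lebesgue \<psi> = integral\<^sup>L lborel \<psi>" "integrable lebesgue \<psi>"
    if t: "test_function UNIV \<psi>" for \<psi> :: "real \<Rightarrow> real"
  proof -
    have t': "smooth \<psi>" "compact (closure {x. \<psi> x \<noteq> 0})" using t by (auto simp: test_function_iff)
    show c: "continuous_on UNIV \<psi>" by (rule smooth_continuous[OF t'(1)])
    show "integrable lebesgue (\<lambda>x. \<psi> x *\<^sub>R g x)"
      by (rule locally_integrable_mult_test[OF g c t'(2)]) simp
    obtain r where r: "0 < r" "\<And>x. r < norm x \<Longrightarrow> \<psi> x = 0"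
      using compact_support_radius[OF t'(2)] by blast
    then show "\<exists>r. \<forall>x. r < norm x \<longrightarrow> \<psi> x = 0" by blast
    obtain M where M: "0 \<le> M" "\<And>x. \<bar>\<psi> x\<bar> \<le> M"
      using continuous_bounded_support[OF c r(2)] by blast
    have m: "\<psi> \<in> borel_measurable borel" by (rule borel_measurable_continuous_onI[OF c])
    then show "integrable lborel \<psi>"
      using M r by (intro integrable_bounded_support) auto
    then show "integrable lebesgue \<psi>" "integral\<^sup>L lebesgue \<psi> = integral\<^sup>L lborel \<psi>"
      using m by (simp_all add: integrable_completion integral_completion)
  qed
  note p\<theta> = test_facts[OF t\<theta>]
  define I0 where "I0 = integral\<^sup>L lborel ?\<theta>"
  have "I0 \<noteq> 0"
  proof
    assume "I0 = 0"
    then have "AE x in lborel. ?\<theta> x = 0"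
      unfolding I0_def using p\<theta>(2) by (subst (asm) integral_nonneg_eq_0_iff_AE) (auto intro!: AE_I2 box_bump_bounds)
    from AE_completion[OF this] have "AE x in lebesgue. x \<in> {0<..<1::real} \<longrightarrow> x \<in> {}"
      by eventually_elim (auto simp: box_bump_def flat_def)
    from mem_closed_if_AE_lebesgue_open[OF _ _ this, of "1/2"] show False by auto
  qed
  define c where "c = (LINT x|lebesgue. ?\<theta> x *\<^sub>R g x) /\<^sub>R I0"
  have "AE x in lebesgue. x \<in> UNIV \<longrightarrow> g x - c = 0"
  proof (rule fundamental_lemma)
    show "locally_integrable UNIV (\<lambda>x. g x - c)"
      using g unfolding locally_integrable_def
      by (auto intro!: set_integral_diff absolutely_integrable_on_const lmeasurable_compact)
    fix \<psi> :: "real \<Rightarrow> real" assume t: "test_function UNIV \<psi>"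
    note p = test_facts[OF t]
    define J where "J = integral\<^sup>L lborel \<psi>"
    define \<tau> where "\<tau> x = 1 * \<psi> x + (- J / I0) * ?\<theta> x" for x
    have "smooth \<tau>"
      using t t\<theta> unfolding \<tau>_def by (intro smooth_lincomb) (auto simp: test_function_iff)
    moreover obtain r1 r2 where "\<forall>x. r1 < norm x \<longrightarrow> \<psi> x = 0" "\<forall>x. r2 < norm x \<longrightarrow> ?\<theta> x = 0"
      using p(4) p\<theta>(4) by blast
    then have "\<tau> x = 0" if "max r1 r2 < norm x" for x
      using that by (simp add: \<tau>_def)
    moreover have "integral\<^sup>L lborel \<tau> = 0"
      unfolding \<tau>_def using p(2) p\<theta>(2) \<open>I0 \<noteq> 0\<close>
      by (subst Bochner_Integration.integral_add) (auto simp: J_def I0_def simp del: One_nat_def)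
    ultimately obtain \<eta> where \<eta>: "test_function UNIV \<eta>" "\<And>x. frechet_derivative \<eta> (at x) 1 = \<tau> x"
      using test_function_antiderivative[of \<tau> "max r1 r2"] by blast
    have "0 = (LINT x|lebesgue. \<tau> x *\<^sub>R g x)"
      using test[OF \<eta>(1)] by (simp add: \<eta>(2))
    also have "\<dots> = (LINT x|lebesgue. \<psi> x *\<^sub>R g x + (- J / I0) *\<^sub>R (?\<theta> x *\<^sub>R g x))"
      by (simp only: \<tau>_def scaleR_add_left scaleR_scaleR mult_1_left)
    also have "\<dots> = (LINT x|lebesgue. \<psi> x *\<^sub>R g x) + (- J / I0) *\<^sub>R (LINT x|lebesgue. ?\<theta> x *\<^sub>R g x)"
      using p(3) p\<theta>(3)
      by (subst Bochner_Integration.integral_add) (simp_all only: integral_scaleR_right integrable_scaleR_right)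
    also have "(- J / I0) *\<^sub>R (LINT x|lebesgue. ?\<theta> x *\<^sub>R g x) = - (J *\<^sub>R c)"
      by (simp add: c_def divide_inverse)
    finally have 1: "(LINT x|lebesgue. \<psi> x *\<^sub>R g x) = J *\<^sub>R c" by simp
    have "(LINT x|lebesgue. \<psi> x *\<^sub>R (g x - c)) = (LINT x|lebesgue. \<psi> x *\<^sub>R g x - \<psi> x *\<^sub>R c)"
      by (simp add: scaleR_diff_right)
    also have "\<dots> = (LINT x|lebesgue. \<psi> x *\<^sub>R g x) - (LINT x|lebesgue. \<psi> x *\<^sub>R c)"
      using p(3) p(6) by (intro Bochner_Integration.integral_diff) auto
    also have "\<dots> = 0"
      using p(5,6) 1 by (simp add: J_def)
    finally show "(LINT x|lebesgue_on UNIV. \<psi> x *\<^sub>R (g x - c)) = 0"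
      by (simp only: lebesgue_on_UNIV_eq)
  qed simp
  then show ?thesis by auto
qed

text \<open>The signed indicator of the oriented interval from \<open>a\<close> to \<open>b\<close>. It is additive in adjacent
  intervals whatever the order of the end points (\<open>orient_diff\<close>).\<close>

definition orient :: "real \<Rightarrow> real \<Rightarrow> real \<Rightarrow> real" where
  "orient a b x = indicator {a<..b} x - indicator {b<..a} x"

definition primitive :: "(real \<Rightarrow> complex) \<Rightarrow> real \<Rightarrow> complex" where
  "primitive s y = (LINT x|lborel. orient 0 y x *\<^sub>R s x)"

lemma orient_diff: "orient a c x - orient a b x = orient b c x"
  by (auto simp: orient_def indicator_def)

lemma integrable_orient:
  assumes s: "s \<in> borel_measurable borel" "locally_bounded (s :: real \<Rightarrow> complex)"
  shows "integrable lborel (\<lambda>x. orient a b x *\<^sub>R s x)"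
proof -
  define r where "r = \<bar>a\<bar> + \<bar>b\<bar>"
  obtain B where B: "0 \<le> B" "\<And>x. norm x \<le> r \<Longrightarrow> norm (s x) \<le> B"
    using s(2) unfolding locally_bounded_def by meson
  have z: "orient a b x = 0" if "r < norm x" for x
    using that by (auto simp: orient_def r_def indicator_def)
  have o: "\<bar>orient a b x\<bar> \<le> 1" for x
    by (auto simp: orient_def indicator_def)
  show ?thesis
  proof (rule integrable_bounded_support[where r=r and B=B])
    show "(\<lambda>x. orient a b x *\<^sub>R s x) \<in> borel_measurable borel"
      unfolding orient_def using s(1) by measurable
    fix x
    show "norm (orient a b x *\<^sub>R s x) \<le> B"
      using z[of x] B mult_mono[OF o[of x] B(2)[of x]] by (cases "norm x \<le> r") auto
  qed (simp add: z)
qed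

text \<open>Parametrizing the interval from \<open>c\<close> to \<open>c + h\<close> by the unit interval gives one formula
  for \<open>h\<close> of either sign; it is applied with \<open>h\<close> a multiple of an inner product \<open>w \<bullet> e\<close>.\<close>

lemma primitive_increment:
  assumes s: "s \<in> borel_measurable borel" "locally_bounded s"
  shows "primitive s (c + h) - primitive s c = h *\<^sub>R (LINT t|lborel. indicator {0..1} t *\<^sub>R s (c + t * h))"
proof (cases "h = 0")
  case False
  have [measurable]: "s \<in> borel_measurable borel" by (rule s)
  have "primitive s (c + h) - primitive s c = (LINT x|lborel. orient 0 (c + h) x *\<^sub>R s x - orient 0 c x *\<^sub>R s x)"
    unfolding primitive_def
    by (rule Bochner_Integration.integral_diff[OF integrable_orient[OF s] integrable_orient[OF s], symmetric])
  also have "\<dots> = (LINT x|lborel. orient c (c + h) x *\<^sub>R s x)"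
    by (simp only: scaleR_diff_left[symmetric] orient_diff)
  also have "\<dots> = \<bar>h\<bar> *\<^sub>R (LINT t|lborel. orient c (c + h) (c + h * t) *\<^sub>R s (c + h * t))"
    by (rule lborel_integral_real_affine[OF False])
  also have "(LINT t|lborel. orient c (c + h) (c + h * t) *\<^sub>R s (c + h * t)) =
      (LINT t|lborel. sgn h *\<^sub>R (indicator {0..1} t *\<^sub>R s (c + t * h)))"
  proof (rule integral_cong_AE)
    have "AE t in lborel. t \<noteq> 0 \<and> t \<noteq> (1::real)"
      using AE_lborel_singleton[of 0] AE_lborel_singleton[of "1::real"] by eventually_elim auto
    then show "AE t in lborel. orient c (c + h) (c + h * t) *\<^sub>R s (c + h * t) = sgn h *\<^sub>R (indicator {0..1} t *\<^sub>R s (c + t * h))"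
    proof eventually_elim
      case (elim t)
      have "orient c (c + h) (c + h * t) = sgn h * indicator {0..1} t"
      proof (cases "h > 0")
        case True
        then show ?thesis using elim by (auto simp: orient_def indicator_def zero_less_mult_iff)
      next
        case F: False
        then have "h < 0" using False by simp
        then show ?thesis using elim
          by (auto simp: orient_def indicator_def zero_less_mult_iff mult_less_0_iff mult_le_0_iff)
      qed
      then show ?case by (simp add: mult.commute)
    qed
  qed (unfold orient_def, measurable)
  also have "\<bar>h\<bar> *\<^sub>R \<dots> = h *\<^sub>R (LINT t|lborel. indicator {0..1} t *\<^sub>R s (c + t * h))"
    by (simp only: integral_scaleR_right) (simp add: abs_mult_sgn)
  finally show ?thesis .
qed simp

lemma average_bound:
  fixes g :: "real \<Rightarrow> complex"
  assumes "\<And>t. 0 \<le> t \<Longrightarrow> t \<le> 1 \<Longrightarrow> norm (g t) \<le> B" "0 \<le> B" "g \<in> borel_measurable borel"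
  shows "norm (LINT t|lborel. indicator {0..1} t *\<^sub>R g t) \<le> B"
proof -
  have i: "integrable lborel (\<lambda>t. B * indicator {0..1::real} t)"
    by (intro integrable_mult_right integrable_real_indicator) auto
  have "norm (LINT t|lborel. indicator {0..1} t *\<^sub>R g t) \<le> (LINT t|lborel. B * indicator {0..1::real} t)"
  proof (rule Bochner_Integration.integral_norm_bound_integral[OF _ i])
    show "integrable lborel (\<lambda>t. indicator {0..1} t *\<^sub>R g t)"
      using assms by (intro integrable_bounded_support[where r=1 and B=B]) (auto simp: indicator_def)
    show "norm (indicator {0..1} t *\<^sub>R g t) \<le> B * indicator {0..1} t" for t
      using assms by (auto simp: indicator_def)
  qed
  also have "\<dots> = B" by simp
  finally show ?thesis .
qed

lemma increment_continuous:
  fixes S L :: "real \<Rightarrow> complex"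
  assumes inc: "\<And>c h. S (c + h) - S c = h *\<^sub>R (LINT t|lborel. indicator {0..1} t *\<^sub>R L (c + t * h))"
    and L: "L \<in> borel_measurable borel" "locally_bounded L"
  shows "continuous_on UNIV S"
  unfolding continuous_on_eq_continuous_at[OF open_UNIV]
proof
  fix c
  have [measurable]: "L \<in> borel_measurable borel" by (rule L)
  obtain B where B: "0 \<le> B" "\<And>x. norm x \<le> \<bar>c\<bar> + 1 \<Longrightarrow> norm (L x) \<le> B"
    using L(2) unfolding locally_bounded_def by meson
  have "norm (S (c + h) - S c) \<le> \<bar>h\<bar> * B" if "\<bar>h\<bar> < 1" for h
    unfolding inc norm_scaleR
  proof (intro mult_left_mono average_bound B)
    fix t :: real assume "0 \<le> t" "t \<le> 1"
    then have "\<bar>t * h\<bar> \<le> 1" using that by (auto simp: abs_mult intro!: mult_le_one)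
    then show "norm (c + t * h) \<le> \<bar>c\<bar> + 1" by simp
  qed auto
  then have "\<forall>\<^sub>F h in at 0. norm (S (c + h) - S c) \<le> \<bar>h\<bar> * B"
    by (auto simp: eventually_at dist_norm intro!: exI[of _ 1])
  moreover have "((\<lambda>h::real. \<bar>h\<bar> * B) \<longlongrightarrow> 0) (at 0)"
    by (intro tendsto_eq_intros refl) auto
  ultimately have "((\<lambda>h. S (c + h) - S c) \<longlongrightarrow> 0) (at 0)"
    by (rule Lim_null_comparison)
  then show "isCont S c"
    unfolding isCont_iff by (rule LIM_zero_cancel)
qed

text \<open>By parts, the primitive of \<open>s'\<close> has weak derivative \<open>s'\<close>, so its difference to \<open>s\<close> is constant
  by \<open>du_Bois_Reymond\<close>.\<close>

lemma weak_pair_representative: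
  fixes s s' :: "real \<Rightarrow> complex"
  assumes s: "s \<in> borel_measurable borel" "locally_bounded s"
    and s': "s' \<in> borel_measurable borel" "locally_bounded s'"
    and weak: "\<And>\<eta>. test_function UNIV \<eta> \<Longrightarrow>
       (LINT x|lborel. frechet_derivative \<eta> (at x) 1 *\<^sub>R s x) = - (LINT x|lborel. \<eta> x *\<^sub>R s' x)"
  obtains S where "continuous_on UNIV S" "AE x in lborel. s x = S x"
    "\<And>c h. S (c + h) - S c = h *\<^sub>R (LINT t|lborel. indicator {0..1} t *\<^sub>R s' (c + t * h))"
proof -
  let ?T = "primitive s'"
  note inc = primitive_increment[OF s']
  have c: "continuous_on UNIV ?T" by (rule increment_continuous[OF inc s'])
  have T: "?T \<in> borel_measurable borel" "locally_bounded ?T"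
  proof -
    show "?T \<in> borel_measurable borel" by (rule borel_measurable_continuous_onI[OF c])
    show "locally_bounded ?T" unfolding locally_bounded_def
    proof
      fix r
      have "bounded (?T ` cball 0 r)"
        using c by (intro compact_imp_bounded compact_continuous_image) (auto intro: continuous_on_subset)
      then obtain B where "0 < B" "\<forall>y\<in>?T ` cball 0 r. norm y \<le> B" using bounded_pos by metis
      then show "\<exists>B\<ge>0. \<forall>x. norm x \<le> r \<longrightarrow> norm (?T x) \<le> B"
        by (intro exI[of _ B]) auto
    qed
  qed
  let ?g = "\<lambda>x. s x - ?T x"
  have [measurable]: "s \<in> borel_measurable borel" "?T \<in> borel_measurable borel" by fact+
  have li: "locally_integrable UNIV u" if u: "u \<in> borel_measurable borel" "locally_bounded u" for u :: "real \<Rightarrow> complex"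
    unfolding locally_integrable_def set_integrable_def
  proof (intro allI impI)
    fix K :: "real set" assume "compact K \<and> K \<subseteq> UNIV"
    then obtain r where K: "K \<in> sets borel" "\<forall>x\<in>K. norm x \<le> r"
      using compact_imp_bounded[of K] by (auto simp: bounded_iff compact_imp_closed borel_closed)
    obtain B where B: "0 \<le> B" "\<And>x. norm x \<le> r \<Longrightarrow> norm (u x) \<le> B"
      using u(2) unfolding locally_bounded_def by meson
    have m: "(\<lambda>x. indicator K x *\<^sub>R u x) \<in> borel_measurable borel" using u K by measurable
    have "integrable lborel (\<lambda>x. indicator K x *\<^sub>R u x)"
      using K B m by (intro integrable_bounded_support[where B=B and r=r]) (auto simp: indicator_def)
    then show "integrable lebesgue (\<lambda>x. indicator K x *\<^sub>R u x)"
      using m by (simp add: integrable_completion)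
  qed
  have "\<exists>c. AE x in lebesgue. ?g x = c"
  proof (rule du_Bois_Reymond)
    show "locally_integrable UNIV ?g"
      using li[OF s] li[OF T] unfolding locally_integrable_def by (auto intro!: set_integral_diff)
    fix \<eta> :: "real \<Rightarrow> real" assume \<eta>: "test_function UNIV \<eta>"
    then have t: "smooth \<eta>" "compact (closure {x. \<eta> x \<noteq> 0})" by (auto simp: test_function_iff)
    let ?D = "\<lambda>x. frechet_derivative \<eta> (at x) 1"
    have sD: "smooth ?D" by (rule smooth_partial[OF t(1)]) simp
    note cD = smooth_continuous[OF sD, of UNIV]
    have [measurable]: "?D \<in> borel_measurable borel" by (rule borel_measurable_continuous_onI[OF cD])
    obtain r where r: "0 < r" "\<And>x. r < norm x \<Longrightarrow> \<eta> x = 0"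
      using compact_support_radius[OF t(2)] by blast
    have rD: "?D x = 0" if "r < norm x" for x
      by (rule frechet_derivative_outside_support[of r \<eta>, OF r(2) that])
    obtain M where M: "0 \<le> M" "\<And>x. \<bar>?D x\<bar> \<le> M"
      using continuous_bounded_support[OF cD rD] by blast
    have int: "integrable lborel (\<lambda>x. ?D x *\<^sub>R u x)" if u: "u \<in> borel_measurable borel" "locally_bounded u" for u :: "real \<Rightarrow> complex"
    proof -
      have [measurable]: "u \<in> borel_measurable borel" by fact
      obtain B where B: "0 \<le> B" "\<And>x. norm x \<le> r \<Longrightarrow> norm (u x) \<le> B"
        using u(2) unfolding locally_bounded_def by meson
      show ?thesis
      proof (rule integrable_bounded_support[where r=r and B="M * B"])
        fix x show "norm (?D x *\<^sub>R u x) \<le> M * B"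
          using rD[of x] M B mult_mono[OF M(2)[of x] B(2)[of x]] by (cases "norm x \<le> r") auto
      qed (auto simp: rD)
    qed
    have "(LINT x|lebesgue. ?D x *\<^sub>R ?g x) = (LINT x|lborel. ?D x *\<^sub>R ?g x)"
      by (intro integral_completion) measurable
    also have "\<dots> = (LINT x|lborel. ?D x *\<^sub>R s x - ?D x *\<^sub>R ?T x)"
      by (simp add: scaleR_diff_right)
    also have "\<dots> = (LINT x|lborel. ?D x *\<^sub>R s x) - (LINT x|lborel. ?D x *\<^sub>R ?T x)"
      by (rule Bochner_Integration.integral_diff[OF int[OF s] int[OF T]])
    also have "(LINT x|lborel. ?D x *\<^sub>R ?T x) = - (LINT x|lborel. \<eta> x *\<^sub>R s' x)"
      using inc by (intro integral_by_parts_direction[OF T(1) s'(1) T(2) s'(2) _ t]) auto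
    finally show "(LINT x|lebesgue. ?D x *\<^sub>R ?g x) = 0"
      using weak[OF \<eta>] by simp
  qed
  then obtain c0 where c0: "AE x in lebesgue. s x - ?T x = c0" by blast
  have "AE x in lborel. s x - ?T x = c0"
    using c0 by (subst AE_completion_iff[symmetric]) auto
  then have "AE x in lborel. s x = ?T x + c0"
    by eventually_elim (simp add: algebra_simps)
  moreover have "continuous_on UNIV (\<lambda>x. ?T x + c0)"
    by (intro continuous_intros c)
  ultimately show ?thesis
    using that[of "\<lambda>x. ?T x + c0"] inc by simp
qed

lemma test_function_partial:
  assumes \<psi>: "test_function \<Omega> \<psi>" and b: "b \<in> Basis"
  shows "test_function \<Omega> (\<lambda>x. frechet_derivative \<psi> (at x) b)"
proof -
  let ?K = "closure {x. \<psi> x \<noteq> 0}" and ?D = "\<lambda>x. frechet_derivative \<psi> (at x) b"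
  have "?D x = 0" if "x \<notin> ?K" for x
  proof -
    have z: "\<psi> y = 0" if "y \<in> - ?K" for y
      using that closure_subset[of "{x. \<psi> x \<noteq> 0}"] by blast
    have "(\<psi> has_derivative (\<lambda>_. 0)) (at x)"
    proof (rule has_derivative_transform_within_open)
      show "((\<lambda>_. 0) has_derivative (\<lambda>_. 0)) (at x)" by (rule has_derivative_const)
      show "open (- ?K)" by (rule open_Compl[OF closed_closure])
      show "x \<in> - ?K" using \<open>x \<notin> ?K\<close> by blast
      show "0 = \<psi> y" if "y \<in> - ?K" for y using z[OF that] by (rule sym)
    qed
    from frechet_derivative_at[OF this] show ?thesis by metis
  qed
  then have "{x. ?D x \<noteq> 0} \<subseteq> ?K" by blast
  then have sub: "closure {x. ?D x \<noteq> 0} \<subseteq> ?K" by (intro closure_minimal) auto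
  moreover from \<psi> have K: "compact ?K" "?K \<subseteq> \<Omega>" "smooth \<psi>" by (auto simp: test_function_iff)
  moreover have "compact (closure {x. ?D x \<noteq> 0})"
    using sub K(1) by (metis closed_closure compact_Int_closed inf.absorb_iff2)
  ultimately show ?thesis
    using smooth_partial[OF K(3) b] by (auto simp: test_function_iff)
qed

lemma test_function_iter_partial:
  assumes "test_function \<Omega> \<psi>" "set bs \<subseteq> Basis"
  shows "test_function \<Omega> (iter_partial bs \<psi>)"
  using assms(2) by (induction bs) (auto simp: assms(1) test_function_partial)

lemma partial_deriv_replicate:
  "partial_deriv (replicate_mset m b) \<psi> = iter_partial (replicate m b) \<psi>"
proof -
  have "bs = replicate m b" if "mset bs = replicate_mset m b" for bs
  proof -
    have "length bs = m" using that by (metis size_mset size_replicate_mset)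
    moreover have "\<forall>x\<in>set bs. x = b"
      using that by (metis in_replicate_mset set_mset_mset)
    ultimately show ?thesis by (metis replicate_length_same)
  qed
  moreover have "mset (SOME bs. mset bs = replicate_mset m b) = replicate_mset m b"
    by (rule someI_ex[OF ex_mset])
  ultimately show ?thesis by (simp add: partial_deriv_def)
qed

text \<open>\<open>damped \<phi> m x\<close> is the product of \<open>damped \<phi> k x\<close> and the increasing factor \<open>(1 + x) ^ (k - m)\<close>.\<close>

lemma damped_mono_le:
  assumes "mono_on {0..} (damped \<phi> k)" "\<forall>x\<ge>0. 0 < damped \<phi> k x" "m \<le> k" "0 \<le> x" "x \<le> y"
  shows "damped \<phi> m x \<le> damped \<phi> m y" "0 < damped \<phi> m x"
proof -
  have eq: "damped \<phi> m x = damped \<phi> k x * (1 + x) ^ (k - m)" if "0 \<le> x" for x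
  proof -
    have "(1 + x) ^ k = (1 + x) ^ (k - m) * (1 + x) ^ m"
      using \<open>m \<le> k\<close> by (simp flip: power_add)
    then show ?thesis using that by (simp add: damped_def)
  qed
  have "damped \<phi> k x \<le> damped \<phi> k y"
    using assms by (intro mono_onD[OF assms(1)]) auto
  moreover have "(1 + x) ^ (k - m) \<le> (1 + y) ^ (k - m)"
    using assms by (intro power_mono) auto
  moreover have "0 < damped \<phi> k x" using assms by auto
  ultimately show "damped \<phi> m x \<le> damped \<phi> m y" "0 < damped \<phi> m x"
    using assms by (auto simp: eq intro!: mult_mono)
qed

text \<open>Superpositions of neurons evaluate \<open>s\<close> along whole families of affine maps, so the bound has to
  hold everywhere; this is achieved by the value 0 wherever a Borel version violates it.\<close>

lemma weak_deriv_borel_version: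
  fixes d :: "real \<Rightarrow> complex"
  assumes d: "d \<in> borel_measurable lebesgue" and bound: "AE x in lebesgue. norm (d x) \<le> b x"
    and b: "b \<in> borel_measurable borel" "\<And>x. 0 \<le> b x"
  obtains s where "s \<in> borel_measurable borel" "AE x in lebesgue. d x = s x" "\<And>x. norm (s x) \<le> b x"
proof -
  obtain g where g [measurable]: "g \<in> borel_measurable borel" and ae: "AE x in lebesgue. d x = g x"
    by (rule lebesgue_borel_version[OF d])
  let ?s = "\<lambda>x. if norm (g x) \<le> b x then g x else 0"
  have [measurable]: "b \<in> borel_measurable borel" by (rule b)
  have "?s \<in> borel_measurable borel" by measurable
  moreover have "AE x in lebesgue. d x = ?s x"
    using ae bound by eventually_elim auto
  ultimately show ?thesis using that[of ?s] b(2) by auto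
qed

text \<open>Consecutive weak derivatives of \<open>\<sigma>\<close> satisfy the hypothesis of \<open>weak_pair_representative\<close>, so all
  of them except the last one have continuous versions. Their bounds pass from almost every to every
  point by continuity. Here \<open>\<phi>\<close> may jump, which is why the bound at \<open>y\<close> is stated in
  terms of any \<open>R > \<bar>y\<bar>\<close>: the almost everywhere bound is used on the open interval of radius \<open>R\<close>.\<close>

lemma activation_representatives:
  fixes \<sigma> :: "real \<Rightarrow> complex" and \<phi> :: "real \<Rightarrow> real"
  assumes activation: "\<sigma> \<in> borel_measurable borel"
    and sobolev: "\<sigma> \<in> sobolev_loc1 k UNIV"
    and norm_function: "norm_function \<sigma> \<phi>"
    and derivatives: "\<exists>C>0. \<forall>m\<le>k. AE x in lebesgue.
                        norm (weak_deriv_real m \<sigma> x) \<le> C * damped \<phi> m \<bar>x\<bar>"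
    and mono: "mono_on {0..} (damped \<phi> k)"
    and pos: "\<forall>x\<ge>0. 0 < damped \<phi> k x"
  obtains S :: "nat \<Rightarrow> real \<Rightarrow> complex" and C :: real where "0 < C"
    "\<And>j. j \<le> k \<Longrightarrow> S j \<in> borel_measurable borel"
    "1 \<le> k \<Longrightarrow> AE y in lborel. \<sigma> y = S 0 y"
    "\<And>y. norm (\<sigma> y) \<le> C * \<phi> \<bar>y\<bar>"
    "\<And>j c h. j < k \<Longrightarrow> S j (c + h) - S j c = h *\<^sub>R (LINT t|lborel. indicator {0..1} t *\<^sub>R S (Suc j) (c + t * h))"
    "\<And>j y R. j \<le> k \<Longrightarrow> \<bar>y\<bar> < R \<Longrightarrow> norm (S j y) \<le> C * damped \<phi> j R"
proof -
  obtain C1 where C1: "0 < C1" "\<And>m. m \<le> k \<Longrightarrow> AE x in lebesgue. norm (weak_deriv_real m \<sigma> x) \<le> C1 * damped \<phi> m \<bar>x\<bar>"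
    using derivatives by blast
  obtain C2 where C2: "0 < C2" "\<And>x. norm (\<sigma> x) \<le> C2 * \<phi> \<bar>x\<bar>"
    using norm_function unfolding norm_function_def by blast
  define C where "C = max C1 C2"
  have C: "0 < C" "C1 \<le> C" "C2 \<le> C" using C1 by (auto simp: C_def)
  have \<phi>pos: "0 < \<phi> x" if "0 \<le> x" for x
    using norm_function that by (auto simp: norm_function_def)
  note dm = damped_mono_le[OF mono pos]
  define d where "d m = weak_deriv_real m \<sigma>" for m
  have d: "has_weak_deriv UNIV (replicate_mset m 1) \<sigma> (d m)" if "m \<le> k" for m
  proof -
    have "replicate_mset m 1 \<in> (multi_indices k :: real multiset set)"
      using that by (auto simp: multi_indices_def)
    then have "\<exists>v. has_weak_deriv UNIV (replicate_mset m 1) \<sigma> v"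
      using sobolev by (auto simp: sobolev_loc1_def)
    then show ?thesis
      unfolding d_def weak_deriv_def by (rule someI_ex)
  qed
  have weak: "(LINT x|lebesgue. iter_partial (replicate m 1) \<psi> x *\<^sub>R \<sigma> x) = (-1) ^ m * (LINT x|lebesgue. \<psi> x *\<^sub>R d m x)"
    if "m \<le> k" "test_function UNIV \<psi>" for m \<psi>
    using d[OF that(1)] that(2) by (simp add: has_weak_deriv_def partial_deriv_replicate lebesgue_on_UNIV_eq)
  have weak_step: "(LINT x|lebesgue. frechet_derivative \<eta> (at x) 1 *\<^sub>R d m x) = - (LINT x|lebesgue. \<eta> x *\<^sub>R d (Suc m) x)"
    if m: "m < k" and \<eta>: "test_function UNIV \<eta>" for m \<eta>
  proof -
    let ?\<eta>' = "\<lambda>x. frechet_derivative \<eta> (at x) 1"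
    have "iter_partial (replicate m 1) ?\<eta>' = iter_partial (replicate m 1 @ [1]) \<eta>"
      by (simp only: iter_partial_append iter_partial.simps)
    also have "replicate m 1 @ [1::real] = replicate (Suc m) 1"
      by (simp add: replicate_append_same)
    finally have "(-1) ^ m * (LINT x|lebesgue. ?\<eta>' x *\<^sub>R d m x) = (-1) ^ Suc m * (LINT x|lebesgue. \<eta> x *\<^sub>R d (Suc m) x)"
      using weak[of m ?\<eta>'] weak[of "Suc m" \<eta>] m \<eta> test_function_partial[OF \<eta>, of 1] by simp
    then have "(-1) ^ m * (LINT x|lebesgue. ?\<eta>' x *\<^sub>R d m x) = (-1) ^ m * (- (LINT x|lebesgue. \<eta> x *\<^sub>R d (Suc m) x))"
      by simp
    then show ?thesis
      unfolding mult_cancel_left by simp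
  qed
  have li: "locally_integrable UNIV (d m)" "d m \<in> borel_measurable lebesgue" if "m \<le> k" for m
  proof -
    show l: "locally_integrable UNIV (d m)" using d[OF that] by (simp add: has_weak_deriv_def)
    have "integrable lebesgue (\<lambda>x. indicator (cball 0 (real n)) x *\<^sub>R d m x)" for n
      using l unfolding locally_integrable_def set_integrable_def by (meson compact_cball subset_UNIV)
    then have "(\<lambda>x. indicator (cball 0 (real n)) x *\<^sub>R d m x) \<in> borel_measurable lebesgue" for n
      by (rule borel_measurable_integrable)
    moreover have "(\<lambda>n. indicator (cball 0 (real n)) x *\<^sub>R d m x) \<longlonglongrightarrow> d m x" for x
    proof (rule tendsto_eventually)
      obtain N where "norm x \<le> real N" using real_arch_simple by blast
      then show "\<forall>\<^sub>F n in sequentially. indicator (cball 0 (real n)) x *\<^sub>R d m x = d m x"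
        by (intro eventually_sequentiallyI[of N]) (auto simp: indicator_def)
    qed
    ultimately show "d m \<in> borel_measurable lebesgue"
      by (rule borel_measurable_LIMSEQ_metric)
  qed
  have \<phi>m [measurable]: "(\<lambda>x. \<phi> \<bar>x\<bar>) \<in> borel_measurable borel"
  proof -
    have "mono (\<lambda>x. \<phi> (max 0 x))"
      using norm_function by (auto simp: norm_function_def intro!: monoI elim!: mono_onD)
    then have [measurable]: "(\<lambda>x. \<phi> (max 0 x)) \<in> borel_measurable borel"
      by (rule borel_measurable_mono)
    have "(\<lambda>x::real. \<phi> (max 0 \<bar>x\<bar>)) \<in> borel_measurable borel"
      by (rule measurable_compose[of abs borel borel "\<lambda>x. \<phi> (max 0 x)"]) auto
    then show ?thesis by simp
  qed
  define P where "P m s \<longleftrightarrow> s \<in> borel_measurable borel \<and> (AE x in lebesgue. d m x = s x) \<and>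
      (\<forall>x. norm (s x) \<le> C * damped \<phi> m \<bar>x\<bar>)" for m s
  define s where "s m = (SOME s. P m s)" for m
  have sP: "P m (s m)" if m: "m \<le> k" for m
  proof -
    have a1: "AE x in lebesgue. norm (d m x) \<le> C * damped \<phi> m \<bar>x\<bar>"
      using C1(2)[OF m]
    proof eventually_elim
      case (elim x)
      then have "norm (d m x) \<le> C1 * damped \<phi> m \<bar>x\<bar>" by (simp add: d_def)
      also have "\<dots> \<le> C * damped \<phi> m \<bar>x\<bar>"
        using dm(2)[OF m, of "\<bar>x\<bar>" "\<bar>x\<bar>"] C by (intro mult_right_mono) auto
      finally show ?case .
    qed
    have a2: "(\<lambda>x. C * damped \<phi> m \<bar>x\<bar>) \<in> borel_measurable borel"
      unfolding damped_def by measurable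
    have a3: "0 \<le> C * damped \<phi> m \<bar>x\<bar>" for x
      using dm(2)[OF m, of "\<bar>x\<bar>" "\<bar>x\<bar>"] C by simp
    obtain g where "g \<in> borel_measurable borel" "AE x in lebesgue. d m x = g x"
      "\<And>x. norm (g x) \<le> C * damped \<phi> m \<bar>x\<bar>"
      by (rule weak_deriv_borel_version[OF li(2)[OF m] a1 a2 a3]) (rule that; blast)
    then have "P m g" by (simp add: P_def)
    then show ?thesis unfolding s_def by (rule someI[of "P m"])
  qed
  have s: "s m \<in> borel_measurable borel" "AE x in lebesgue. d m x = s m x"
    "norm (s m x) \<le> C * damped \<phi> m \<bar>x\<bar>" if "m \<le> k" for m x
    using sP[OF that] by (auto simp: P_def)
  have sb: "norm (s m x) \<le> C * damped \<phi> m R" if "m \<le> k" "\<bar>x\<bar> \<le> R" for m x R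
    using s(3)[OF that(1), of x] dm(1)[OF that(1), of "\<bar>x\<bar>" R] that C
    by (meson abs_ge_zero less_imp_le mult_left_mono order_trans)
  have slb: "locally_bounded (s m)" if m: "m \<le> k" for m
    unfolding locally_bounded_def
  proof
    fix r :: real
    have "0 \<le> C * damped \<phi> m (max 0 r)" using dm(2)[OF m, of "max 0 r" "max 0 r"] C by simp
    moreover have "norm (s m x) \<le> C * damped \<phi> m (max 0 r)" if "norm x \<le> r" for x
      using that by (intro sb[OF m]) auto
    ultimately show "\<exists>B\<ge>0. \<forall>x. norm x \<le> r \<longrightarrow> norm (s m x) \<le> B" by blast
  qed
  have pair: "(LINT x|lborel. frechet_derivative \<eta> (at x) 1 *\<^sub>R s m x) = - (LINT x|lborel. \<eta> x *\<^sub>R s (Suc m) x)"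
    if m: "m < k" and \<eta>: "test_function UNIV \<eta>" for m \<eta>
  proof -
    have tr: "(LINT x|lborel. \<psi> x *\<^sub>R s j x) = (LINT x|lebesgue. \<psi> x *\<^sub>R d j x)"
      if j: "j \<le> k" and \<psi>: "test_function UNIV \<psi>" for j \<psi>
    proof -
      have "smooth \<psi>" using \<psi> by (simp add: test_function_iff)
      then have \<psi>m: "\<psi> \<in> borel_measurable borel"
        by (intro borel_measurable_continuous_onI smooth_continuous)
      have "(LINT x|lborel. \<psi> x *\<^sub>R s j x) = (LINT x|lebesgue. \<psi> x *\<^sub>R s j x)"
        using \<psi>m s(1)[OF j] by (intro integral_completion[symmetric]) simp
      also have "\<dots> = (LINT x|lebesgue. \<psi> x *\<^sub>R d j x)"
      proof (rule integral_cong_AE)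
        have L: "\<psi> \<in> borel_measurable lebesgue" "s j \<in> borel_measurable lebesgue"
          using \<psi>m s(1)[OF j] by (simp_all add: measurable_completion)
        then show "(\<lambda>x. \<psi> x *\<^sub>R s j x) \<in> borel_measurable lebesgue" by simp
        show "(\<lambda>x. \<psi> x *\<^sub>R d j x) \<in> borel_measurable lebesgue"
          using L(1) li(2)[OF j] by simp
        show "AE x in lebesgue. \<psi> x *\<^sub>R s j x = \<psi> x *\<^sub>R d j x"
          using s(2)[OF j] by eventually_elim simp
      qed
      finally show ?thesis .
    qed
    show ?thesis
      using weak_step[OF m \<eta>] tr[of m, OF _ test_function_partial[OF \<eta>, of 1]] tr[of "Suc m", OF _ \<eta>] m by simp
  qed
  define Q where "Q m T \<longleftrightarrow> continuous_on UNIV T \<and> (AE x in lborel. s m x = T x) \<and>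
      (\<forall>c h. T (c + h) - T c = h *\<^sub>R (LINT t|lborel. indicator {0..1} t *\<^sub>R s (Suc m) (c + t * h)))" for m T
  define T where "T m = (SOME T. Q m T)" for m
  have TQ: "Q m (T m)" if m: "m < k" for m
  proof -
    have *: "m \<le> k" "Suc m \<le> k" using m by auto
    show ?thesis
    proof (rule weak_pair_representative[OF s(1)[OF *(1)] slb[OF *(1)] s(1)[OF *(2)] slb[OF *(2)]])
      fix \<eta> :: "real \<Rightarrow> real" assume "test_function UNIV \<eta>"
      then show "(LINT x|lborel. frechet_derivative \<eta> (at x) 1 *\<^sub>R s m x) = - (LINT x|lborel. \<eta> x *\<^sub>R s (Suc m) x)"
        by (rule pair[OF m])
    next
      fix U assume "continuous_on UNIV U" "AE x in lborel. s m x = U x"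
        "\<And>c h. U (c + h) - U c = h *\<^sub>R (LINT t|lborel. indicator {0..1} t *\<^sub>R s (Suc m) (c + t * h))"
      then have "Q m U" unfolding Q_def by blast
      then show "Q m (T m)" unfolding T_def by (rule someI[of "Q m"])
    qed
  qed
  have T: "continuous_on UNIV (T m)" "AE x in lborel. s m x = T m x"
    "T m (c + h) - T m c = h *\<^sub>R (LINT t|lborel. indicator {0..1} t *\<^sub>R s (Suc m) (c + t * h))" if "m < k" for m c h
    using TQ[OF that] by (auto simp: Q_def)
  define S where "S j = (if j < k then T j else s j)" for j
  have Sm: "S j \<in> borel_measurable borel" if "j \<le> k" for j
    using that s(1) borel_measurable_continuous_onI[OF T(1)] by (auto simp: S_def)
  have Ss: "AE x in lborel. s j x = S j x" for j
    using T(2) by (auto simp: S_def)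
  have inc: "S j (c + h) - S j c = h *\<^sub>R (LINT t|lborel. indicator {0..1} t *\<^sub>R S (Suc j) (c + t * h))" if j: "j < k" for j c h
  proof (cases "h = 0")
    case False
    have [measurable]: "S (Suc j) \<in> borel_measurable borel" "s (Suc j) \<in> borel_measurable borel"
      using Sm s(1) j by auto
    have "AE t in lborel. s (Suc j) (c + h * t) = S (Suc j) (c + h * t)"
      using False Ss by (intro AE_borel_affine) auto
    then have "(LINT t|lborel. indicator {0..1} t *\<^sub>R s (Suc j) (c + t * h)) = (LINT t|lborel. indicator {0..1} t *\<^sub>R S (Suc j) (c + t * h))"
      by (intro integral_cong_AE) (auto simp: mult.commute)
    then show ?thesis
      using T(3)[OF j] j by (simp add: S_def)
  qed simp
  have Sbound: "norm (S j y) \<le> C * damped \<phi> j R" if j: "j \<le> k" and y: "\<bar>y\<bar> < R" for j y R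
  proof (cases "j < k")
    case False
    then show ?thesis using sb[OF j, of y R] y by (simp add: S_def)
  next
    case True
    let ?A = "{y. norm (S j y) \<le> C * damped \<phi> j R}"
    have "?A = S j -` cball 0 (C * damped \<phi> j R)" by auto
    then have cl: "closed ?A"
      using T(1)[OF True] True by (simp add: S_def closed_vimage)
    have ae: "AE x in lebesgue. x \<in> {-R<..<R} \<longrightarrow> x \<in> ?A"
      using AE_completion[OF Ss[of j]]
    proof eventually_elim
      case (elim x)
      then show ?case using sb[OF j, of x R] by auto
    qed
    have "y \<in> ?A"
      by (rule mem_closed_if_AE_lebesgue_open[OF _ cl ae]) (use y in auto)
    then show ?thesis by simp
  qed
  have "AE y in lebesgue. y \<in> UNIV \<longrightarrow> \<sigma> y - d 0 y = 0"
  proof (rule fundamental_lemma)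
    have l\<sigma>: "locally_integrable UNIV \<sigma>" using d[of 0] by (simp add: has_weak_deriv_def)
    then show "locally_integrable UNIV (\<lambda>y. \<sigma> y - d 0 y)"
      using li(1)[of 0] unfolding locally_integrable_def by (auto intro!: set_integral_diff)
    fix \<psi> :: "real \<Rightarrow> real" assume t: "test_function UNIV \<psi>"
    then have t': "continuous_on UNIV \<psi>" "compact (closure {x. \<psi> x \<noteq> 0})"
      by (auto simp: test_function_iff smooth_continuous)
    have "(LINT x|lebesgue. \<psi> x *\<^sub>R (\<sigma> x - d 0 x)) = (LINT x|lebesgue. \<psi> x *\<^sub>R \<sigma> x - \<psi> x *\<^sub>R d 0 x)"
      by (simp add: scaleR_diff_right)
    also have "\<dots> = (LINT x|lebesgue. \<psi> x *\<^sub>R \<sigma> x) - (LINT x|lebesgue. \<psi> x *\<^sub>R d 0 x)"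
      using li(1)[of 0] l\<sigma> by (intro Bochner_Integration.integral_diff locally_integrable_mult_test[OF _ t']) auto
    also have "\<dots> = 0" using weak[of 0 \<psi>] t by simp
    finally show "(LINT x|lebesgue_on UNIV. \<psi> x *\<^sub>R (\<sigma> x - d 0 x)) = 0" by (simp only: lebesgue_on_UNIV_eq)
  qed simp
  moreover have "AE y in lebesgue. d 0 y = s 0 y" by (rule s(2)) simp
  ultimately have "AE y in lebesgue. \<sigma> y = S 0 y"
    using AE_completion[OF Ss[of 0]] by eventually_elim auto
  then have "AE y in lborel. \<sigma> y = S 0 y"
    by (subst AE_completion_iff[symmetric]) auto
  moreover have "norm (\<sigma> y) \<le> C * \<phi> \<bar>y\<bar>" for y
    by (intro order_trans[OF C2(2) mult_right_mono[OF C(3)]] less_imp_le[OF \<phi>pos]) simp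
  ultimately show ?thesis
    using that[of C S] C(1) Sm inc Sbound by blast
qed

section \<open>Variation measures\<close>

text \<open>Superadditivity on pairs extends to finite unions and, by monotonicity, to countable ones, which is the
  inequality that complements \<open>sub\<close>. For set functions defined as suprema, superadditivity and
  subadditivity are each a short argument about competitors.\<close>

lemma measure_space_superadditive:
  fixes F :: "'b::topological_space set \<Rightarrow> ennreal"
  assumes empty: "F {} = 0"
    and mono: "\<And>A B. A \<in> sets borel \<Longrightarrow> B \<in> sets borel \<Longrightarrow> A \<subseteq> B \<Longrightarrow> F A \<le> F B"
    and super: "\<And>A B. A \<in> sets borel \<Longrightarrow> B \<in> sets borel \<Longrightarrow> A \<inter> B = {} \<Longrightarrow> F A + F B \<le> F (A \<union> B)"
    and sub: "\<And>A :: nat \<Rightarrow> 'b set. range A \<subseteq> sets borel \<Longrightarrow> disjoint_family A \<Longrightarrow> F (\<Union>i. A i) \<le> (\<Sum>i. F (A i))"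
    and E: "E \<in> sets borel"
  shows "emeasure (measure_of UNIV (sets borel) F) E = F E"
proof -
  have "countably_additive (sets borel) F"
    unfolding countably_additive_def
  proof (intro allI impI antisym)
    fix A :: "nat \<Rightarrow> 'b set"
    assume A: "range A \<subseteq> sets borel" "disjoint_family A"
    show "F (\<Union>i. A i) \<le> (\<Sum>i. F (A i))"
      by (rule sub[OF A])
    have Ai: "A i \<in> sets borel" for i using A(1) by auto
    have fin: "(\<Sum>i<n. F (A i)) \<le> F (\<Union>i<n. A i)" for n
    proof (induction n)
      case (Suc n)
      have "A i \<inter> A n = {}" if "i < n" for i
        using disjoint_family_onD[OF A(2), of i n] that by simp
      then have "(\<Union>i<n. A i) \<inter> A n = {}" by blast
      then have "F (\<Union>i<n. A i) + F (A n) \<le> F ((\<Union>i<n. A i) \<union> A n)"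
        using Ai by (intro super) auto
      moreover have "(\<Union>i<Suc n. A i) = (\<Union>i<n. A i) \<union> A n"
        by (auto simp: lessThan_Suc)
      ultimately show ?case
        using order_trans[OF add_right_mono[OF Suc.IH, of "F (A n)"]] by simp
    qed (simp add: empty)
    show "(\<Sum>i. F (A i)) \<le> F (\<Union>i. A i)"
      unfolding suminf_eq_SUP
    proof (rule SUP_least)
      fix n
      have "F (\<Union>i<n. A i) \<le> F (\<Union>i. A i)"
        using Ai by (intro mono) auto
      then show "(\<Sum>i<n. F (A i)) \<le> F (\<Union>i. A i)"
        using fin order_trans by blast
    qed
  qed
  moreover have "positive (sets borel) F"
    by (simp add: positive_def empty)
  moreover have "sigma_algebra UNIV (sets (borel :: 'b measure))"
    using sets.sigma_algebra_axioms[of "borel :: 'b measure"] by simp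
  ultimately show ?thesis
    using E by (intro emeasure_measure_of_sigma) auto
qed

definition sigma_additive :: "('b::topological_space set \<Rightarrow> 'c::real_normed_vector) \<Rightarrow> bool" where
  "sigma_additive \<nu> \<longleftrightarrow> (\<forall>A::nat \<Rightarrow> 'b set. range A \<subseteq> sets borel \<and> disjoint_family A
        \<longrightarrow> (\<lambda>n. \<nu> (A n)) sums \<nu> (\<Union>n. A n))"

lemma complex_measure_sigma_additive: "complex_measure \<rho> \<longleftrightarrow> sigma_additive \<rho>"
  by (simp add: complex_measure_def sigma_additive_def)

lemma sigma_additive_empty:
  fixes \<nu> :: "'b::topological_space set \<Rightarrow> 'c::real_normed_vector"
  assumes "sigma_additive \<nu>"
  shows "\<nu> {} = 0"
proof -
  have "(\<lambda>n::nat. \<nu> {}) sums \<nu> (\<Union>n::nat. {})"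
    using assms[unfolded sigma_additive_def, rule_format, of "\<lambda>_. {}"] by (auto simp: disjoint_family_on_def)
  then have "(\<lambda>n::nat. \<nu> {}) \<longlonglongrightarrow> 0"
    using sums_summable summable_LIMSEQ_zero by blast
  then show ?thesis by (simp add: LIMSEQ_const_iff)
qed

lemma sigma_additive_Un:
  assumes \<nu>: "sigma_additive \<nu>" and AB: "A \<in> sets borel" "B \<in> sets borel" "A \<inter> B = {}"
  shows "\<nu> (A \<union> B) = \<nu> A + \<nu> B"
proof -
  have "disjoint_family (binaryset A B)"
    using AB(3) by (auto simp: disjoint_family_on_def binaryset_def)
  then have "(\<lambda>n. \<nu> (binaryset A B n)) sums \<nu> (\<Union>n. binaryset A B n)"
    using AB by (intro \<nu>[unfolded sigma_additive_def, rule_format]) (auto simp: range_binaryset_eq)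
  then have "(\<lambda>n. \<nu> (binaryset A B n)) sums \<nu> (A \<union> B)"
    by (simp add: UN_binaryset_eq)
  moreover have "(\<lambda>n. \<nu> (binaryset A B n)) sums (\<nu> A + \<nu> B)"
    by (rule binaryset_sums[of \<nu>, OF sigma_additive_empty[OF \<nu>]])
  ultimately show ?thesis
    by (rule sums_unique2)
qed

lemma ennreal_norm_sums_le:
  fixes f :: "nat \<Rightarrow> 'c::banach"
  assumes "f sums s"
  shows "ennreal (norm s) \<le> (\<Sum>i. ennreal (norm (f i)))"
proof (cases "(\<Sum>i. ennreal (norm (f i))) = top")
  case False
  then have "summable (\<lambda>i. norm (f i))"
    by (intro summable_suminf_not_top) auto
  then have "norm s \<le> (\<Sum>i. norm (f i))" "(\<Sum>i. ennreal (norm (f i))) = ennreal (\<Sum>i. norm (f i))"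
    using assms summable_norm[of f] by (auto simp: sums_iff intro: suminf_ennreal2)
  then show ?thesis by (simp add: ennreal_leI)
qed simp

lemma ennreal_suminf_swap:
  fixes f :: "nat \<Rightarrow> nat \<Rightarrow> ennreal"
  shows "(\<Sum>i. \<Sum>j. f i j) = (\<Sum>j. \<Sum>i. f i j)"
proof -
  have "(\<Sum>i. \<Sum>j. f i j) = (\<integral>\<^sup>+i. (\<Sum>j. f i j) \<partial>count_space UNIV)"
    by (simp add: nn_integral_count_space_nat)
  also have "\<dots> = (\<Sum>j. \<integral>\<^sup>+i. f i j \<partial>count_space UNIV)"
    by (intro nn_integral_suminf) auto
  finally show ?thesis
    by (simp add: nn_integral_count_space_nat)
qed

lemma disjoint_family_Int:
  assumes "disjoint_family E"
  shows "disjoint_family (\<lambda>i. A \<inter> E i)" "disjoint_family (\<lambda>i. E i \<inter> A)"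
  using assms unfolding disjoint_family_on_def by blast+

definition partitions :: "'b::topological_space set \<Rightarrow> (nat \<Rightarrow> 'b set) set" where
  "partitions E = {A. range A \<subseteq> sets borel \<and> disjoint_family A \<and> (\<Union>n. A n) = E}"

lemma binaryset_partition:
  assumes "A \<in> sets borel" "E \<in> sets borel" "A \<subseteq> E"
  shows "binaryset A (E - A) \<in> partitions E"
  using assms unfolding partitions_def
  by (auto simp: range_binaryset_eq UN_binaryset_eq disjoint_family_on_def binaryset_def)

text \<open>Interleaving partitions of two disjoint sets gives a partition of their union; a partition of a
  union is refined by intersecting it with the pieces.\<close>

lemma emeasure_total_variation:
  fixes \<rho> :: "'b::euclidean_space set \<Rightarrow> complex"
  assumes \<rho>: "complex_measure \<rho>" and E: "E \<in> sets borel"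
  shows "emeasure (total_variation \<rho>) E = (SUP A\<in>partitions E. \<Sum>n. ennreal (norm (\<rho> (A n))))"
  unfolding total_variation_def partitions_def[symmetric]
proof (rule measure_space_superadditive[OF _ _ _ _ E])
  have \<nu>: "sigma_additive \<rho>" using \<rho> by (simp add: complex_measure_sigma_additive)
  let ?F = "\<lambda>E. SUP A\<in>partitions E. \<Sum>n. ennreal (norm (\<rho> (A n)))"
  have "(\<Sum>n. ennreal (norm (\<rho> (A n)))) = 0" if "A \<in> partitions {}" for A
    using that sigma_additive_empty[OF \<nu>] by (simp add: partitions_def)
  then show F0: "?F {} = 0"
    by (metis (mono_tags, lifting) SUP_least le_zero_eq order_refl)
  show super: "?F A + ?F B \<le> ?F (A \<union> B)" if AB: "A \<in> sets borel" "B \<in> sets borel" "A \<inter> B = {}" for A B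
  proof -
    have ne: "partitions A \<noteq> {}" "partitions B \<noteq> {}"
      using binaryset_partition[of A A] binaryset_partition[of B B] AB by auto
    have *: "(\<Sum>n. ennreal (norm (\<rho> (P n)))) + (\<Sum>n. ennreal (norm (\<rho> (Q n)))) \<le> ?F (A \<union> B)"
      if PQ: "P \<in> partitions A" "Q \<in> partitions B" for P Q
    proof -
      define R where "R = (\<lambda>n. if even n then P (n div 2) else Q (n div 2))"
      have "(\<Union>n. R n) = (\<Union>n. P n) \<union> (\<Union>n. Q n)"
      proof (intro equalityI subsetI)
        fix x assume "x \<in> (\<Union>n. P n) \<union> (\<Union>n. Q n)"
        then obtain n where "x \<in> R (2 * n) \<or> x \<in> R (2 * n + 1)" by (auto simp: R_def)
        then show "x \<in> (\<Union>n. R n)" by blast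
      qed (auto simp: R_def split: if_splits)
      moreover have "disjoint_family R"
        unfolding disjoint_family_on_def
      proof (intro ballI impI)
        fix m n :: nat assume "m \<noteq> n"
        have P: "P i \<subseteq> A" "Q i \<subseteq> B" for i using PQ by (auto simp: partitions_def)
        have d: "P i \<inter> P j = {}" "Q i \<inter> Q j = {}" if "i \<noteq> j" for i j
          using PQ that by (auto simp: partitions_def disjoint_family_on_def)
        show "R m \<inter> R n = {}"
        proof (cases "even m = even n")
          case True
          then have "m div 2 \<noteq> n div 2"
            using \<open>m \<noteq> n\<close> by (metis dvd_mult_div_cancel odd_two_times_div_two_succ)
          then show ?thesis using d True by (auto simp: R_def)
        next
          case False
          then show ?thesis using P[of "m div 2"] P[of "n div 2"] AB(3) by (auto simp: R_def)
        qed
      qed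
      ultimately have "R \<in> partitions (A \<union> B)"
        using PQ by (auto simp: partitions_def R_def)
      then have R: "(\<Sum>n. ennreal (norm (\<rho> (R n)))) \<le> ?F (A \<union> B)"
        by (rule SUP_upper)
      have "(\<Sum>i<n. ennreal (norm (\<rho> (P i))) + ennreal (norm (\<rho> (Q i)))) = (\<Sum>i<2 * n. ennreal (norm (\<rho> (R i))))" for n
        by (induction n) (auto simp: R_def add.assoc)
      also have "(\<Sum>i<2 * n. ennreal (norm (\<rho> (R i)))) \<le> (\<Sum>n. ennreal (norm (\<rho> (R n))))" for n
        by (rule sum_le_suminf) auto
      finally have "(\<Sum>i. ennreal (norm (\<rho> (P i))) + ennreal (norm (\<rho> (Q i)))) \<le> (\<Sum>n. ennreal (norm (\<rho> (R n))))"
        unfolding suminf_eq_SUP[of "\<lambda>i. ennreal (norm (\<rho> (P i))) + ennreal (norm (\<rho> (Q i)))"] by (rule SUP_least)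
      then show ?thesis
        using R by (simp add: suminf_add)
    qed
    have "(\<Sum>n. ennreal (norm (\<rho> (P n)))) + ?F B \<le> ?F (A \<union> B)" if "P \<in> partitions A" for P
      unfolding ennreal_SUP_add_right[OF ne(2)] by (intro SUP_least * that)
    then show ?thesis
      unfolding ennreal_SUP_add_left[OF ne(1), symmetric] by (intro SUP_least)
  qed
  show "?F A \<le> ?F B" if AB: "A \<in> sets borel" "B \<in> sets borel" "A \<subseteq> B" for A B
  proof -
    have "?F A \<le> ?F A + ?F (B - A)" by simp
    also have "\<dots> \<le> ?F (A \<union> (B - A))" using AB by (intro super) auto
    also have "A \<union> (B - A) = B" using AB by auto
    finally show ?thesis .
  qed
  show "?F (\<Union>i. E i) \<le> (\<Sum>i. ?F (E i))" if E: "range E \<subseteq> sets borel" "disjoint_family E" for E :: "nat \<Rightarrow> 'b set"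
  proof (rule SUP_least)
    fix P assume "P \<in> partitions (\<Union>i. E i)"
    then have P: "range P \<subseteq> sets borel" "disjoint_family P" "(\<Union>n. P n) = (\<Union>i. E i)"
      by (auto simp: partitions_def)
    have "(\<Sum>n. ennreal (norm (\<rho> (P n)))) \<le> (\<Sum>n. \<Sum>i. ennreal (norm (\<rho> (P n \<inter> E i))))"
    proof (intro suminf_le ennreal_norm_sums_le)
      fix n
      have "(\<lambda>i. \<rho> (P n \<inter> E i)) sums \<rho> (\<Union>i. P n \<inter> E i)"
        using P E by (intro \<nu>[unfolded sigma_additive_def, rule_format] conjI disjoint_family_Int) auto
      moreover have "(\<Union>i. P n \<inter> E i) = P n"
        using P(3) by auto
      ultimately show "(\<lambda>i. \<rho> (P n \<inter> E i)) sums \<rho> (P n)" by simp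
    qed auto
    also have "\<dots> = (\<Sum>i. \<Sum>n. ennreal (norm (\<rho> (P n \<inter> E i))))"
      by (rule ennreal_suminf_swap)
    also have "\<dots> \<le> (\<Sum>i. ?F (E i))"
    proof (intro suminf_le)
      fix i
      have "(\<lambda>n. P n \<inter> E i) \<in> partitions (E i)"
        using P E disjoint_family_Int(2)[OF P(2)] by (auto simp: partitions_def)
      then show "(\<Sum>n. ennreal (norm (\<rho> (P n \<inter> E i)))) \<le> ?F (E i)"
        by (rule SUP_upper2) simp
    qed auto
    finally show "(\<Sum>n. ennreal (norm (\<rho> (P n)))) \<le> (\<Sum>i. ?F (E i))" .
  qed
qed

text \<open>Competitors of two disjoint sets are united, leaving out one on which \<open>\<nu>\<close> is negative; a competitor
  of a union is cut along the pieces.\<close>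

lemma emeasure_upper_variation:
  fixes \<nu> :: "'b::euclidean_space set \<Rightarrow> real"
  assumes \<nu>: "sigma_additive \<nu>" and E: "E \<in> sets borel"
  shows "emeasure (upper_variation \<nu>) E = (SUP A\<in>{A \<in> sets borel. A \<subseteq> E}. ennreal (\<nu> A))"
  unfolding upper_variation_def
proof (rule measure_space_superadditive[OF _ _ _ _ E])
  let ?F = "\<lambda>E. SUP A\<in>{A \<in> sets borel. A \<subseteq> E}. ennreal (\<nu> A)"
  have "{A \<in> sets borel. A \<subseteq> {}} = {{}::'b set}" by auto
  then show "?F {} = 0"
    using sigma_additive_empty[OF \<nu>] by simp
  show "?F A \<le> ?F B" if "A \<subseteq> B" for A B
    using that by (intro SUP_subset_mono) auto
  show "?F A + ?F B \<le> ?F (A \<union> B)" if AB: "A \<inter> B = {}" for A B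
  proof -
    have ne: "{X \<in> sets borel. X \<subseteq> C} \<noteq> {}" for C :: "'b set" by blast
    have *: "ennreal (\<nu> P) + ennreal (\<nu> Q) \<le> ?F (A \<union> B)"
      if P: "P \<in> {X \<in> sets borel. X \<subseteq> A}" and Q: "Q \<in> {X \<in> sets borel. X \<subseteq> B}" for P Q
    proof -
      have up: "ennreal (\<nu> X) \<le> ?F (A \<union> B)" if "X \<in> sets borel" "X \<subseteq> A \<union> B" for X
        using that by (intro SUP_upper) auto
      consider "\<nu> P \<le> 0" | "\<nu> Q \<le> 0" | "0 \<le> \<nu> P" "0 \<le> \<nu> Q" by linarith
      then show ?thesis
      proof cases
        case 1
        then show ?thesis using up[of Q] Q by (auto simp: ennreal_neg)
      next
        case 2
        then show ?thesis using up[of P] P by (auto simp: ennreal_neg)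
      next
        case 3
        have "\<nu> (P \<union> Q) = \<nu> P + \<nu> Q"
          using P Q AB by (intro sigma_additive_Un[OF \<nu>]) auto
        then show ?thesis using up[of "P \<union> Q"] P Q 3 by auto
      qed
    qed
    have "ennreal (\<nu> P) + ?F B \<le> ?F (A \<union> B)" if "P \<in> {X \<in> sets borel. X \<subseteq> A}" for P
      unfolding ennreal_SUP_add_right[OF ne] by (intro SUP_least * that)
    then show ?thesis
      unfolding ennreal_SUP_add_left[OF ne, symmetric] by (intro SUP_least)
  qed
  show "?F (\<Union>i. E i) \<le> (\<Sum>i. ?F (E i))" if E: "range E \<subseteq> sets borel" "disjoint_family E" for E :: "nat \<Rightarrow> 'b set"
  proof (rule SUP_least)
    fix A assume "A \<in> {A \<in> sets borel. A \<subseteq> (\<Union>i. E i)}"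
    then have A: "A \<in> sets borel" "A \<subseteq> (\<Union>i. E i)" by auto
    have "(\<lambda>i. \<nu> (A \<inter> E i)) sums \<nu> (\<Union>i. A \<inter> E i)"
      using A E by (intro \<nu>[unfolded sigma_additive_def, rule_format] conjI disjoint_family_Int) auto
    moreover have "(\<Union>i. A \<inter> E i) = A" using A by auto
    ultimately have "(\<lambda>n. \<Sum>i<n. \<nu> (A \<inter> E i)) \<longlonglongrightarrow> \<nu> A" by (simp add: sums_def)
    then have lim: "(\<lambda>n. ennreal (\<Sum>i<n. \<nu> (A \<inter> E i))) \<longlonglongrightarrow> ennreal (\<nu> A)"
      by (rule tendsto_ennrealI)
    have "ennreal (\<Sum>i<n. \<nu> (A \<inter> E i)) \<le> (\<Sum>i. ?F (E i))" for n
    proof -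
      have "ennreal (\<Sum>i<n. \<nu> (A \<inter> E i)) \<le> (\<Sum>i<n. ennreal (\<nu> (A \<inter> E i)))"
      proof (induction n)
        case (Suc n)
        have "ennreal (x + y) \<le> ennreal x + ennreal y" for x y
          by (cases "0 \<le> x"; cases "0 \<le> y") (auto simp: ennreal_neg intro: ennreal_leI)
        from this[of "\<Sum>i<n. \<nu> (A \<inter> E i)" "\<nu> (A \<inter> E n)"] Suc show ?case
          by (simp add: order_trans[OF _ add_right_mono])
      qed simp
      also have "\<dots> \<le> (\<Sum>i<n. ?F (E i))"
        using A E by (intro sum_mono SUP_upper) auto
      also have "\<dots> \<le> (\<Sum>i. ?F (E i))"
        by (rule sum_le_suminf) auto
      finally show ?thesis .
    qed
    then show "ennreal (\<nu> A) \<le> (\<Sum>i. ?F (E i))"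
      by (intro LIMSEQ_le_const2[OF lim]) auto
  qed
qed

lemma sets_variation [simp]:
  "sets (total_variation \<rho>) = sets borel" "sets (upper_variation \<nu>) = sets borel"
  unfolding total_variation_def upper_variation_def
  using sets.sigma_sets_eq[of "borel :: 'a::euclidean_space measure"] sets.sigma_sets_eq[of "borel :: 'b::euclidean_space measure"]
  by simp_all

lemma upper_variation_le_total_variation:
  fixes \<rho> :: "'b::euclidean_space set \<Rightarrow> complex"
  assumes \<rho>: "complex_measure \<rho>" and \<nu>: "sigma_additive \<nu>" and le: "\<And>A. \<nu> A \<le> norm (\<rho> A)"
  shows "upper_variation \<nu> \<le> total_variation \<rho>"
proof (subst le_measure)
  show "\<forall>E\<in>sets (upper_variation \<nu>). emeasure (upper_variation \<nu>) E \<le> emeasure (total_variation \<rho>) E"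
  proof
    fix E assume "E \<in> sets (upper_variation \<nu>)"
    then have E: "E \<in> sets borel" by simp
    show "emeasure (upper_variation \<nu>) E \<le> emeasure (total_variation \<rho>) E"
      unfolding emeasure_upper_variation[OF \<nu> E]
    proof (rule SUP_least)
      fix A assume A: "A \<in> {A \<in> sets borel. A \<subseteq> E}"
      let ?P = "binaryset A (E - A)"
      have "ennreal (\<nu> A) \<le> ennreal (norm (\<rho> (?P 0)))"
        using le by (simp add: binaryset_def ennreal_leI)
      also have "\<dots> = (\<Sum>n\<in>{0}. ennreal (norm (\<rho> (?P n))))" by simp
      also have "\<dots> \<le> (\<Sum>n. ennreal (norm (\<rho> (?P n))))"
        by (rule sum_le_suminf) auto
      also have "\<dots> \<le> emeasure (total_variation \<rho>) E"
        unfolding emeasure_total_variation[OF \<rho> E]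
        using A E by (intro SUP_upper binaryset_partition) auto
      finally show "ennreal (\<nu> A) \<le> emeasure (total_variation \<rho>) E" .
    qed
  qed
qed simp

text \<open>The Jordan decompositions of the real and the imaginary part of \<open>\<rho>\<close>. Domination by the total
  variation makes \<open>barron_cost\<close> control the integral over each of the four measures.\<close>

lemma complex_integral_decomposition:
  fixes \<rho> :: "'b::euclidean_space set \<Rightarrow> complex"
  assumes \<rho>: "complex_measure \<rho>"
  obtains \<mu> :: "nat \<Rightarrow> 'b measure" where
    "\<And>i. sets (\<mu> i) = sets borel" "\<And>i. \<mu> i \<le> total_variation \<rho>"
    "\<And>h. complex_integral \<rho> h =
       (\<integral>z. h z \<partial>\<mu> 0) - (\<integral>z. h z \<partial>\<mu> 1) + \<i> * ((\<integral>z. h z \<partial>\<mu> 2) - (\<integral>z. h z \<partial>\<mu> 3))"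
proof -
  define \<nu> :: "nat \<Rightarrow> 'b set \<Rightarrow> real" where
    "\<nu> i A = (if i = 0 then Re (\<rho> A) else if i = 1 then - Re (\<rho> A) else if i = 2 then Im (\<rho> A) else - Im (\<rho> A))" for i A
  have s: "sigma_additive \<rho>" using \<rho> by (simp add: complex_measure_sigma_additive)
  have "sigma_additive (\<nu> i)" for i
    using s unfolding sigma_additive_def \<nu>_def
    by (auto intro: sums_minus[OF sums_Re] sums_minus[OF sums_Im] sums_Re sums_Im)
  moreover have "\<nu> i A \<le> norm (\<rho> A)" for i A
    unfolding \<nu>_def using abs_Re_le_cmod[of "\<rho> A"] abs_Im_le_cmod[of "\<rho> A"] by auto
  ultimately have "upper_variation (\<nu> i) \<le> total_variation \<rho>" for i
    by (intro upper_variation_le_total_variation[OF \<rho>])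
  moreover have "complex_integral \<rho> h =
       (\<integral>z. h z \<partial>upper_variation (\<nu> 0)) - (\<integral>z. h z \<partial>upper_variation (\<nu> 1)) +
       \<i> * ((\<integral>z. h z \<partial>upper_variation (\<nu> 2)) - (\<integral>z. h z \<partial>upper_variation (\<nu> 3)))" for h
    unfolding complex_integral_def signed_integral_def \<nu>_def by simp
  ultimately show ?thesis
    using that[of "\<lambda>i. upper_variation (\<nu> i)"] by simp
qed

section \<open>Neurons and their derivatives\<close>

text \<open>The partial derivative in the directions \<open>bs\<close> of \<open>\<lambda>x. \<sigma> (w \<bullet> x + b)\<close>, where \<open>S j\<close> stands for the
  derivative of \<open>\<sigma>\<close> of order \<open>j\<close>. For \<open>w = 0\<close> the neuron is the constant \<open>\<sigma> b\<close>, and this value may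
  differ from \<open>S 0 b\<close>, since \<open>S 0\<close> agrees with \<open>\<sigma>\<close> almost everywhere only. For nonempty \<open>bs\<close> the
  product of inner products is 0 in this case.\<close>

definition neuron ::
  "(real \<Rightarrow> complex) \<Rightarrow> (nat \<Rightarrow> real \<Rightarrow> complex) \<Rightarrow> 'a::euclidean_space list \<Rightarrow> 'a \<times> real \<Rightarrow> 'a \<Rightarrow> complex" where
  "neuron \<sigma> S bs z x = (if bs = [] \<and> fst z = 0 then \<sigma> (snd z)
     else prod_list (map (\<lambda>e. fst z \<bullet> e) bs) *\<^sub>R S (length bs) (fst z \<bullet> x + snd z))"

text \<open>The argument at which the cost of a neuron evaluates \<open>\<phi>\<close>; it dominates \<open>\<bar>w \<bullet> x + b\<bar>\<close> on the cube.\<close>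

definition reach :: "'a::euclidean_space \<times> real \<Rightarrow> real" where
  "reach z = l1_norm (fst z) + \<bar>snd z\<bar>"

lemma abs_inner_le_l1_norm: "e \<in> Basis \<Longrightarrow> \<bar>w \<bullet> e\<bar> \<le> l1_norm w"
  unfolding l1_norm_def by (rule member_le_sum) auto

lemma l1_norm_nonneg: "0 \<le> l1_norm w"
  unfolding l1_norm_def by (rule sum_nonneg) auto

lemma reach_nonneg: "0 \<le> reach z"
  using l1_norm_nonneg[of "fst z"] by (simp add: reach_def)

text \<open>The inequality is strict because the cube is open. Strictness matches the bounds on the
  representatives \<open>S j\<close>, which hold strictly inside an interval.\<close>

lemma abs_inner_cube_less:
  fixes w :: "'a::euclidean_space"
  assumes "w \<noteq> 0" "x \<in> unit_cube"
  shows "\<bar>w \<bullet> x\<bar> < l1_norm w"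
proof -
  have x: "0 < x \<bullet> b" "x \<bullet> b < 1" if "b \<in> Basis" for b
    using assms(2) that by (auto simp: mem_box)
  obtain b where b: "b \<in> Basis" "w \<bullet> b \<noteq> 0"
    using assms(1) euclidean_all_zero_iff by blast
  have "\<bar>w \<bullet> x\<bar> = \<bar>\<Sum>b\<in>Basis. (w \<bullet> b) * (x \<bullet> b)\<bar>"
    by (simp add: euclidean_inner[of w x])
  also have "\<dots> \<le> (\<Sum>b\<in>Basis. \<bar>w \<bullet> b\<bar> * (x \<bullet> b))"
    using x by (intro order_trans[OF sum_abs] sum_mono) (auto simp: abs_mult less_imp_le)
  also have "\<dots> < (\<Sum>b\<in>Basis. \<bar>w \<bullet> b\<bar>)"
  proof (rule sum_strict_mono_ex1)
    show "\<forall>b\<in>Basis. \<bar>w \<bullet> b\<bar> * (x \<bullet> b) \<le> \<bar>w \<bullet> b\<bar>"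
      using x by (auto intro!: mult_right_le_one_le simp: less_imp_le)
    show "\<exists>b\<in>Basis. \<bar>w \<bullet> b\<bar> * (x \<bullet> b) < \<bar>w \<bullet> b\<bar>"
      using b x[OF b(1)] by (intro bexI[OF _ b(1)]) (simp add: mult_less_cancel_left2)
  qed auto
  finally show ?thesis by (simp add: l1_norm_def)
qed

lemma abs_prod_list_le:
  fixes w :: "'a::euclidean_space"
  assumes "set bs \<subseteq> Basis"
  shows "\<bar>prod_list (map (\<lambda>e. w \<bullet> e) bs)\<bar> \<le> l1_norm w ^ length bs"
  using assms
proof (induction bs)
  case (Cons b bs)
  then show ?case
    using abs_inner_le_l1_norm[of b w] l1_norm_nonneg[of w] by (auto simp: abs_mult intro!: mult_mono)
qed simp

text \<open>Taylor's formula for a chain of functions, each the primitive of the next. In the induction the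
  formula of lower order for the second function is integrated. With increments in integral
  form the last function of the chain need only be measurable and bounded.\<close>

lemma taylor_increment:
  fixes a :: "nat \<Rightarrow> real \<Rightarrow> complex"
  assumes "\<And>l \<tau> h. l < r \<Longrightarrow> a l (\<tau> + h) - a l \<tau> = h *\<^sub>R (LINT s|lborel. indicator {0..1} s *\<^sub>R a (Suc l) (\<tau> + s * h))"
    and "\<And>l. l \<le> r \<Longrightarrow> a l \<in> borel_measurable borel"
    and "\<And>s. 0 \<le> s \<Longrightarrow> s \<le> 1 \<Longrightarrow> norm (a r (s * t)) \<le> B" "0 \<le> B"
  shows "norm (a 0 t - (\<Sum>l<r. (t ^ l / fact l) *\<^sub>R a l 0)) \<le> B * \<bar>t\<bar> ^ r"
  using assms
proof (induction r arbitrary: a t)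
  case 0
  then show ?case using "0.prems"(3)[of 1] by simp
next
  case (Suc r)
  let ?p = "\<lambda>s. \<Sum>l<r. ((s * t) ^ l / fact l) *\<^sub>R a (Suc l) 0"
  have IH: "norm (a 1 (s * t) - ?p s) \<le> B * \<bar>t\<bar> ^ r" if s: "0 \<le> s" "s \<le> 1" for s
  proof -
    have "norm (a (Suc 0) (s * t) - (\<Sum>l<r. ((s * t) ^ l / fact l) *\<^sub>R a (Suc l) 0)) \<le> B * \<bar>s * t\<bar> ^ r"
    proof (rule Suc.IH[of "\<lambda>l. a (Suc l)" "s * t"])
      show "norm (a (Suc r) (u * (s * t))) \<le> B" if "0 \<le> u" "u \<le> 1" for u
        using Suc.prems(3)[of "u * s"] s that by (simp add: mult.assoc mult_le_one)
    qed (use Suc.prems in auto)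
    also have "\<dots> \<le> B * \<bar>t\<bar> ^ r"
      using s Suc.prems(4) by (intro mult_left_mono power_mono) (auto simp: abs_mult mult_left_le_one_le)
    finally show ?thesis by simp
  qed
  have [measurable]: "a (Suc 0) \<in> borel_measurable borel" by (rule Suc.prems) simp
  have m: "(\<lambda>s. a (Suc 0) (s * t) - ?p s) \<in> borel_measurable borel" by measurable
  have i1: "integrable lborel (\<lambda>s. indicator {0..1} s *\<^sub>R (a (Suc 0) (s * t) - ?p s))"
    using IH Suc.prems(4) m by (intro integrable_bounded_support[where r=1 and B="B * \<bar>t\<bar> ^ r"])
      (auto simp: indicator_def)
  have pw: "((\<lambda>s. (t ^ l / fact l) * s ^ l) has_integral (t ^ l / fact (Suc l))) {0..1::real}" for l
  proof -
    have "((\<lambda>s. (t ^ l / fact l) * s ^ l) has_integral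
        (t ^ l / fact (Suc l)) * 1 ^ Suc l - (t ^ l / fact (Suc l)) * 0 ^ Suc l) {0..1::real}"
    proof (rule fundamental_theorem_of_calculus)
      fix x :: real
      have "((\<lambda>s. (t ^ l / fact (Suc l)) * s ^ Suc l) has_real_derivative (t ^ l / fact (Suc l)) * (real (Suc l) * x ^ l)) (at x within {0..1})"
        using DERIV_cmult[OF DERIV_pow[of "Suc l" x "{0..1}"], of "t ^ l / fact (Suc l)"]
        by (simp del: fact_Suc of_nat_Suc)
      moreover have "(t ^ l / fact (Suc l)) * (real (Suc l) * x ^ l) = (t ^ l / fact l) * x ^ l"
        by (simp add: field_simps del: of_nat_Suc)
      ultimately show "((\<lambda>s. (t ^ l / fact (Suc l)) * s ^ Suc l) has_vector_derivative (t ^ l / fact l) * x ^ l) (at x within {0..1})"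
        by (simp add: has_real_derivative_iff_has_vector_derivative del: fact_Suc)
    qed simp
    then show ?thesis by (simp del: fact_Suc)
  qed
  have pi: "integrable lborel (\<lambda>s. indicator {0..1} s * ((t ^ l / fact l) * s ^ l))"
    "(LINT s|lborel. indicator {0..1} s * ((t ^ l / fact l) * s ^ l)) = t ^ l / fact (Suc l)" for l
  proof -
    have c: "continuous_on {0..1} (\<lambda>s::real. (t ^ l / fact l) * s ^ l)" by (intro continuous_intros)
    have "set_integrable lborel {0..1} (\<lambda>s::real. (t ^ l / fact l) * s ^ l)"
      by (rule borel_integrable_atLeastAtMost'[OF c])
    then show "integrable lborel (\<lambda>s. indicator {0..1} s * ((t ^ l / fact l) * s ^ l))"
      by (simp add: set_integrable_def)
    show "(LINT s|lborel. indicator {0..1} s * ((t ^ l / fact l) * s ^ l)) = t ^ l / fact (Suc l)"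
      using set_borel_integral_eq_integral(2)[OF \<open>set_integrable lborel {0..1} (\<lambda>s::real. (t ^ l / fact l) * s ^ l)\<close>]
        integral_unique[OF pw[of l]] unfolding set_lebesgue_integral_def real_scaleR_def by (simp only:)
  qed
  have peq: "indicator {0..1} s *\<^sub>R ?p s = (\<Sum>l<r. (indicator {0..1} s * ((t ^ l / fact l) * s ^ l)) *\<^sub>R a (Suc l) 0)" for s
    by (simp add: scaleR_sum_right power_mult_distrib mult.commute)
  have i2: "integrable lborel (\<lambda>s. indicator {0..1} s *\<^sub>R ?p s)"
    unfolding peq by (intro Bochner_Integration.integrable_sum integrable_scaleR_left pi(1))
  have "(LINT s|lborel. indicator {0..1} s *\<^sub>R ?p s) =
      (\<Sum>l<r. (LINT s|lborel. (indicator {0..1} s * ((t ^ l / fact l) * s ^ l)) *\<^sub>R a (Suc l) 0))"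
    unfolding peq by (intro Bochner_Integration.integral_sum integrable_scaleR_left pi(1))
  also have "\<dots> = (\<Sum>l<r. (t ^ l / fact (Suc l)) *\<^sub>R a (Suc l) 0)"
    by (intro sum.cong refl) (simp only: integral_scaleR_left[OF pi(1)] pi(2))
  finally have ip: "(LINT s|lborel. indicator {0..1} s *\<^sub>R ?p s) = (\<Sum>l<r. (t ^ l / fact (Suc l)) *\<^sub>R a (Suc l) 0)" .
  have "a 0 t - a 0 0 = t *\<^sub>R (LINT s|lborel. indicator {0..1} s *\<^sub>R a (Suc 0) (s * t))"
    using Suc.prems(1)[of 0 0 t] by simp
  also have "(\<lambda>s. indicator {0..1} s *\<^sub>R a (Suc 0) (s * t)) =
      (\<lambda>s. indicator {0..1} s *\<^sub>R (a (Suc 0) (s * t) - ?p s) + indicator {0..1} s *\<^sub>R ?p s)"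
    by (simp only: scaleR_add_right[symmetric] diff_add_cancel)
  also have "(LINT s|lborel. indicator {0..1} s *\<^sub>R (a (Suc 0) (s * t) - ?p s) + indicator {0..1} s *\<^sub>R ?p s) =
     (LINT s|lborel. indicator {0..1} s *\<^sub>R (a (Suc 0) (s * t) - ?p s)) + (\<Sum>l<r. (t ^ l / fact (Suc l)) *\<^sub>R a (Suc l) 0)"
    using i1 i2 by (simp only: Bochner_Integration.integral_add ip)
  also have "t *\<^sub>R \<dots> = t *\<^sub>R (LINT s|lborel. indicator {0..1} s *\<^sub>R (a (Suc 0) (s * t) - ?p s)) +
      (\<Sum>l<r. (t ^ Suc l / fact (Suc l)) *\<^sub>R a (Suc l) 0)"
    by (simp add: scaleR_add_right scaleR_sum_right del: fact_Suc)
  finally have "a 0 t - (\<Sum>l<Suc r. (t ^ l / fact l) *\<^sub>R a l 0) = t *\<^sub>R (LINT s|lborel. indicator {0..1} s *\<^sub>R (a (Suc 0) (s * t) - ?p s))"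
    unfolding sum.lessThan_Suc_shift by (simp add: algebra_simps)
  moreover have "norm (LINT s|lborel. indicator {0..1} s *\<^sub>R (a (Suc 0) (s * t) - ?p s)) \<le> B * \<bar>t\<bar> ^ r"
    using IH Suc.prems(4) m by (intro average_bound) auto
  ultimately show ?case
    using mult_left_mono[of "norm (LINT s|lborel. indicator {0..1} s *\<^sub>R (a (Suc 0) (s * t) - ?p s))" "B * \<bar>t\<bar> ^ r" "\<bar>t\<bar>"]
    by (simp only: norm_scaleR) (simp add: mult.left_commute)
qed

text \<open>For a direction \<open>e\<close> with \<open>w \<bullet> e \<noteq> 0\<close>, almost every \<open>t\<close> is good at \<open>x + t *\<^sub>R e\<close> for each \<open>x\<close>. By Fubini
  some fixed \<open>t\<close> is good for almost every \<open>x\<close>, and a translation by \<open>t *\<^sub>R e\<close> finishes the proof.\<close>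

lemma AE_affine:
  fixes w :: "'a::euclidean_space"
  assumes w: "w \<noteq> 0" and P: "Measurable.pred borel P" "AE y in lborel. P (y::real)"
  shows "AE x in lborel. P (w \<bullet> x + b)"
proof -
  obtain e where e: "e \<in> Basis" "w \<bullet> e \<noteq> 0"
    using w euclidean_all_zero_iff by blast
  have [measurable]: "Measurable.pred borel P" by (rule P)
  have "AE x in lborel. AE t in lborel. P (w \<bullet> x + b + (w \<bullet> e) * t)"
    by (rule AE_I2, rule AE_borel_affine[OF e(2) P])
  moreover have "(\<lambda>z::'a \<times> real. w \<bullet> fst z + b + (w \<bullet> e) * snd z) \<in> borel_measurable (lborel \<Otimes>\<^sub>M lborel)"
    by measurable
  from measurable_compose[OF this P(1)]
  have "{z \<in> space (lborel \<Otimes>\<^sub>M lborel). P (w \<bullet> fst z + b + (w \<bullet> e) * snd z)} \<in> sets (lborel \<Otimes>\<^sub>M lborel)"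
    unfolding pred_def .
  ultimately have "AE t in lborel. AE x in lborel. P (w \<bullet> x + b + (w \<bullet> e) * t)"
    by (subst (asm) lborel_pair.AE_commute)
  then obtain t where "AE x in lborel. P (w \<bullet> x + b + (w \<bullet> e) * t)"
    using eventually_happens[of _ "ae_filter lborel"] by (auto simp: ae_filter_eq_bot_iff emeasure_lborel_UNIV)
  then have "AE x in distr lborel borel ((+) (t *\<^sub>R e)). P (w \<bullet> (x - t *\<^sub>R e) + b + (w \<bullet> e) * t)"
    by (subst AE_distr_iff) auto
  then show ?thesis
    unfolding lborel_distr_plus by (simp add: inner_diff_right mult.commute)
qed

text \<open>An activation function with representatives of its derivatives as provided by
  \<open>activation_representatives\<close>.\<close>

locale activation_data =
  fixes \<sigma> :: "real \<Rightarrow> complex" and \<phi> :: "real \<Rightarrow> real" and k :: nat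
    and S :: "nat \<Rightarrow> real \<Rightarrow> complex" and C :: real
  assumes k: "1 \<le> k" and C: "0 < C"
    and \<sigma>_measurable [measurable]: "\<sigma> \<in> borel_measurable borel"
    and S_measurable: "\<And>j. j \<le> k \<Longrightarrow> S j \<in> borel_measurable borel"
    and \<sigma>_eq_S: "AE y in lborel. \<sigma> y = S 0 y"
    and \<sigma>_bound: "\<And>y. norm (\<sigma> y) \<le> C * \<phi> \<bar>y\<bar>"
    and S_increment: "\<And>j c h. j < k \<Longrightarrow>
      S j (c + h) - S j c = h *\<^sub>R (LINT t|lborel. indicator {0..1} t *\<^sub>R S (Suc j) (c + t * h))"
    and S_bound: "\<And>j y R. j \<le> k \<Longrightarrow> \<bar>y\<bar> < R \<Longrightarrow> norm (S j y) \<le> C * damped \<phi> j R"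
    and \<phi>_pos: "\<And>x. 0 \<le> x \<Longrightarrow> 0 < \<phi> x"
    and \<phi>_mono: "mono_on {0..} \<phi>"
begin

abbreviation "N \<equiv> neuron \<sigma> S"

lemma N_measurable [measurable]:
  assumes "length bs \<le> k" "f \<in> borel_measurable M" "g \<in> borel_measurable M"
  shows "(\<lambda>y. N bs (f y) (g y)) \<in> borel_measurable M"
proof -
  have [measurable]: "S (length bs) \<in> borel_measurable borel" using S_measurable assms(1) .
  note [measurable] = assms(2,3)
  have fst_m [measurable]: "(\<lambda>y. fst (f y)) \<in> borel_measurable M"
    using assms(2) unfolding borel_prod[symmetric] by measurable
  have [measurable]: "(\<lambda>y. snd (f y)) \<in> borel_measurable M"
    using assms(2) unfolding borel_prod[symmetric] by measurable
  have [measurable]: "(\<lambda>y. prod_list (map (\<lambda>e. fst (f y) \<bullet> e) bs)) \<in> borel_measurable M"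
  proof (induction bs)
    case (Cons b bs)
    then show ?case
      unfolding list.map prod_list.Cons using fst_m by (intro borel_measurable_times borel_measurable_inner) auto
  qed simp
  show ?thesis
    unfolding neuron_def by measurable
qed

text \<open>The product of the weights is at most \<open>(1 + reach z) ^ length bs\<close>, which is the denominator of
  \<open>damped \<phi> (length bs) (reach z)\<close>.\<close>

lemma N_bound:
  assumes bs: "length bs \<le> k" "set bs \<subseteq> Basis" and x: "x \<in> unit_cube"
  shows "norm (N bs z x) \<le> C * \<phi> (reach z)"
proof (cases "fst z = 0")
  case True
  have "0 \<le> C * \<phi> (reach z)" using \<phi>_pos[OF reach_nonneg[of z]] C by (simp add: less_imp_le)
  then show ?thesis
    using True \<sigma>_bound[of "snd z"] by (cases bs) (auto simp: neuron_def reach_def l1_norm_def)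
next
  case False
  let ?w = "fst z" and ?m = "length bs"
  have "\<bar>?w \<bullet> x + snd z\<bar> < reach z"
    using abs_inner_cube_less[OF False x] by (simp add: reach_def)
  then have s: "norm (S ?m (?w \<bullet> x + snd z)) \<le> C * damped \<phi> ?m (reach z)"
    by (rule S_bound[OF bs(1)])
  have "norm (N bs z x) = \<bar>prod_list (map (\<lambda>e. ?w \<bullet> e) bs)\<bar> * norm (S ?m (?w \<bullet> x + snd z))"
    using False by (simp add: neuron_def)
  also have "\<dots> \<le> l1_norm ?w ^ ?m * (C * damped \<phi> ?m (reach z))"
    using abs_prod_list_le[OF bs(2)] s l1_norm_nonneg by (intro mult_mono zero_le_power) auto
  also have "\<dots> \<le> (1 + reach z) ^ ?m * (C * damped \<phi> ?m (reach z))"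
  proof (rule mult_right_mono)
    show "l1_norm ?w ^ ?m \<le> (1 + reach z) ^ ?m"
      using l1_norm_nonneg[of ?w] by (intro power_mono) (auto simp: reach_def)
    show "0 \<le> C * damped \<phi> ?m (reach z)"
      using s norm_ge_zero order_trans by blast
  qed
  also have "\<dots> = C * \<phi> (reach z)"
    using reach_nonneg[of z] by (simp add: damped_def)
  finally show ?thesis .
qed

lemma N_locally_bounded:
  assumes "length bs \<le> k"
  shows "locally_bounded (N bs z)"
  unfolding locally_bounded_def
proof
  fix r
  let ?R = "norm (fst z) * \<bar>r\<bar> + \<bar>snd z\<bar> + 1"
  let ?P = "\<bar>prod_list (map (\<lambda>e. fst z \<bullet> e) bs)\<bar>"
  let ?B = "norm (\<sigma> (snd z)) + ?P * (C * damped \<phi> (length bs) ?R)"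
  have "norm (S (length bs) (fst z \<bullet> x + snd z)) \<le> C * damped \<phi> (length bs) ?R" if "norm x \<le> r" for x
  proof (rule S_bound[OF assms])
    have "\<bar>fst z \<bullet> x\<bar> \<le> norm (fst z) * norm x" by (rule Cauchy_Schwarz_ineq2)
    also have "\<dots> \<le> norm (fst z) * \<bar>r\<bar>" using that by (intro mult_left_mono) auto
    finally show "\<bar>fst z \<bullet> x + snd z\<bar> < ?R" by simp
  qed
  note s = this
  have b: "norm (N bs z x) \<le> ?B" if x: "norm x \<le> r" for x
  proof -
    have 0: "0 \<le> C * damped \<phi> (length bs) ?R"
      by (rule order_trans[OF norm_ge_zero s[OF x]])
    show ?thesis
    proof (cases "bs = [] \<and> fst z = 0")
      case True
      then have "norm (N bs z x) = norm (\<sigma> (snd z))" by (simp add: neuron_def)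
      also have "\<dots> \<le> ?B" using mult_nonneg_nonneg[OF abs_ge_zero 0] by simp
      finally show ?thesis .
    next
      case False
      then have "norm (N bs z x) = ?P * norm (S (length bs) (fst z \<bullet> x + snd z))" by (auto simp: neuron_def)
      also have "\<dots> \<le> ?P * (C * damped \<phi> (length bs) ?R)" by (rule mult_left_mono[OF s[OF x] abs_ge_zero])
      also have "\<dots> \<le> ?B" by simp
      finally show ?thesis .
    qed
  qed
  show "\<exists>B\<ge>0. \<forall>x. norm x \<le> r \<longrightarrow> norm (N bs z x) \<le> B"
  proof (cases "0 \<le> r")
    case True
    then have "0 \<le> ?B" by (intro order_trans[OF norm_ge_zero b[of 0]]) simp
    then show ?thesis using b by blast
  next
    case False
    then have "\<not> norm x \<le> r" for x :: 'a using norm_ge_zero[of x] by linarith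
    then show ?thesis by (intro exI[of _ 0]) simp
  qed
qed

lemma N_increment:
  assumes bs: "length bs < k"
  shows "N bs z (x + h *\<^sub>R e) - N bs z x = h *\<^sub>R (LINT s|lborel. indicator {0..1} s *\<^sub>R N (e # bs) z (x + (s * h) *\<^sub>R e))"
proof (cases "bs = [] \<and> fst z = 0")
  case True
  then show ?thesis by (simp add: neuron_def)
next
  case False
  let ?w = "fst z" and ?c = "fst z \<bullet> x + snd z" and ?P = "prod_list (map (\<lambda>e. fst z \<bullet> e) bs)"
  have "N bs z (x + h *\<^sub>R e) - N bs z x = ?P *\<^sub>R (S (length bs) (?c + h * (?w \<bullet> e)) - S (length bs) ?c)"
    using False by (auto simp: neuron_def inner_add_right algebra_simps)
  also have "\<dots> = h *\<^sub>R ((?P * (?w \<bullet> e)) *\<^sub>R (LINT s|lborel. indicator {0..1} s *\<^sub>R S (Suc (length bs)) (?c + s * (h * (?w \<bullet> e)))))"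
    unfolding S_increment[OF bs] by (simp add: mult_ac)
  also have "(?P * (?w \<bullet> e)) *\<^sub>R (LINT s|lborel. indicator {0..1} s *\<^sub>R S (Suc (length bs)) (?c + s * (h * (?w \<bullet> e)))) =
     (LINT s|lborel. (?P * (?w \<bullet> e)) *\<^sub>R (indicator {0..1} s *\<^sub>R S (Suc (length bs)) (?c + s * (h * (?w \<bullet> e)))))"
    by (rule integral_scaleR_right[symmetric])
  also have "\<dots> = (LINT s|lborel. indicator {0..1} s *\<^sub>R N (e # bs) z (x + (s * h) *\<^sub>R e))"
    by (intro Bochner_Integration.integral_cong) (auto simp: neuron_def inner_add_right mult_ac add_ac)
  finally show ?thesis .
qed

lemma N_rev: "N (rev bs) z x = N bs z x"
  by (simp add: neuron_def flip: rev_map)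

text \<open>Integration by parts strips the outermost derivative off \<open>\<psi>\<close> first and thereby reverses the list,
  which does not change the neuron derivative.\<close>

lemma N_weak_deriv:
  assumes \<psi>: "test_function \<Omega> \<psi>" and bs: "set bs \<subseteq> Basis" "length bs \<le> k"
  shows "(LINT x|lborel. iter_partial bs \<psi> x *\<^sub>R N [] z x) = (-1) ^ length bs * (LINT x|lborel. \<psi> x *\<^sub>R N bs z x)"
proof -
  have *: "(LINT x|lborel. iter_partial bs \<psi> x *\<^sub>R N cs z x) = (-1) ^ length bs * (LINT x|lborel. \<psi> x *\<^sub>R N (rev bs @ cs) z x)"
    if "set bs \<subseteq> Basis" "length bs + length cs \<le> k" for cs
    using that
  proof (induction bs arbitrary: cs)
    case (Cons b bs)
    have t: "smooth (iter_partial bs \<psi>)" "compact (closure {x. iter_partial bs \<psi> x \<noteq> 0})"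
      using test_function_iter_partial[OF \<psi>, of bs] Cons.prems by (auto simp: test_function_iff)
    have "(LINT x|lborel. iter_partial (b # bs) \<psi> x *\<^sub>R N cs z x) = - (LINT x|lborel. iter_partial bs \<psi> x *\<^sub>R N (b # cs) z x)"
      unfolding iter_partial.simps
    proof (rule integral_by_parts_direction[OF _ _ _ _ _ t])
      show "N cs z (x + h *\<^sub>R b) - N cs z x = h *\<^sub>R (LINT s|lborel. indicator {0..1} s *\<^sub>R N (b # cs) z (x + (s * h) *\<^sub>R b))" for x h
        using Cons.prems by (intro N_increment) auto
    qed (use Cons.prems in \<open>auto intro!: N_measurable N_locally_bounded\<close>)
    also have "(LINT x|lborel. iter_partial bs \<psi> x *\<^sub>R N (b # cs) z x) = (-1) ^ length bs * (LINT x|lborel. \<psi> x *\<^sub>R N (rev bs @ b # cs) z x)"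
      using Cons.prems by (intro Cons.IH) auto
    finally show ?case by simp
  qed simp
  have "N (rev bs @ []) z = N bs z" by (rule ext) (simp add: N_rev)
  then show ?thesis using *[of "[]"] bs by simp
qed

lemma N_taylor:
  assumes bs: "set bs \<subseteq> Basis" "length bs < k" and e: "e \<in> Basis"
    and x: "x \<in> unit_cube" "x + t *\<^sub>R e \<in> unit_cube"
  shows "norm (N bs z (x + t *\<^sub>R e) - (\<Sum>l<k - length bs. (t ^ l / fact l) *\<^sub>R N (replicate l e @ bs) z x))
    \<le> C * \<phi> (reach z) * \<bar>t\<bar> ^ (k - length bs)"
proof -
  let ?a = "\<lambda>l \<tau>. N (replicate l e @ bs) z (x + \<tau> *\<^sub>R e)"
  have "norm (?a 0 t - (\<Sum>l<k - length bs. (t ^ l / fact l) *\<^sub>R ?a l 0)) \<le> C * \<phi> (reach z) * \<bar>t\<bar> ^ (k - length bs)"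
  proof (rule taylor_increment)
    show "?a l (\<tau> + h) - ?a l \<tau> = h *\<^sub>R (LINT s|lborel. indicator {0..1} s *\<^sub>R ?a (Suc l) (\<tau> + s * h))"
      if "l < k - length bs" for l \<tau> h
      using N_increment[of "replicate l e @ bs" z "x + \<tau> *\<^sub>R e" h e] that
      by (simp add: scaleR_add_left add.assoc)
    show "?a l \<in> borel_measurable borel" if "l \<le> k - length bs" for l
      using that bs by (intro N_measurable) auto
    show "norm (?a (k - length bs) (s * t)) \<le> C * \<phi> (reach z)" if s: "0 \<le> s" "s \<le> 1" for s
    proof (rule N_bound)
      have "(1 - s) *\<^sub>R x + s *\<^sub>R (x + t *\<^sub>R e) \<in> unit_cube"
        using convex_box(2) x s by (intro convexD_alt) auto
      then show "x + (s * t) *\<^sub>R e \<in> unit_cube" by (simp add: algebra_simps)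
    qed (use bs e in auto)
    show "0 \<le> C * \<phi> (reach z)" using \<phi>_pos[OF reach_nonneg[of z]] C by (simp add: less_imp_le)
  qed
  then show ?thesis by simp
qed

lemma N_Nil_AE: "AE x in lborel. \<sigma> (fst z \<bullet> x + snd z) = N [] z x"
proof (cases "fst z = 0")
  case False
  have [measurable]: "S 0 \<in> borel_measurable borel" by (rule S_measurable) simp
  have "AE x in lborel. \<sigma> (fst z \<bullet> x + snd z) = S 0 (fst z \<bullet> x + snd z)"
    by (rule AE_affine[OF False _ \<sigma>_eq_S]) measurable
  then show ?thesis by eventually_elim (simp add: neuron_def False)
qed (simp add: neuron_def)

end

section \<open>Interpolation between derivatives on the cube\<close>

text \<open>The functions \<open>V bs\<close> are to be thought of as the partial derivatives of \<open>V []\<close> in the directions \<open>bs\<close>,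
  all bounded by \<open>M\<close> on the cube. The last clause is Taylor's formula along coordinate directions, the only
  form in which regularity enters the interpolation argument. All clauses are inherited by integrals
  over a parameter, with \<open>M\<close> integrated.\<close>

definition smooth_family ::
  "nat \<Rightarrow> real \<Rightarrow> ('a::euclidean_space list \<Rightarrow> 'a \<Rightarrow> complex) \<Rightarrow> bool" where
  "smooth_family k M V \<longleftrightarrow>
     (\<forall>bs. set bs \<subseteq> Basis \<and> length bs \<le> k \<longrightarrow>
        V bs \<in> borel_measurable borel \<and>
        (\<forall>x\<in>unit_cube. norm (V bs x) \<le> M) \<and>
        (\<forall>\<psi>. test_function unit_cube \<psi> \<longrightarrow>
           (LINT x|lborel. iter_partial bs \<psi> x *\<^sub>R V [] x) = (-1) ^ length bs * (LINT x|lborel. \<psi> x *\<^sub>R V bs x)) \<and>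
        (length bs < k \<longrightarrow> (\<forall>e\<in>Basis. \<forall>x\<in>unit_cube. \<forall>t. x + t *\<^sub>R e \<in> unit_cube \<longrightarrow>
           norm (V bs (x + t *\<^sub>R e) - (\<Sum>l<k - length bs. (t ^ l / fact l) *\<^sub>R V (replicate l e @ bs) x))
             \<le> M * \<bar>t\<bar> ^ (k - length bs))))"

lemma smooth_familyI:
  assumes "\<And>bs. set bs \<subseteq> Basis \<Longrightarrow> length bs \<le> k \<Longrightarrow> V bs \<in> borel_measurable borel"
    and "\<And>bs x. set bs \<subseteq> Basis \<Longrightarrow> length bs \<le> k \<Longrightarrow> x \<in> unit_cube \<Longrightarrow> norm (V bs x) \<le> M"
    and "\<And>bs \<psi>. set bs \<subseteq> Basis \<Longrightarrow> length bs \<le> k \<Longrightarrow> test_function unit_cube \<psi> \<Longrightarrow>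
           (LINT x|lborel. iter_partial bs \<psi> x *\<^sub>R V [] x) = (-1) ^ length bs * (LINT x|lborel. \<psi> x *\<^sub>R V bs x)"
    and "\<And>bs e x t. set bs \<subseteq> Basis \<Longrightarrow> length bs < k \<Longrightarrow> e \<in> Basis \<Longrightarrow> x \<in> unit_cube \<Longrightarrow> x + t *\<^sub>R e \<in> unit_cube \<Longrightarrow>
           norm (V bs (x + t *\<^sub>R e) - (\<Sum>l<k - length bs. (t ^ l / fact l) *\<^sub>R V (replicate l e @ bs) x))
             \<le> M * \<bar>t\<bar> ^ (k - length bs)"
  shows "smooth_family k M V"
  using assms unfolding smooth_family_def by blast

context
  fixes k M and V :: "'a::euclidean_space list \<Rightarrow> 'a \<Rightarrow> complex"
  assumes V: "smooth_family k M V"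
begin

lemma smooth_family_measurable: "set bs \<subseteq> Basis \<Longrightarrow> length bs \<le> k \<Longrightarrow> V bs \<in> borel_measurable borel"
  using V unfolding smooth_family_def by blast

lemma smooth_family_bound: "set bs \<subseteq> Basis \<Longrightarrow> length bs \<le> k \<Longrightarrow> x \<in> unit_cube \<Longrightarrow> norm (V bs x) \<le> M"
  using V unfolding smooth_family_def by blast

lemma smooth_family_weak: "set bs \<subseteq> Basis \<Longrightarrow> length bs \<le> k \<Longrightarrow> test_function unit_cube \<psi> \<Longrightarrow>
    (LINT x|lborel. iter_partial bs \<psi> x *\<^sub>R V [] x) = (-1) ^ length bs * (LINT x|lborel. \<psi> x *\<^sub>R V bs x)"
  using V unfolding smooth_family_def by blast

lemma smooth_family_taylor:
  "set bs \<subseteq> Basis \<Longrightarrow> length bs < k \<Longrightarrow> e \<in> Basis \<Longrightarrow> x \<in> unit_cube \<Longrightarrow> x + t *\<^sub>R e \<in> unit_cube \<Longrightarrow>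
    norm (V bs (x + t *\<^sub>R e) - (\<Sum>l<k - length bs. (t ^ l / fact l) *\<^sub>R V (replicate l e @ bs) x))
      \<le> M * \<bar>t\<bar> ^ (k - length bs)"
  using V unfolding smooth_family_def by (meson less_imp_le)

lemma smooth_family_nonneg: "0 \<le> M"
proof -
  have "(\<Sum>b\<in>Basis. (1/2) *\<^sub>R b) \<in> (unit_cube :: 'a set)"
    by (simp add: mem_box)
  then show ?thesis
    using smooth_family_bound[of "[]"] norm_ge_zero order_trans by (metis empty_iff le0 list.size(3) set_empty2 subsetI)
qed

end

lemma test_function_bounds:
  fixes \<psi> :: "'a::euclidean_space \<Rightarrow> real"
  assumes \<psi>: "test_function \<Omega> \<psi>"
  obtains B r where "0 \<le> B" "\<And>x. \<bar>\<psi> x\<bar> \<le> B" "\<And>x. r < norm x \<Longrightarrow> \<psi> x = 0"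
    "\<And>x. x \<notin> \<Omega> \<Longrightarrow> \<psi> x = 0" "\<psi> \<in> borel_measurable borel"
proof -
  have t: "smooth \<psi>" "compact (closure {x. \<psi> x \<noteq> 0})" "closure {x. \<psi> x \<noteq> 0} \<subseteq> \<Omega>"
    using \<psi> by (auto simp: test_function_iff)
  note c = smooth_continuous[OF t(1), of UNIV]
  obtain r where r: "0 < r" "\<And>x. r < norm x \<Longrightarrow> \<psi> x = 0"
    using compact_support_radius[OF t(2)] by blast
  obtain B where B: "0 \<le> B" "\<And>x. \<bar>\<psi> x\<bar> \<le> B"
    using continuous_bounded_support[OF c r(2)] by blast
  have z: "\<psi> x = 0" if "x \<notin> \<Omega>" for x
    using t(3) that closure_subset[of "{x. \<psi> x \<noteq> 0}"] by blast
  show ?thesis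
    by (rule that[OF B r(2) z borel_measurable_continuous_onI[OF c]])
qed

lemma integrable_test_bounded:
  fixes g :: "'a::euclidean_space \<Rightarrow> complex"
  assumes \<psi>: "test_function \<Omega> \<psi>" and g: "g \<in> borel_measurable borel" "\<And>x. x \<in> \<Omega> \<Longrightarrow> norm (g x) \<le> M" "0 \<le> M"
  shows "integrable lborel (\<lambda>x. \<psi> x *\<^sub>R g x)"
proof (rule test_function_bounds[OF \<psi>])
  fix B r assume B: "0 \<le> B" "\<And>x. \<bar>\<psi> x\<bar> \<le> B" "\<And>x. r < norm x \<Longrightarrow> \<psi> x = 0"
    "\<And>x. x \<notin> \<Omega> \<Longrightarrow> \<psi> x = 0" "\<psi> \<in> borel_measurable borel"
  show ?thesis
  proof (rule integrable_bounded_support[where r=r and B="B * M"])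
    show "(\<lambda>x. \<psi> x *\<^sub>R g x) \<in> borel_measurable borel" using B(5) g(1) by measurable
    show "norm (\<psi> x *\<^sub>R g x) \<le> B * M" for x
      using mult_mono[OF B(2)[of x] g(2)[of x]] B g(3) by (cases "x \<in> \<Omega>") auto
  qed (simp add: B(3))
qed

lemma smooth_family_add:
  fixes V W :: "'a::euclidean_space list \<Rightarrow> 'a \<Rightarrow> complex"
  assumes V: "smooth_family k M V" and W: "smooth_family k L W"
  shows "smooth_family k (M + L) (\<lambda>bs x. V bs x + W bs x)"
proof (rule smooth_familyI)
  fix bs :: "'a list" assume bs: "set bs \<subseteq> Basis" "length bs \<le> k"
  show "(\<lambda>x. V bs x + W bs x) \<in> borel_measurable borel"
    using smooth_family_measurable[OF V bs] smooth_family_measurable[OF W bs] by measurable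
  show "norm (V bs x + W bs x) \<le> M + L" if "x \<in> unit_cube" for x
    using smooth_family_bound[OF V bs that] smooth_family_bound[OF W bs that] norm_triangle_mono by blast
  show "(LINT x|lborel. iter_partial bs \<psi> x *\<^sub>R (V [] x + W [] x)) = (-1) ^ length bs * (LINT x|lborel. \<psi> x *\<^sub>R (V bs x + W bs x))"
    if \<psi>: "test_function unit_cube \<psi>" for \<psi>
  proof -
    have i: "integrable lborel (\<lambda>x. \<psi>' x *\<^sub>R U cs x)"
      if "test_function unit_cube \<psi>'" "set cs \<subseteq> Basis" "length cs \<le> k" "smooth_family k m U" for \<psi>' U cs m
      using that by (intro integrable_test_bounded[OF that(1)] smooth_family_measurable smooth_family_bound smooth_family_nonneg)
    note \<psi>' = test_function_iter_partial[OF \<psi> bs(1)]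
    have "(LINT x|lborel. iter_partial bs \<psi> x *\<^sub>R (V [] x + W [] x)) =
        (LINT x|lborel. iter_partial bs \<psi> x *\<^sub>R V [] x) + (LINT x|lborel. iter_partial bs \<psi> x *\<^sub>R W [] x)"
      unfolding scaleR_add_right by (intro Bochner_Integration.integral_add i[OF \<psi>' _ _ V] i[OF \<psi>' _ _ W]) auto
    moreover have "(LINT x|lborel. \<psi> x *\<^sub>R (V bs x + W bs x)) =
        (LINT x|lborel. \<psi> x *\<^sub>R V bs x) + (LINT x|lborel. \<psi> x *\<^sub>R W bs x)"
      unfolding scaleR_add_right by (intro Bochner_Integration.integral_add i[OF \<psi> bs V] i[OF \<psi> bs W])
    ultimately show ?thesis
      using smooth_family_weak[OF V bs \<psi>] smooth_family_weak[OF W bs \<psi>] by (simp add: distrib_left)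
  qed
next
  fix bs :: "'a list" and e x :: 'a and t :: real
  assume a: "set bs \<subseteq> Basis" "length bs < k" "e \<in> Basis" "x \<in> unit_cube" "x + t *\<^sub>R e \<in> unit_cube"
  have "V bs (x + t *\<^sub>R e) + W bs (x + t *\<^sub>R e) - (\<Sum>l<k - length bs. (t ^ l / fact l) *\<^sub>R (V (replicate l e @ bs) x + W (replicate l e @ bs) x))
     = (V bs (x + t *\<^sub>R e) - (\<Sum>l<k - length bs. (t ^ l / fact l) *\<^sub>R V (replicate l e @ bs) x)) +
       (W bs (x + t *\<^sub>R e) - (\<Sum>l<k - length bs. (t ^ l / fact l) *\<^sub>R W (replicate l e @ bs) x))"
    by (simp add: scaleR_add_right sum.distrib)
  then show "norm (V bs (x + t *\<^sub>R e) + W bs (x + t *\<^sub>R e) - (\<Sum>l<k - length bs. (t ^ l / fact l) *\<^sub>R (V (replicate l e @ bs) x + W (replicate l e @ bs) x)))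
     \<le> (M + L) * \<bar>t\<bar> ^ (k - length bs)"
    using norm_triangle_mono[OF smooth_family_taylor[OF V a] smooth_family_taylor[OF W a]]
    by (simp only: distrib_right)
qed

lemma smooth_family_mult:
  fixes V :: "'a::euclidean_space list \<Rightarrow> 'a \<Rightarrow> complex"
  assumes V: "smooth_family k M V"
  shows "smooth_family k (norm c * M) (\<lambda>bs x. c * V bs x)"
proof (rule smooth_familyI)
  fix bs :: "'a list" assume bs: "set bs \<subseteq> Basis" "length bs \<le> k"
  show "(\<lambda>x. c * V bs x) \<in> borel_measurable borel"
    using smooth_family_measurable[OF V bs] by measurable
  show "norm (c * V bs x) \<le> norm c * M" if "x \<in> unit_cube" for x
    unfolding norm_mult by (rule mult_left_mono[OF smooth_family_bound[OF V bs that] norm_ge_zero])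
  show "(LINT x|lborel. iter_partial bs \<psi> x *\<^sub>R (c * V [] x)) = (-1) ^ length bs * (LINT x|lborel. \<psi> x *\<^sub>R (c * V bs x))"
    if \<psi>: "test_function unit_cube \<psi>" for \<psi>
    using smooth_family_weak[OF V bs \<psi>] by (simp flip: mult_scaleR_right)
next
  fix bs :: "'a list" and e x :: 'a and t :: real
  assume a: "set bs \<subseteq> Basis" "length bs < k" "e \<in> Basis" "x \<in> unit_cube" "x + t *\<^sub>R e \<in> unit_cube"
  have "c * V bs (x + t *\<^sub>R e) - (\<Sum>l<k - length bs. (t ^ l / fact l) *\<^sub>R (c * V (replicate l e @ bs) x))
     = c * (V bs (x + t *\<^sub>R e) - (\<Sum>l<k - length bs. (t ^ l / fact l) *\<^sub>R V (replicate l e @ bs) x))"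
    by (simp add: right_diff_distrib sum_distrib_left)
  then show "norm (c * V bs (x + t *\<^sub>R e) - (\<Sum>l<k - length bs. (t ^ l / fact l) *\<^sub>R (c * V (replicate l e @ bs) x)))
     \<le> norm c * M * \<bar>t\<bar> ^ (k - length bs)"
    using mult_left_mono[OF smooth_family_taylor[OF V a] norm_ge_zero[of c]]
    by (simp only: norm_mult mult.assoc)
qed

text \<open>Coefficients of a one-sided finite difference formula for the first derivative that is exact
  on polynomials of degree less than \<open>r\<close>. Richardson extrapolation raises the order: of the formula
  and its dilation by 2 one takes the combination that keeps the first moment and kills the moment
  of order \<open>r\<close>.\<close>

lemma finite_difference_list:
  "\<exists>xs :: (real \<times> real) list. (\<forall>(a, s)\<in>set xs. 0 \<le> s) \<and>
     (\<forall>l<r. (\<Sum>(a, s)\<leftarrow>xs. a * s ^ l) = (if l = 1 then 1 else 0))"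
proof (induction r)
  case 0
  show ?case by (rule exI[of _ "[]"]) simp
next
  case (Suc r)
  show ?case
  proof (cases "r \<le> 1")
    case True
    show ?thesis
      by (rule exI[of _ "[(-1, 0), (1, 1)]"]) (use True in \<open>auto simp: less_Suc_eq le_Suc_eq\<close>)
  next
    case False
    obtain xs where xs: "\<forall>(a, s)\<in>set xs. 0 \<le> (s::real)"
      "\<And>l. l < r \<Longrightarrow> (\<Sum>(a, s)\<leftarrow>xs. a * s ^ l) = (if l = 1 then 1 else (0::real))"
      using Suc.IH by blast
    define \<beta> :: real where "\<beta> = 1 / (2 - 2 ^ r)"
    define \<alpha> where "\<alpha> = - (2 ^ r * \<beta>)"
    have "(2::real) ^ 1 < 2 ^ r" using False by (intro power_strict_increasing) auto
    then have "\<beta> * (2 - 2 ^ r) = 1" by (simp add: \<beta>_def)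
    then have \<alpha>\<beta>: "\<alpha> + 2 * \<beta> = 1" "\<alpha> + 2 ^ r * \<beta> = 0"
      by (simp_all add: \<alpha>_def algebra_simps)
    let ?ys = "map (\<lambda>(a, s). (\<alpha> * a, s)) xs @ map (\<lambda>(a, s). (\<beta> * a, 2 * s)) xs"
    have sum: "(\<Sum>(a, s)\<leftarrow>?ys. a * s ^ l) = (\<alpha> + 2 ^ l * \<beta>) * (\<Sum>(a, s)\<leftarrow>xs. a * s ^ l)" for l
      by (induction xs) (auto simp: algebra_simps power_mult_distrib)
    have "(\<Sum>(a, s)\<leftarrow>?ys. a * s ^ l) = (if l = 1 then 1 else 0)" if "l < Suc r" for l
    proof (cases "l = r")
      case True
      then show ?thesis using \<alpha>\<beta> False by (simp only: sum) simp
    next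
      case l: False
      then show ?thesis using xs(2)[of l] that \<alpha>\<beta> by (simp only: sum) auto
    qed
    moreover have "\<forall>(a, s)\<in>set ?ys. 0 \<le> s" using xs(1) by auto
    ultimately show ?thesis by blast
  qed
qed

lemma finite_difference_coefficients:
  "\<exists>(n :: nat) (\<mu> :: nat \<Rightarrow> real) (s :: nat \<Rightarrow> real). (\<forall>i<n. 0 \<le> s i) \<and>
    (\<forall>l<r. (\<Sum>i<n. \<mu> i * s i ^ l) = (if l = 1 then 1 else 0))"
proof -
  obtain xs :: "(real \<times> real) list" where xs: "\<forall>(a, s)\<in>set xs. 0 \<le> s"
    "\<And>l. l < r \<Longrightarrow> (\<Sum>(a, s)\<leftarrow>xs. a * s ^ l) = (if l = 1 then 1 else 0)"
    using finite_difference_list[of r] by blast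
  have eq: "(\<Sum>i<length xs. fst (xs ! i) * snd (xs ! i) ^ l) = (\<Sum>(a, s)\<leftarrow>xs. a * s ^ l)" for l
    by (simp add: sum_list_sum_nth case_prod_beta atLeast0LessThan)
  have "\<forall>l<r. (\<Sum>i<length xs. fst (xs ! i) * snd (xs ! i) ^ l) = (if l = 1 then 1 else 0)"
    by (intro allI impI) (rule trans[OF eq xs(2)])
  moreover have "\<forall>z\<in>set xs. 0 \<le> snd z" using xs(1) by auto
  then have "\<forall>i<length xs. 0 \<le> snd (xs ! i)" using nth_mem by blast
  ultimately show ?thesis
    by (intro exI[of _ "length xs"] exI[of _ "\<lambda>i. fst (xs ! i)"] exI[of _ "\<lambda>i. snd (xs ! i)"] conjI)
qed

lemma powr_sum_le:
  fixes f :: "'i \<Rightarrow> real"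
  assumes A: "finite A" "A \<noteq> {}" and f: "\<And>i. i \<in> A \<Longrightarrow> 0 \<le> f i" and p: "0 \<le> p"
  shows "(\<Sum>i\<in>A. f i) powr p \<le> real (card A) powr p * (\<Sum>i\<in>A. f i powr p)"
proof -
  have "Max (f ` A) \<in> f ` A" using A by (intro Max_in) auto
  then obtain j where jA: "j \<in> A" and "f j = Max (f ` A)" by auto
  then have "f i \<le> f j" if "i \<in> A" for i
    using A(1) that by simp
  note j = jA this
  have "(\<Sum>i\<in>A. f i) powr p \<le> (real (card A) * f j) powr p"
    using sum_bounded_above[of A f "f j"] j f p by (intro powr_mono2 sum_nonneg) auto
  also have "\<dots> = real (card A) powr p * f j powr p"
    by (rule powr_mult)
  also have "\<dots> \<le> real (card A) powr p * (\<Sum>i\<in>A. f i powr p)"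
    using A j by (intro mult_left_mono member_le_sum) auto
  finally show ?thesis .
qed

definition cube_power :: "real \<Rightarrow> ('a::euclidean_space \<Rightarrow> complex) \<Rightarrow> real" where
  "cube_power p g = (LINT x|lborel. indicator unit_cube x * norm (g x) powr p)"

lemma cube_norm_bound: "x \<in> (unit_cube :: 'a::euclidean_space set) \<Longrightarrow> norm x \<le> real DIM('a)"
proof -
  assume "x \<in> (unit_cube :: 'a set)"
  then have "\<bar>x \<bullet> b\<bar> \<le> 1" if "b \<in> Basis" for b
    using that by (auto simp: mem_box abs_le_iff less_imp_le intro: order_trans[of _ 0])
  then have "(\<Sum>b\<in>Basis. \<bar>x \<bullet> b\<bar>) \<le> (\<Sum>b\<in>(Basis::'a set). 1)"
    by (intro sum_mono)
  then show ?thesis using norm_le_l1[of x] by simp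
qed

lemma integrable_cube:
  fixes f :: "'a::euclidean_space \<Rightarrow> real"
  assumes "f \<in> borel_measurable borel" "\<And>x. x \<in> unit_cube \<Longrightarrow> \<bar>f x\<bar> \<le> B" "0 \<le> B"
  shows "integrable lborel (\<lambda>x. indicator unit_cube x * f x)"
proof (rule integrable_bounded_support[where B=B and r="real DIM('a)"])
  show "(\<lambda>x. indicator unit_cube x * f x) \<in> borel_measurable borel"
    using assms(1) by measurable
  show "norm (indicator unit_cube z * f z) \<le> B" for z
    using assms(2,3) by (auto simp: indicator_def)
  show "real DIM('a) < norm z \<Longrightarrow> indicator unit_cube z * f z = 0" for z :: 'a
    using cube_norm_bound[of z] by (auto simp: indicator_def)
qed

lemma cube_power_integrable:
  fixes g :: "'a::euclidean_space \<Rightarrow> complex"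
  assumes g: "g \<in> borel_measurable borel" "\<And>x. x \<in> unit_cube \<Longrightarrow> norm (g x) \<le> B" and p: "0 \<le> p"
  shows "integrable lborel (\<lambda>x. indicator unit_cube x * norm (g x) powr p)"
proof (rule integrable_cube)
  show "(\<lambda>x. norm (g x) powr p) \<in> borel_measurable borel" using g(1) by measurable
  show "\<bar>norm (g x) powr p\<bar> \<le> B powr p" if "x \<in> unit_cube" for x
    using g(2)[OF that] p by (simp add: powr_mono2)
qed simp

lemma integrable_lborel_translate:
  fixes g :: "'a::euclidean_space \<Rightarrow> real"
  assumes "integrable lborel g"
  shows "integrable lborel (\<lambda>x. g (x + h))"
proof -
  have "integrable (distr lborel borel ((+) h)) g"
    using assms by (simp add: lborel_distr_plus)
  then have "integrable lborel (\<lambda>x. g (h + x))"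
    using assms by (subst (asm) integrable_distr_eq) auto
  then show ?thesis by (simp add: add.commute)
qed

lemma lborel_cube [simp]: "(LINT x|lborel. indicator (unit_cube :: 'a::euclidean_space set) x) = (1::real)"
proof -
  have "measure lborel (unit_cube :: 'a set) = (\<Prod>b\<in>(Basis::'a set). (One - 0) \<bullet> b)"
    by (rule measure_lborel_box_eq[THEN trans]) auto
  then show ?thesis by simp
qed

text \<open>A finite difference formula of order \<open>r\<close> expresses \<open>\<epsilon>\<close> times the derivative in direction \<open>e\<close> by values of
  \<open>V bs\<close> on the line through \<open>x\<close>, with an error controlled by Taylor's formula. The number of nodes and the
  coefficients are absorbed into \<open>A\<close>.\<close>

lemma interpolation_step:
  assumes p: "1 \<le> p" and r: "2 \<le> (r::nat)"
  obtains A \<epsilon>0 where "0 < A" "0 < \<epsilon>0"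
    "\<And>k M (V :: 'a::euclidean_space list \<Rightarrow> 'a \<Rightarrow> complex) bs e \<epsilon>. smooth_family k M V \<Longrightarrow> set bs \<subseteq> Basis \<Longrightarrow>
       length bs + r = k \<Longrightarrow> e \<in> Basis \<Longrightarrow> 0 < \<epsilon> \<Longrightarrow> \<epsilon> \<le> \<epsilon>0 \<Longrightarrow>
       \<epsilon> powr p * cube_power p (V (e # bs)) \<le> A * (cube_power p (V bs) + (\<epsilon> ^ r * M) powr p)"
proof -
  obtain n and \<mu> s :: "nat \<Rightarrow> real" where coeffs: "(\<forall>i<n. 0 \<le> s i) \<and>
    (\<forall>l<r. (\<Sum>i<n. \<mu> i * s i ^ l) = (if l = 1 then 1 else 0))"
    using finite_difference_coefficients[of r] by (elim exE) (rule that)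
  then have s: "\<And>i. i < n \<Longrightarrow> 0 \<le> s i"
    and mom: "\<And>l. l < r \<Longrightarrow> (\<Sum>i<n. \<mu> i * s i ^ l) = (if l = 1 then 1 else 0)"
    by simp_all
  define B where "B = 1 + (\<Sum>i<n. s i)"
  have B: "1 \<le> B" "\<And>i. i < n \<Longrightarrow> s i \<le> B"
  proof -
    show "1 \<le> B" using s by (auto simp: B_def intro: sum_nonneg)
    show "s i \<le> B" if "i < n" for i
      using member_le_sum[of i "{..<n}" s] s that by (auto simp: B_def)
  qed
  \<comment> \<open>\<open>L\<close> bounds both the coefficients and the sum of the coefficients weighted by the remainders.\<close>
  define L where "L = 1 + (\<Sum>i<n. \<bar>\<mu> i\<bar>) * B ^ r"
  have Bp: "1 \<le> B ^ r" using B(1) by (rule one_le_power)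
  have Lmu: "\<bar>\<mu> i\<bar> \<le> L" if "i < n" for i
  proof -
    have "\<bar>\<mu> i\<bar> \<le> (\<Sum>i<n. \<bar>\<mu> i\<bar>) * 1" using that member_le_sum[of i "{..<n}" "\<lambda>i. \<bar>\<mu> i\<bar>"] by simp
    also have "\<dots> \<le> (\<Sum>i<n. \<bar>\<mu> i\<bar>) * B ^ r" using Bp by (intro mult_left_mono sum_nonneg) auto
    finally show ?thesis by (simp add: L_def)
  qed
  have L: "1 \<le> L" using Bp by (auto simp: L_def intro!: mult_nonneg_nonneg sum_nonneg)
  define A1 where "A1 = L powr p * real (Suc n) powr p"
  have A1: "0 < A1" using L by (simp add: A1_def)
  define A where "A = A1 * (2 * real n + 1)"
  show ?thesis
  proof (rule that[of A "1 / (4 * B)"])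
    show "0 < A" using A1 by (simp add: A_def)
    show "0 < 1 / (4 * B)" using B by simp
    fix k M and V :: "'a list \<Rightarrow> 'a \<Rightarrow> complex" and bs :: "'a list" and e :: 'a and \<epsilon> :: real
    assume V: "smooth_family k M V" and bs: "set bs \<subseteq> Basis" and kr: "length bs + r = k" and e: "e \<in> Basis"
      and \<epsilon>: "0 < \<epsilon>" "\<epsilon> \<le> 1 / (4 * B)"
    have ebs: "set (e # bs) \<subseteq> Basis" "length (e # bs) \<le> k" and bsk: "length bs \<le> k" "length bs < k" "k - length bs = r"
      using bs e kr r by auto
    note M = smooth_family_nonneg[OF V]
    let ?Q = "unit_cube :: 'a set"
    let ?D = "\<epsilon> ^ r * M"
    have D: "0 \<le> ?D" using M \<epsilon> by simp
    have \<epsilon>s: "0 \<le> \<epsilon> * s i" "\<epsilon> * s i \<le> 1 / 4" if "i < n" for i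
    proof -
      show "0 \<le> \<epsilon> * s i" using \<epsilon> s[OF that] by simp
      have "\<epsilon> * s i \<le> 1 / (4 * B) * B"
        using \<epsilon> B s[OF that] that by (intro mult_mono) auto
      then show "\<epsilon> * s i \<le> 1 / 4" using B by simp
    qed
    have formula: "\<epsilon> * norm (V (e # bs) x) \<le> L * ((\<Sum>i<n. norm (V bs (x + (\<kappa> * \<epsilon> * s i) *\<^sub>R e))) + ?D)"
      if x: "x \<in> ?Q" and \<kappa>: "\<bar>\<kappa>\<bar> = 1" and inQ: "\<And>i. i < n \<Longrightarrow> x + (\<kappa> * \<epsilon> * s i) *\<^sub>R e \<in> ?Q" for x and \<kappa> :: real
    proof -
      let ?t = "\<lambda>i. \<kappa> * \<epsilon> * s i"
      let ?T = "\<lambda>t. \<Sum>l<r. (t ^ l / fact l) *\<^sub>R V (replicate l e @ bs) x"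
      have "(\<Sum>i<n. \<mu> i *\<^sub>R ?T (?t i)) = (\<Sum>l<r. \<Sum>i<n. (\<mu> i * (?t i ^ l / fact l)) *\<^sub>R V (replicate l e @ bs) x)"
        by (subst sum.swap) (simp add: scaleR_sum_right)
      also have "\<dots> = (\<Sum>l<r. ((\<kappa> * \<epsilon>) ^ l / fact l * (\<Sum>i<n. \<mu> i * s i ^ l)) *\<^sub>R V (replicate l e @ bs) x)"
        by (simp add: scaleR_sum_left sum_distrib_left power_mult_distrib mult_ac)
      also have "\<dots> = (\<Sum>l<r. if l = 1 then (\<kappa> * \<epsilon>) *\<^sub>R V (e # bs) x else 0)"
        by (intro sum.cong refl) (auto simp: mom)
      also have "\<dots> = (\<kappa> * \<epsilon>) *\<^sub>R V (e # bs) x"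
        using r by simp
      finally have *: "(\<Sum>i<n. \<mu> i *\<^sub>R ?T (?t i)) = (\<kappa> * \<epsilon>) *\<^sub>R V (e # bs) x" .
      have rem: "norm (V bs (x + ?t i *\<^sub>R e) - ?T (?t i)) \<le> B ^ r * ?D" if i: "i < n" for i
      proof -
        have "norm (V bs (x + ?t i *\<^sub>R e) - ?T (?t i)) \<le> M * \<bar>?t i\<bar> ^ r"
          using smooth_family_taylor[OF V bs bsk(2) e x inQ[OF i]] by (simp only: bsk(3))
        also have "\<bar>?t i\<bar> = \<epsilon> * s i"
          using \<kappa> \<epsilon> s[OF i] by (simp add: abs_mult)
        also have "M * (\<epsilon> * s i) ^ r \<le> M * (\<epsilon> * B) ^ r"
          using M \<epsilon> s[OF i] B(2)[OF i] by (intro mult_left_mono power_mono) auto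
        finally show ?thesis by (simp add: power_mult_distrib mult_ac)
      qed
      have "\<epsilon> * norm (V (e # bs) x) = norm ((\<kappa> * \<epsilon>) *\<^sub>R V (e # bs) x)"
        using \<kappa> \<epsilon> by (simp add: abs_mult)
      also have "\<dots> = norm (\<Sum>i<n. \<mu> i *\<^sub>R V bs (x + ?t i *\<^sub>R e) - \<mu> i *\<^sub>R (V bs (x + ?t i *\<^sub>R e) - ?T (?t i)))"
        unfolding *[symmetric] by (simp add: scaleR_diff_right)
      also have "\<dots> \<le> (\<Sum>i<n. L * norm (V bs (x + ?t i *\<^sub>R e)) + \<bar>\<mu> i\<bar> * (B ^ r * ?D))"
      proof (rule sum_norm_le)
        fix i assume "i \<in> {..<n}"
        then have i: "i < n" by simp
        have "norm (\<mu> i *\<^sub>R V bs (x + ?t i *\<^sub>R e) - \<mu> i *\<^sub>R (V bs (x + ?t i *\<^sub>R e) - ?T (?t i)))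
          \<le> \<bar>\<mu> i\<bar> * norm (V bs (x + ?t i *\<^sub>R e)) + \<bar>\<mu> i\<bar> * norm (V bs (x + ?t i *\<^sub>R e) - ?T (?t i))"
          by (rule order_trans[OF norm_triangle_ineq4]) simp
        also have "\<dots> \<le> L * norm (V bs (x + ?t i *\<^sub>R e)) + \<bar>\<mu> i\<bar> * (B ^ r * ?D)"
          using Lmu[OF i] rem[OF i] by (intro add_mono mult_right_mono mult_left_mono) auto
        finally show "norm (\<mu> i *\<^sub>R V bs (x + ?t i *\<^sub>R e) - \<mu> i *\<^sub>R (V bs (x + ?t i *\<^sub>R e) - ?T (?t i)))
          \<le> L * norm (V bs (x + ?t i *\<^sub>R e)) + \<bar>\<mu> i\<bar> * (B ^ r * ?D)" .
      qed
      also have "\<dots> = L * (\<Sum>i<n. norm (V bs (x + ?t i *\<^sub>R e))) + (L - 1) * ?D"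
        by (simp add: sum.distrib sum_distrib_left sum_distrib_right L_def mult.assoc)
      also have "\<dots> \<le> L * (\<Sum>i<n. norm (V bs (x + ?t i *\<^sub>R e))) + L * ?D"
        using D by (intro add_left_mono mult_right_mono) auto
      finally show ?thesis by (simp add: distrib_left)
    qed
    let ?g = "\<lambda>y. indicator ?Q y * norm (V bs y) powr p"
    have g0: "0 \<le> ?g y" for y by simp
    have p0: "0 \<le> p" using p by simp
    have main: "indicator ?Q x * (\<epsilon> powr p * norm (V (e # bs) x) powr p) \<le>
        A1 * ((\<Sum>i<n. ?g (x + (\<epsilon> * s i) *\<^sub>R e) + ?g (x + (- \<epsilon> * s i) *\<^sub>R e)) + indicator ?Q x * ?D powr p)" for x
    proof (cases "x \<in> ?Q")
      case True
      \<comment> \<open>The sign of the step points towards the more distant face of the cube, so a step of length at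
        most \<open>1 / 4\<close> does not leave it.\<close>
      define \<kappa> :: real where "\<kappa> = (if x \<bullet> e < 1 / 2 then 1 else - 1)"
      have \<kappa>: "\<bar>\<kappa>\<bar> = 1" by (simp add: \<kappa>_def)
      have xb: "0 < x \<bullet> b" "x \<bullet> b < 1" if "b \<in> Basis" for b
        using True that by (auto simp: mem_box)
      have inQ: "x + (\<kappa> * \<epsilon> * s i) *\<^sub>R e \<in> ?Q" if i: "i < n" for i
      proof -
        have "0 < (x + (\<kappa> * \<epsilon> * s i) *\<^sub>R e) \<bullet> b \<and> (x + (\<kappa> * \<epsilon> * s i) *\<^sub>R e) \<bullet> b < 1" if b: "b \<in> Basis" for b
        proof (cases "b = e")
          case True
          then show ?thesis
            using xb[OF e] \<epsilon>s[OF i] e by (auto simp: inner_add_left \<kappa>_def)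
        next
          case False
          then show ?thesis
            using xb[OF b] e b by (simp add: inner_add_left inner_Basis)
        qed
        then show ?thesis by (auto simp: mem_box)
      qed
      let ?y = "\<lambda>i. x + (\<kappa> * \<epsilon> * s i) *\<^sub>R e"
      \<comment> \<open>The remainder is the summand with index \<open>n\<close>, so that \<open>powr_sum_le\<close> treats all terms at once.\<close>
      define f where "f i = (if i < n then norm (V bs (?y i)) else ?D)" for i
      have f0: "0 \<le> f i" for i using D by (simp add: f_def)
      have fs: "(\<Sum>i<Suc n. f i) = (\<Sum>i<n. norm (V bs (?y i))) + ?D"
        by (simp add: f_def)
      have "(\<epsilon> * norm (V (e # bs) x)) powr p \<le> (L * (\<Sum>i<Suc n. f i)) powr p"
        unfolding fs using formula[OF True \<kappa> inQ] \<epsilon> p0 by (intro powr_mono2) auto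
      also have "\<dots> = L powr p * (\<Sum>i<Suc n. f i) powr p"
        by (rule powr_mult)
      also have "\<dots> \<le> L powr p * (real (card {..<Suc n}) powr p * (\<Sum>i<Suc n. f i powr p))"
        using f0 p0 by (intro mult_left_mono powr_sum_le) auto
      also have "\<dots> = A1 * ((\<Sum>i<n. ?g (?y i)) + ?D powr p)"
        using inQ by (simp add: A1_def f_def)
      also have "\<dots> \<le> A1 * ((\<Sum>i<n. ?g (x + (\<epsilon> * s i) *\<^sub>R e) + ?g (x + (- \<epsilon> * s i) *\<^sub>R e)) + ?D powr p)"
      proof (intro mult_left_mono add_right_mono sum_mono)
        fix i
        show "?g (?y i) \<le> ?g (x + (\<epsilon> * s i) *\<^sub>R e) + ?g (x + (- \<epsilon> * s i) *\<^sub>R e)"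
          using g0 by (simp add: \<kappa>_def)
      qed (use A1 in simp)
      finally show ?thesis
        using True \<epsilon> by (simp add: powr_mult)
    next
      case False
      have "0 \<le> A1 * ((\<Sum>i<n. ?g (x + (\<epsilon> * s i) *\<^sub>R e) + ?g (x + (- \<epsilon> * s i) *\<^sub>R e)) + indicator ?Q x * ?D powr p)"
        using A1 g0 by (intro mult_nonneg_nonneg add_nonneg_nonneg sum_nonneg) auto
      then show ?thesis using False by simp
    qed
    have gi: "integrable lborel ?g"
      using smooth_family_measurable[OF V bs bsk(1)] smooth_family_bound[OF V bs bsk(1)] p0
      by (rule cube_power_integrable)
    have gm: "?g \<in> borel_measurable borel"
      using borel_measurable_integrable[OF gi] by simp
    have gt: "(LINT x|lborel. ?g (x + h)) = cube_power p (V bs)" for h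
      unfolding cube_power_def by (rule lborel_integral_translate[OF gm])
    have hi: "integrable lborel (\<lambda>x. indicator ?Q x * norm (V (e # bs) x) powr p)"
      using smooth_family_measurable[OF V ebs] smooth_family_bound[OF V ebs] p0
      by (rule cube_power_integrable)
    have qi: "integrable lborel (\<lambda>x. indicator ?Q x * ?D powr p)"
      by (rule integrable_cube[where B="?D powr p"]) auto
    note ti = integrable_lborel_translate[OF gi]
    have "\<epsilon> powr p * cube_power p (V (e # bs)) = (LINT x|lborel. indicator ?Q x * (\<epsilon> powr p * norm (V (e # bs) x) powr p))"
      unfolding cube_power_def by (simp flip: integral_mult_right_zero add: mult_ac)
    also have "\<dots> \<le> (LINT x|lborel. A1 * ((\<Sum>i<n. ?g (x + (\<epsilon> * s i) *\<^sub>R e) + ?g (x + (- \<epsilon> * s i) *\<^sub>R e)) + indicator ?Q x * ?D powr p))"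
    proof (rule integral_mono)
      have "integrable lborel (\<lambda>x. \<epsilon> powr p * (indicator ?Q x * norm (V (e # bs) x) powr p))"
        using hi by (rule integrable_mult_right)
      then show "integrable lborel (\<lambda>x. indicator ?Q x * (\<epsilon> powr p * norm (V (e # bs) x) powr p))"
        by (simp add: mult_ac)
      show "integrable lborel (\<lambda>x. A1 * ((\<Sum>i<n. ?g (x + (\<epsilon> * s i) *\<^sub>R e) + ?g (x + (- \<epsilon> * s i) *\<^sub>R e)) + indicator ?Q x * ?D powr p))"
        by (intro integrable_mult_right Bochner_Integration.integrable_add Bochner_Integration.integrable_sum ti qi)
    qed (rule main)
    also have "\<dots> = A1 * ((\<Sum>i<n. cube_power p (V bs) + cube_power p (V bs)) + ?D powr p)"
      unfolding integral_mult_right_zero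
      by (simp only: Bochner_Integration.integral_add Bochner_Integration.integral_sum
          Bochner_Integration.integrable_add Bochner_Integration.integrable_sum ti qi gt integral_mult_left_zero lborel_cube) simp
    also have "\<dots> \<le> A * (cube_power p (V bs) + ?D powr p)"
    proof -
      have "0 \<le> cube_power p (V bs)" unfolding cube_power_def using g0 by (rule integral_nonneg_AE[OF AE_I2])
      then have "2 * real n * cube_power p (V bs) + ?D powr p \<le> (2 * real n + 1) * (cube_power p (V bs) + ?D powr p)"
        by (simp add: algebra_simps)
      then show ?thesis using A1 unfolding A_def mult.assoc by (intro mult_left_mono) auto
    qed
    finally show "\<epsilon> powr p * cube_power p (V (e # bs)) \<le> A * (cube_power p (V bs) + (\<epsilon> ^ r * M) powr p)" .
  qed
qed

text \<open>Induction on the order of the derivative. A derivative of order \<open>m\<close> has \<open>k - m\<close> bounded derivatives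
  left, so the next step is made with a formula of order \<open>k - m\<close>; after multiplication by
  \<open>\<epsilon> ^ m\<close> its error is \<open>\<epsilon> ^ k * M\<close> at every stage.\<close>

theorem interpolation:
  assumes p: "1 \<le> p"
  shows "m < k \<Longrightarrow> \<exists>A>0. \<exists>\<epsilon>0>0. \<forall>M (V :: 'a::euclidean_space list \<Rightarrow> 'a \<Rightarrow> complex) bs \<epsilon>. smooth_family k M V \<longrightarrow> set bs \<subseteq> Basis \<longrightarrow>
       length bs = m \<longrightarrow> 0 < \<epsilon> \<longrightarrow> \<epsilon> \<le> \<epsilon>0 \<longrightarrow>
       (\<epsilon> ^ m) powr p * cube_power p (V bs) \<le> A * (cube_power p (V []) + (\<epsilon> ^ k * M) powr p)"
proof (induction m)
  case 0
  show ?case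
    by (intro exI[of _ 1] conjI allI impI) auto
next
  case (Suc m)
  obtain A \<epsilon>0 where A: "0 < A" "0 < \<epsilon>0" and
    IH: "\<And>M (V :: 'a list \<Rightarrow> 'a \<Rightarrow> complex) bs \<epsilon>. smooth_family k M V \<Longrightarrow> set bs \<subseteq> Basis \<Longrightarrow>
       length bs = m \<Longrightarrow> 0 < \<epsilon> \<Longrightarrow> \<epsilon> \<le> \<epsilon>0 \<Longrightarrow>
       (\<epsilon> ^ m) powr p * cube_power p (V bs) \<le> A * (cube_power p (V []) + (\<epsilon> ^ k * M) powr p)"
    using Suc.IH Suc.prems by (meson Suc_lessD)
  have "2 \<le> k - m" using Suc.prems by simp
  from interpolation_step[OF p this, where 'a='a] obtain A' \<epsilon>1 where A': "0 < A'" "0 < \<epsilon>1" and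
    step: "\<And>K M (V :: 'a list \<Rightarrow> 'a \<Rightarrow> complex) bs e \<epsilon>. smooth_family K M V \<Longrightarrow> set bs \<subseteq> Basis \<Longrightarrow>
       length bs + (k - m) = K \<Longrightarrow> e \<in> Basis \<Longrightarrow> 0 < \<epsilon> \<Longrightarrow> \<epsilon> \<le> \<epsilon>1 \<Longrightarrow>
       \<epsilon> powr p * cube_power p (V (e # bs)) \<le> A' * (cube_power p (V bs) + (\<epsilon> ^ (k - m) * M) powr p)"
    by blast
  have "(\<epsilon> ^ Suc m) powr p * cube_power p (V bs) \<le> A' * (A + 1) * (cube_power p (V []) + (\<epsilon> ^ k * M) powr p)"
    if V: "smooth_family k M V" and bs: "set bs \<subseteq> Basis" "length bs = Suc m" and \<epsilon>: "0 < \<epsilon>" "\<epsilon> \<le> min \<epsilon>0 \<epsilon>1"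
    for M \<epsilon> and V :: "'a list \<Rightarrow> 'a \<Rightarrow> complex" and bs
  proof -
    obtain e cs where cs: "bs = e # cs" "length cs = m" using bs(2) by (auto simp: length_Suc_conv)
    have M: "0 \<le> M" by (rule smooth_family_nonneg[OF V])
    let ?X = "cube_power p (V [])" and ?E = "(\<epsilon> ^ k * M) powr p"
    have X: "0 \<le> ?X" unfolding cube_power_def by (intro integral_nonneg_AE AE_I2) auto
    have "(\<epsilon> ^ Suc m) powr p * cube_power p (V bs) = (\<epsilon> ^ m) powr p * (\<epsilon> powr p * cube_power p (V (e # cs)))"
      using \<epsilon> by (simp add: cs powr_mult)
    also have "\<dots> \<le> (\<epsilon> ^ m) powr p * (A' * (cube_power p (V cs) + (\<epsilon> ^ (k - m) * M) powr p))"
      using step[OF V, of cs e \<epsilon>] bs cs \<epsilon> Suc.prems by (intro mult_left_mono) auto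
    also have "\<dots> = A' * ((\<epsilon> ^ m) powr p * cube_power p (V cs) + (\<epsilon> ^ m * (\<epsilon> ^ (k - m) * M)) powr p)"
      using \<epsilon> M by (subst powr_mult) (auto simp: algebra_simps)
    also have "\<epsilon> ^ m * (\<epsilon> ^ (k - m) * M) = \<epsilon> ^ k * M"
      using Suc.prems by (simp add: mult.assoc[symmetric] flip: power_add)
    also have "A' * ((\<epsilon> ^ m) powr p * cube_power p (V cs) + ?E) \<le> A' * (A * (?X + ?E) + ?E)"
      using IH[OF V, of cs \<epsilon>] bs cs \<epsilon> A' by (intro mult_left_mono add_right_mono) auto
    also have "\<dots> \<le> A' * ((A + 1) * (?X + ?E))"
      using A' X by (intro mult_left_mono) (auto simp: algebra_simps)
    finally show ?thesis by (simp add: mult.assoc)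
  qed
  then show ?case
    using A A' by (intro exI[of _ "A' * (A + 1)"] conjI exI[of _ "min \<epsilon>0 \<epsilon>1"]) auto
qed

section \<open>Superpositions of neurons\<close>

lemma smooth_family_mono:
  assumes V: "smooth_family k M V" and "M \<le> M'"
  shows "smooth_family k M' V"
proof (rule smooth_familyI)
  fix bs :: "'a list" assume bs: "set bs \<subseteq> Basis" "length bs \<le> k"
  show "V bs \<in> borel_measurable borel" by (rule smooth_family_measurable[OF V bs])
  show "norm (V bs x) \<le> M'" if "x \<in> unit_cube" for x
    using smooth_family_bound[OF V bs that] assms(2) by simp
  show "(LINT x|lborel. iter_partial bs \<psi> x *\<^sub>R V [] x) = (-1) ^ length bs * (LINT x|lborel. \<psi> x *\<^sub>R V bs x)"
    if "test_function unit_cube \<psi>" for \<psi>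
    by (rule smooth_family_weak[OF V bs that])
next
  fix bs :: "'a list" and e x :: 'a and t :: real
  assume a: "set bs \<subseteq> Basis" "length bs < k" "e \<in> Basis" "x \<in> unit_cube" "x + t *\<^sub>R e \<in> unit_cube"
  show "norm (V bs (x + t *\<^sub>R e) - (\<Sum>l<k - length bs. (t ^ l / fact l) *\<^sub>R V (replicate l e @ bs) x)) \<le> M' * \<bar>t\<bar> ^ (k - length bs)"
    using smooth_family_taylor[OF V a] mult_right_mono[OF assms(2), of "\<bar>t\<bar> ^ (k - length bs)"] by simp
qed

lemma smooth_family_zero: "smooth_family k 0 (\<lambda>bs x. 0)"
  by (rule smooth_familyI) auto

context activation_data
begin

lemma \<phi>_reach_measurable [measurable]: "(\<lambda>z::'a::euclidean_space \<times> real. \<phi> (reach z)) \<in> borel_measurable borel"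
proof -
  have "mono (\<lambda>x. \<phi> (max 0 x))"
    using \<phi>_mono by (auto intro!: monoI elim!: mono_onD)
  then have m: "(\<lambda>x. \<phi> (max 0 x)) \<in> borel_measurable borel"
    by (rule borel_measurable_mono)
  have "(\<lambda>z::'a \<times> real. reach z) \<in> borel_measurable borel"
    unfolding reach_def l1_norm_def by (intro borel_measurable_continuous_onI continuous_intros)
  from measurable_compose[OF this m] show ?thesis
    using reach_nonneg[where 'a='a] by (simp add: max_absorb2)
qed

lemma N_smooth_family: "smooth_family k (C * \<phi> (reach z)) (\<lambda>bs. N bs z)"
  by (rule smooth_familyI) (auto intro!: N_measurable N_bound N_weak_deriv N_taylor)

context
  fixes \<mu> :: "('a::euclidean_space \<times> real) measure"
  assumes sets_\<mu> [measurable_cong]: "sets \<mu> = sets borel" and int_\<phi>: "integrable \<mu> (\<lambda>z. \<phi> (reach z))"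
begin

lemma finite_\<mu>: "finite_measure \<mu>"
proof
  have "integrable \<mu> (\<lambda>z. \<phi> 0)"
  proof (rule Bochner_Integration.integrable_bound[OF int_\<phi>])
    show "AE z in \<mu>. norm (\<phi> 0) \<le> norm (\<phi> (reach z))"
    proof (rule AE_I2)
      fix z :: "'a \<times> real"
      have "\<phi> 0 \<le> \<phi> (reach z)" using reach_nonneg[of z] by (intro mono_onD[OF \<phi>_mono]) auto
      then show "norm (\<phi> 0) \<le> norm (\<phi> (reach z))" using \<phi>_pos[of 0] by simp
    qed
  qed simp
  then have "ennreal (norm (\<phi> 0)) * emeasure \<mu> (space \<mu>) < \<infinity>"
    by (simp add: integrable_iff_bounded)
  then show "emeasure \<mu> (space \<mu>) \<noteq> \<infinity>"
    using \<phi>_pos[of 0] by (auto simp: ennreal_mult_eq_top_iff ennreal_mult_less_top)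
qed

lemma N_integrable:
  assumes bs: "set bs \<subseteq> Basis" "length bs \<le> k" and x: "x \<in> unit_cube"
  shows "integrable \<mu> (\<lambda>z. N bs z x)"
proof (rule Bochner_Integration.integrable_bound)
  show "integrable \<mu> (\<lambda>z. C * \<phi> (reach z))" using int_\<phi> by simp
  show "(\<lambda>z. N bs z x) \<in> borel_measurable \<mu>"
    by (rule N_measurable[OF bs(2)]) measurable
  show "AE z in \<mu>. norm (N bs z x) \<le> norm (C * \<phi> (reach z))"
    unfolding real_norm_def by (intro AE_I2 order_trans[OF N_bound[OF bs(2,1) x] abs_ge_self])
qed

lemma N_integral_Fubini:
  assumes bs: "set bs \<subseteq> Basis" "length bs \<le> k" and \<psi>: "test_function unit_cube \<psi>"
  shows "(LINT x|lborel. \<psi> x *\<^sub>R (\<integral>z. N bs z x \<partial>\<mu>)) = (\<integral>z. (LINT x|lborel. \<psi> x *\<^sub>R N bs z x) \<partial>\<mu>)"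
proof (rule test_function_bounds[OF \<psi>])
  fix B r assume B: "0 \<le> B" "\<And>x. \<bar>\<psi> x\<bar> \<le> B" "\<And>x. r < norm x \<Longrightarrow> \<psi> x = 0"
    "\<And>x. x \<notin> unit_cube \<Longrightarrow> \<psi> x = 0" and [measurable]: "\<psi> \<in> borel_measurable borel"
  interpret \<mu>: finite_measure \<mu> by (rule finite_\<mu>)
  interpret pair_sigma_finite lborel \<mu> ..
  have m: "(\<lambda>p. \<psi> (fst p) *\<^sub>R N bs (snd p) (fst p)) \<in> borel_measurable (lborel \<Otimes>\<^sub>M \<mu>)"
    by (intro borel_measurable_scaleR N_measurable[OF bs(2)]) measurable
  have m2: "(\<lambda>p. (B * indicator (unit_cube :: 'a set) (fst p)) * (C * \<phi> (reach (snd p)))) \<in> borel_measurable (lborel \<Otimes>\<^sub>M \<mu>)"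
    by measurable
  have "integrable (lborel \<Otimes>\<^sub>M \<mu>) (\<lambda>p. (B * indicator (unit_cube :: 'a set) (fst p)) * (C * \<phi> (reach (snd p))))"
  proof (rule Fubini_integrable[OF m2])
    have "\<bar>\<phi> (reach z)\<bar> = \<phi> (reach z)" for z :: "'a \<times> real"
      using \<phi>_pos[OF reach_nonneg[of z]] by simp
    moreover have "\<bar>C\<bar> = C" using C by simp
    ultimately have "(\<integral>z. norm ((B * indicator (unit_cube :: 'a set) (fst (x, z))) * (C * \<phi> (reach (snd (x, z))))) \<partial>\<mu>) =
        indicator unit_cube x * (B * (C * (\<integral>z. \<phi> (reach z) \<partial>\<mu>)))" for x :: 'a
      using B(1) by (simp add: abs_mult indicator_def)
    moreover have "integrable lborel (\<lambda>x::'a. indicator unit_cube x * (B * (C * (\<integral>z. \<phi> (reach z) \<partial>\<mu>))))"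
      by (rule integrable_cube[where B="\<bar>B * (C * (\<integral>z. \<phi> (reach z) \<partial>\<mu>))\<bar>"]) auto
    ultimately show "integrable lborel (\<lambda>x. \<integral>z. norm ((B * indicator (unit_cube :: 'a set) (fst (x, z))) * (C * \<phi> (reach (snd (x, z))))) \<partial>\<mu>)"
      by (simp only:)
    show "AE x in lborel. integrable \<mu> (\<lambda>z. (B * indicator (unit_cube :: 'a set) (fst (x, z))) * (C * \<phi> (reach (snd (x, z)))))"
      using int_\<phi> by (intro AE_I2) simp
  qed
  then have "integrable (lborel \<Otimes>\<^sub>M \<mu>) (\<lambda>p. \<psi> (fst p) *\<^sub>R N bs (snd p) (fst p))"
  proof (rule Bochner_Integration.integrable_bound[OF _ m])
    show "AE p in lborel \<Otimes>\<^sub>M \<mu>. norm (\<psi> (fst p) *\<^sub>R N bs (snd p) (fst p)) \<le>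
        norm ((B * indicator (unit_cube :: 'a set) (fst p)) * (C * \<phi> (reach (snd p))))"
    proof (rule AE_I2)
      fix p :: "'a \<times> 'a \<times> real"
      have C0: "0 \<le> C * \<phi> (reach (snd p))"
        using \<phi>_pos[OF reach_nonneg[of "snd p"]] C by (simp add: less_imp_le)
      show "norm (\<psi> (fst p) *\<^sub>R N bs (snd p) (fst p)) \<le>
        norm ((B * indicator (unit_cube :: 'a set) (fst p)) * (C * \<phi> (reach (snd p))))"
      proof (cases "fst p \<in> unit_cube")
        case True
        have "norm (\<psi> (fst p) *\<^sub>R N bs (snd p) (fst p)) \<le> B * (C * \<phi> (reach (snd p)))"
          unfolding norm_scaleR by (rule mult_mono[OF B(2) N_bound[OF bs(2,1) True] B(1) norm_ge_zero])
        also have "\<dots> \<le> norm ((B * indicator (unit_cube :: 'a set) (fst p)) * (C * \<phi> (reach (snd p))))"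
          using True by simp
        finally show ?thesis .
      qed (simp add: B(4))
    qed
  qed
  then have i: "integrable (lborel \<Otimes>\<^sub>M \<mu>) (\<lambda>(x, z). \<psi> x *\<^sub>R N bs z x)"
    by (simp add: case_prod_unfold)
  have "(LINT x|lborel. \<psi> x *\<^sub>R (\<integral>z. N bs z x \<partial>\<mu>)) = (LINT x|lborel. (\<integral>z. \<psi> x *\<^sub>R N bs z x \<partial>\<mu>))"
    by (simp only: integral_scaleR_right)
  also have "\<dots> = (\<integral>z. (LINT x|lborel. \<psi> x *\<^sub>R N bs z x) \<partial>\<mu>)"
    by (rule Fubini_integral[OF i, symmetric])
  finally show ?thesis .
qed

lemma norm_integral_le_cost:
  fixes g :: "'a \<times> real \<Rightarrow> complex"
  assumes "integrable \<mu> g" "\<And>z. norm (g z) \<le> K * (C * \<phi> (reach z))"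
  shows "norm (\<integral>z. g z \<partial>\<mu>) \<le> K * (C * (\<integral>z. \<phi> (reach z) \<partial>\<mu>))"
proof -
  have "norm (\<integral>z. g z \<partial>\<mu>) \<le> (\<integral>z. K * (C * \<phi> (reach z)) \<partial>\<mu>)"
    by (rule Bochner_Integration.integral_norm_bound_integral[OF assms(1)]) (use int_\<phi> assms(2) in auto)
  then show ?thesis by simp
qed

lemma N_integral_smooth_family:
  "smooth_family k (C * (\<integral>z. \<phi> (reach z) \<partial>\<mu>)) (\<lambda>bs x. \<integral>z. N bs z x \<partial>\<mu>)"
proof (rule smooth_familyI)
  interpret \<mu>: finite_measure \<mu> by (rule finite_\<mu>)
  fix bs :: "'a list" assume bs: "set bs \<subseteq> Basis" "length bs \<le> k"
  have "(\<lambda>(x, z). N bs z x) \<in> borel_measurable (borel \<Otimes>\<^sub>M \<mu>)"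
    unfolding case_prod_unfold by (rule N_measurable[OF bs(2)]) measurable
  then show "(\<lambda>x. \<integral>z. N bs z x \<partial>\<mu>) \<in> borel_measurable borel"
    by (rule \<mu>.borel_measurable_lebesgue_integral)
  show "norm (\<integral>z. N bs z x \<partial>\<mu>) \<le> C * (\<integral>z. \<phi> (reach z) \<partial>\<mu>)" if "x \<in> unit_cube" for x
    using norm_integral_le_cost[OF N_integrable[OF bs that], of 1] N_bound[OF bs(2,1) that] by simp
  show "(LINT x|lborel. iter_partial bs \<psi> x *\<^sub>R (\<integral>z. N [] z x \<partial>\<mu>)) = (-1) ^ length bs * (LINT x|lborel. \<psi> x *\<^sub>R (\<integral>z. N bs z x \<partial>\<mu>))"
    if \<psi>: "test_function unit_cube \<psi>" for \<psi>
  proof -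
    have "(LINT x|lborel. iter_partial bs \<psi> x *\<^sub>R (\<integral>z. N [] z x \<partial>\<mu>)) = (\<integral>z. (LINT x|lborel. iter_partial bs \<psi> x *\<^sub>R N [] z x) \<partial>\<mu>)"
      by (rule N_integral_Fubini[OF _ _ test_function_iter_partial[OF \<psi> bs(1)]]) auto
    also have "\<dots> = (\<integral>z. (-1) ^ length bs * (LINT x|lborel. \<psi> x *\<^sub>R N bs z x) \<partial>\<mu>)"
      by (simp only: N_weak_deriv[OF \<psi> bs])
    also have "\<dots> = (-1) ^ length bs * (\<integral>z. (LINT x|lborel. \<psi> x *\<^sub>R N bs z x) \<partial>\<mu>)"
      by (rule integral_mult_right_zero)
    finally show ?thesis by (simp only: N_integral_Fubini[OF bs \<psi>])
  qed
next
  fix bs :: "'a list" and e x :: 'a and t :: real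
  assume a: "set bs \<subseteq> Basis" "length bs < k" "e \<in> Basis" "x \<in> unit_cube" "x + t *\<^sub>R e \<in> unit_cube"
  let ?n = "k - length bs"
  have i1: "integrable \<mu> (\<lambda>z. N bs z (x + t *\<^sub>R e))"
    using a by (intro N_integrable) auto
  have i2: "integrable \<mu> (\<lambda>z. N (replicate l e @ bs) z x)" if "l < ?n" for l
    using a that by (intro N_integrable) auto
  have i3: "integrable \<mu> (\<lambda>z. \<Sum>l<?n. (t ^ l / fact l) *\<^sub>R N (replicate l e @ bs) z x)"
    by (intro Bochner_Integration.integrable_sum integrable_scaleR_right i2) simp
  have "(\<integral>z. N bs z (x + t *\<^sub>R e) - (\<Sum>l<?n. (t ^ l / fact l) *\<^sub>R N (replicate l e @ bs) z x) \<partial>\<mu>) =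
     (\<integral>z. N bs z (x + t *\<^sub>R e) \<partial>\<mu>) - (\<integral>z. (\<Sum>l<?n. (t ^ l / fact l) *\<^sub>R N (replicate l e @ bs) z x) \<partial>\<mu>)"
    by (rule Bochner_Integration.integral_diff[OF i1 i3])
  also have "(\<integral>z. (\<Sum>l<?n. (t ^ l / fact l) *\<^sub>R N (replicate l e @ bs) z x) \<partial>\<mu>) =
     (\<Sum>l<?n. (\<integral>z. (t ^ l / fact l) *\<^sub>R N (replicate l e @ bs) z x \<partial>\<mu>))"
    by (intro Bochner_Integration.integral_sum integrable_scaleR_right i2) simp
  also have "\<dots> = (\<Sum>l<?n. (t ^ l / fact l) *\<^sub>R (\<integral>z. N (replicate l e @ bs) z x \<partial>\<mu>))"
    by (simp only: integral_scaleR_right)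
  finally have eq: "(\<integral>z. N bs z (x + t *\<^sub>R e) \<partial>\<mu>) - (\<Sum>l<?n. (t ^ l / fact l) *\<^sub>R (\<integral>z. N (replicate l e @ bs) z x \<partial>\<mu>)) =
    (\<integral>z. N bs z (x + t *\<^sub>R e) - (\<Sum>l<?n. (t ^ l / fact l) *\<^sub>R N (replicate l e @ bs) z x) \<partial>\<mu>)" by (rule sym)
  have "norm (\<integral>z. N bs z (x + t *\<^sub>R e) - (\<Sum>l<?n. (t ^ l / fact l) *\<^sub>R N (replicate l e @ bs) z x) \<partial>\<mu>)
      \<le> \<bar>t\<bar> ^ ?n * (C * (\<integral>z. \<phi> (reach z) \<partial>\<mu>))"
  proof (rule norm_integral_le_cost[OF Bochner_Integration.integrable_diff[OF i1 i3]])
    fix z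
    show "norm (N bs z (x + t *\<^sub>R e) - (\<Sum>l<?n. (t ^ l / fact l) *\<^sub>R N (replicate l e @ bs) z x)) \<le> \<bar>t\<bar> ^ ?n * (C * \<phi> (reach z))"
      using N_taylor[OF a] by (simp only: mult.commute)
  qed
  then show "norm ((\<integral>z. N bs z (x + t *\<^sub>R e) \<partial>\<mu>) - (\<Sum>l<?n. (t ^ l / fact l) *\<^sub>R (\<integral>z. N (replicate l e @ bs) z x \<partial>\<mu>)))
      \<le> C * (\<integral>z. \<phi> (reach z) \<partial>\<mu>) * \<bar>t\<bar> ^ ?n"
    unfolding eq by (simp only: mult.commute)
qed

text \<open>For each single neuron the exceptional points form a null set. By Fubini almost every point is
  exceptional for almost no neuron.\<close>

lemma \<sigma>_integral_AE: "AE x in lborel. (\<integral>z. \<sigma> (fst z \<bullet> x + snd z) \<partial>\<mu>) = (\<integral>z. N [] z x \<partial>\<mu>)"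
proof -
  interpret \<mu>: finite_measure \<mu> by (rule finite_\<mu>)
  interpret pair_sigma_finite lborel \<mu> ..
  have sets': "sets \<mu> = sets (borel \<Otimes>\<^sub>M borel)"
    by (simp only: sets_\<mu> borel_prod)
  have "(\<lambda>p. \<sigma> (fst (snd p) \<bullet> fst p + snd (snd p))) \<in> borel_measurable (lborel \<Otimes>\<^sub>M (borel \<Otimes>\<^sub>M borel))"
    by measurable
  then have m1: "(\<lambda>p. \<sigma> (fst (snd p) \<bullet> fst p + snd (snd p))) \<in> borel_measurable (lborel \<Otimes>\<^sub>M \<mu>)"
    by (simp only: measurable_cong_sets[OF sets_pair_measure_cong[OF refl sets'] refl])
  have m2: "(\<lambda>p. N [] (snd p) (fst p)) \<in> borel_measurable (lborel \<Otimes>\<^sub>M \<mu>)"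
    by (rule N_measurable) (simp, measurable)
  have "AE z in \<mu>. AE x in lborel. \<sigma> (fst z \<bullet> x + snd z) = N [] z x"
    by (rule AE_I2) (rule N_Nil_AE)
  moreover have "{p \<in> space (lborel \<Otimes>\<^sub>M \<mu>). \<sigma> (fst (snd p) \<bullet> fst p + snd (snd p)) = N [] (snd p) (fst p)} \<in> sets (lborel \<Otimes>\<^sub>M \<mu>)"
  proof -
    have "(\<lambda>p. \<sigma> (fst (snd p) \<bullet> fst p + snd (snd p)) - N [] (snd p) (fst p)) -` {0} \<inter> space (lborel \<Otimes>\<^sub>M \<mu>) \<in> sets (lborel \<Otimes>\<^sub>M \<mu>)"
      by (rule measurable_sets[OF borel_measurable_diff[OF m1 m2]]) simp
    also have "(\<lambda>p. \<sigma> (fst (snd p) \<bullet> fst p + snd (snd p)) - N [] (snd p) (fst p)) -` {0} \<inter> space (lborel \<Otimes>\<^sub>M \<mu>) =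
       {p \<in> space (lborel \<Otimes>\<^sub>M \<mu>). \<sigma> (fst (snd p) \<bullet> fst p + snd (snd p)) = N [] (snd p) (fst p)}"
      by auto
    finally show ?thesis .
  qed
  ultimately have "AE x in lborel. AE z in \<mu>. \<sigma> (fst z \<bullet> x + snd z) = N [] z x"
    by (subst AE_commute)
  then show ?thesis
  proof eventually_elim
    case (elim x)
    show ?case
    proof (rule integral_cong_AE[OF _ _ elim])
      have "(\<lambda>z. \<sigma> (fst z \<bullet> x + snd z)) \<in> borel_measurable (borel \<Otimes>\<^sub>M borel)" by measurable
      then show "(\<lambda>z. \<sigma> (fst z \<bullet> x + snd z)) \<in> borel_measurable \<mu>"
        by (simp only: measurable_cong_sets[OF sets' refl])
      show "(\<lambda>z. N [] z x) \<in> borel_measurable \<mu>" by (rule N_measurable) (simp, measurable)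
    qed
  qed
qed

end

text \<open>Four superpositions, one for each measure of the decomposition of \<open>\<rho>\<close>, account for the factor 4.\<close>

lemma barron_smooth_family:
  fixes \<rho> :: "('a::euclidean_space \<times> real) set \<Rightarrow> complex"
  assumes \<rho>: "\<rho> \<in> barron_measures \<phi>"
  obtains V where "smooth_family k (4 * C * barron_cost \<phi> \<rho>) V"
    "AE x in lborel. complex_integral \<rho> (\<lambda>(w, b). \<sigma> (w \<bullet> x + b)) = V [] x"
proof -
  have cm: "complex_measure \<rho>" and int: "integrable (total_variation \<rho>) (\<lambda>z. \<phi> (reach z))"
    using \<rho> by (auto simp: barron_measures_def reach_def case_prod_unfold)
  have cost: "barron_cost \<phi> \<rho> = (\<integral>z. \<phi> (reach z) \<partial>total_variation \<rho>)"
    by (simp add: barron_cost_def reach_def case_prod_unfold)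
  obtain \<mu> :: "nat \<Rightarrow> ('a \<times> real) measure" where \<mu>: "\<And>i. sets (\<mu> i) = sets borel" "\<And>i. \<mu> i \<le> total_variation \<rho>"
    "\<And>h. complex_integral \<rho> h =
       (\<integral>z. h z \<partial>\<mu> 0) - (\<integral>z. h z \<partial>\<mu> 1) + \<i> * ((\<integral>z. h z \<partial>\<mu> 2) - (\<integral>z. h z \<partial>\<mu> 3))"
    using complex_integral_decomposition[OF cm] by (metis (no_types))
  have \<phi>0: "0 \<le> \<phi> (reach z)" for z :: "'a \<times> real"
    by (rule less_imp_le[OF \<phi>_pos[OF reach_nonneg]])
  have nn: "(\<integral>\<^sup>+z. ennreal (\<phi> (reach z)) \<partial>\<mu> i) \<le> (\<integral>\<^sup>+z. ennreal (\<phi> (reach z)) \<partial>total_variation \<rho>)" for i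
    by (rule nn_integral_mono_measure) (simp_all add: \<mu>)
  have fin: "(\<integral>\<^sup>+z. ennreal (\<phi> (reach z)) \<partial>total_variation \<rho>) = ennreal (barron_cost \<phi> \<rho>)"
    unfolding cost using int \<phi>0 by (intro nn_integral_eq_integral) auto
  have m: "(\<lambda>z. \<phi> (reach z)) \<in> borel_measurable (\<mu> i)" for i
    using \<phi>_reach_measurable \<mu>(1) by (metis measurable_cong_sets)
  have i: "integrable (\<mu> i) (\<lambda>z. \<phi> (reach z))" for i
    using nn[of i] m \<phi>0 unfolding fin by (intro integrableI_nonneg) (auto intro: order_le_less_trans[OF _ ennreal_less_top])
  have c0: "0 \<le> barron_cost \<phi> \<rho>"
    unfolding cost using \<phi>0 by (intro integral_nonneg_AE AE_I2)
  have le: "(\<integral>z. \<phi> (reach z) \<partial>\<mu> j) \<le> barron_cost \<phi> \<rho>" for j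
  proof -
    have "ennreal (\<integral>z. \<phi> (reach z) \<partial>\<mu> j) \<le> ennreal (barron_cost \<phi> \<rho>)"
      using nn[of j] i[of j] \<phi>0 unfolding fin by (subst nn_integral_eq_integral[symmetric]) auto
    then show ?thesis using c0 by simp
  qed
  define W where "W j bs x = (\<integral>z. N bs z x \<partial>\<mu> j)" for j and bs :: "'a list" and x
  let ?K = "C * barron_cost \<phi> \<rho>"
  have W: "smooth_family k ?K (W j)" for j
    unfolding W_def
    by (rule smooth_family_mono[OF N_integral_smooth_family[OF \<mu>(1) i]]) (use le C in simp)
  define V where "V bs x = (W 0 bs x + (- 1) * W 1 bs x) + \<i> * (W 2 bs x + (- 1) * W 3 bs x)" for bs x
  have "smooth_family k ((?K + norm (- 1 :: complex) * ?K) + norm \<i> * (?K + norm (- 1 :: complex) * ?K)) V"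
    unfolding V_def by (intro smooth_family_add smooth_family_mult W)
  then have "smooth_family k (4 * C * barron_cost \<phi> \<rho>) V"
    by (simp add: algebra_simps)
  moreover have "AE x in lborel. \<forall>j\<in>{..3::nat}. (\<integral>z. \<sigma> (fst z \<bullet> x + snd z) \<partial>\<mu> j) = W j [] x"
    unfolding W_def by (intro AE_finite_allI \<sigma>_integral_AE[OF \<mu>(1) i]) simp
  then have "AE x in lborel. complex_integral \<rho> (\<lambda>(w, b). \<sigma> (w \<bullet> x + b)) = V [] x"
    by eventually_elim (simp add: \<mu>(3) V_def case_prod_unfold)
  ultimately show ?thesis by (rule that)
qed

lemma network_smooth_family:
  fixes \<theta> :: "'a::euclidean_space network"
  shows "\<exists>V. smooth_family k (C * network_cost \<phi> \<theta>) V \<and> (AE x in lborel. realize \<sigma> \<theta> x = V [] x)"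
proof (induction \<theta>)
  case Nil
  show ?case
    using smooth_family_zero by (intro exI[of _ "\<lambda>bs x. 0"]) (simp add: network_cost_def realize_def)
next
  case (Cons h \<theta>)
  obtain a w b where h: "h = (a, w, b)" by (cases h)
  obtain V where V: "smooth_family k (C * network_cost \<phi> \<theta>) V" "AE x in lborel. realize \<sigma> \<theta> x = V [] x"
    using Cons.IH by (elim exE conjE)
  let ?W = "\<lambda>bs x. a * N bs (w, b) x + V bs x"
  have "smooth_family k (norm a * (C * \<phi> (reach (w, b))) + C * network_cost \<phi> \<theta>) ?W"
    by (intro smooth_family_add smooth_family_mult N_smooth_family V)
  then have "smooth_family k (C * network_cost \<phi> (h # \<theta>)) ?W"
    by (simp add: h network_cost_def reach_def algebra_simps)
  moreover have "AE x in lborel. realize \<sigma> (h # \<theta>) x = ?W [] x"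
    using V(2) N_Nil_AE[of "(w, b)"] by eventually_elim (simp add: h realize_def)
  ultimately show ?case by (intro exI[of _ ?W] conjI)
qed

lemma network_cost_nonneg: "0 \<le> network_cost \<phi> \<theta>"
proof (induction \<theta>)
  case (Cons h \<theta>)
  obtain a w b where h: "h = (a, w, b)" by (cases h)
  have "0 < \<phi> (l1_norm w + \<bar>b\<bar>)" using l1_norm_nonneg[of w] by (intro \<phi>_pos) auto
  then show ?case using Cons.IH by (simp add: h network_cost_def)
qed (simp add: network_cost_def)

end

section \<open>Sobolev norms of smooth families\<close>

lemma has_weak_deriv_unique:
  fixes u v w :: "'a::euclidean_space \<Rightarrow> complex"
  assumes \<Omega>: "open \<Omega>" and v: "has_weak_deriv \<Omega> \<alpha> u v" and w: "has_weak_deriv \<Omega> \<alpha> u w"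
  shows "AE x in lebesgue. x \<in> \<Omega> \<longrightarrow> v x = w x"
proof -
  have l: "locally_integrable \<Omega> v" "locally_integrable \<Omega> w"
    using v w by (auto simp: has_weak_deriv_def)
  have "AE x in lebesgue. x \<in> \<Omega> \<longrightarrow> v x - w x = 0"
  proof (rule fundamental_lemma[OF _ \<Omega>])
    show "locally_integrable \<Omega> (\<lambda>x. v x - w x)"
      using l unfolding locally_integrable_def by (auto intro!: set_integral_diff)
    fix \<psi> :: "'a \<Rightarrow> real" assume \<psi>: "test_function \<Omega> \<psi>"
    have i: "integrable (lebesgue_on \<Omega>) (\<lambda>x. \<psi> x *\<^sub>R g x)" if g: "locally_integrable \<Omega> g" for g
    proof (subst integrable_restrict_space)
      have "integrable lebesgue (\<lambda>x. \<psi> x *\<^sub>R g x)"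
        using \<psi> by (intro locally_integrable_mult_test[OF g]) (auto simp: test_function_iff smooth_continuous)
      moreover have "indicator \<Omega> x *\<^sub>R (\<psi> x *\<^sub>R g x) = \<psi> x *\<^sub>R g x" for x
        using \<psi> closure_subset[of "{x. \<psi> x \<noteq> 0}"] by (cases "\<psi> x = 0") (auto simp: test_function_iff indicator_def)
      ultimately show "integrable lebesgue (\<lambda>x. indicator \<Omega> x *\<^sub>R (\<psi> x *\<^sub>R g x))" by (simp only:)
    qed (use \<Omega> in auto)
    have "(-1) ^ size \<alpha> * (LINT x|lebesgue_on \<Omega>. \<psi> x *\<^sub>R v x) = (-1) ^ size \<alpha> * (LINT x|lebesgue_on \<Omega>. \<psi> x *\<^sub>R w x)"
      using v w \<psi> by (simp add: has_weak_deriv_def)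
    then have "(LINT x|lebesgue_on \<Omega>. \<psi> x *\<^sub>R v x) = (LINT x|lebesgue_on \<Omega>. \<psi> x *\<^sub>R w x)"
      unfolding mult_cancel_left by simp
    then show "(LINT x|lebesgue_on \<Omega>. \<psi> x *\<^sub>R (v x - w x)) = 0"
      unfolding scaleR_diff_right using Bochner_Integration.integral_diff[OF i[OF l(1)] i[OF l(2)]] by simp
  qed
  then show ?thesis by eventually_elim simp
qed

text \<open>Functions in Lebesgue and Sobolev spaces are given up to null sets and are Lebesgue measurable, while the
  explicit derivatives are Borel functions. The following lemmas pass from the former to the latter.\<close>

context
  fixes V g :: "'a::euclidean_space \<Rightarrow> complex" and M :: real
  assumes V: "V \<in> borel_measurable borel" and bound: "\<And>x. x \<in> unit_cube \<Longrightarrow> norm (V x) \<le> M"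
    and eq: "AE x in lebesgue. x \<in> unit_cube \<longrightarrow> g x = V x"
begin

lemma cube_measurable: "(\<lambda>x. indicator unit_cube x *\<^sub>R g x) \<in> borel_measurable lebesgue"
proof (rule borel_measurable_AE)
  have "(\<lambda>x. indicator unit_cube x *\<^sub>R V x) \<in> borel_measurable borel" using V by measurable
  then show "(\<lambda>x. indicator unit_cube x *\<^sub>R V x) \<in> borel_measurable lebesgue"
    by (simp add: measurable_completion)
  show "AE x in lebesgue. indicator unit_cube x *\<^sub>R V x = indicator unit_cube x *\<^sub>R g x"
    using eq by eventually_elim (auto simp: indicator_def)
qed

lemma cube_Lp:
  assumes p: "1 \<le> p"
  shows "g \<in> Lp_space p unit_cube" "(LINT x|lebesgue_on unit_cube. norm (g x) powr p) = cube_power p V"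
proof -
  let ?Q = "unit_cube :: 'a set"
  have m: "g \<in> borel_measurable (lebesgue_on ?Q)"
    using cube_measurable by (subst borel_measurable_restrict_space_iff) auto
  have e: "indicator ?Q x *\<^sub>R (norm (g x) powr p) = norm (indicator ?Q x *\<^sub>R g x) powr p" for x
    using p by (auto simp: indicator_def)
  have gm: "(\<lambda>x. indicator ?Q x *\<^sub>R (norm (g x) powr p)) \<in> borel_measurable lebesgue"
    unfolding e using cube_measurable by measurable
  have i: "integrable lborel (\<lambda>x. indicator ?Q x * norm (V x) powr p)"
    using p by (intro cube_power_integrable[OF V bound]) auto
  have Vm: "(\<lambda>x. indicator ?Q x * norm (V x) powr p) \<in> borel_measurable borel"
    using borel_measurable_integrable[OF i] by simp
  have Vl: "(\<lambda>x. indicator ?Q x * norm (V x) powr p) \<in> borel_measurable lebesgue"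
    using Vm by (simp add: measurable_completion)
  have ae: "AE x in lebesgue. indicator ?Q x *\<^sub>R (norm (g x) powr p) = indicator ?Q x * norm (V x) powr p"
    using eq by eventually_elim (auto simp: indicator_def)
  have "integrable lebesgue (\<lambda>x. indicator ?Q x *\<^sub>R (norm (g x) powr p))"
    using i Vm by (subst integrable_cong_AE[OF gm Vl ae]) (simp add: integrable_completion)
  then have "integrable (lebesgue_on ?Q) (\<lambda>x. norm (g x) powr p)"
    by (subst integrable_restrict_space) auto
  with m show "g \<in> Lp_space p ?Q" by (simp add: Lp_space_def)
  have "(LINT x|lebesgue_on ?Q. norm (g x) powr p) = (LINT x|lebesgue. indicator ?Q x *\<^sub>R (norm (g x) powr p))"
    by (rule integral_restrict_space) auto
  also have "\<dots> = (LINT x|lebesgue. indicator ?Q x * norm (V x) powr p)"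
    by (rule integral_cong_AE[OF gm Vl ae])
  also have "\<dots> = cube_power p V"
    unfolding cube_power_def by (rule integral_completion) (simp add: Vm)
  finally show "(LINT x|lebesgue_on ?Q. norm (g x) powr p) = cube_power p V" .
qed

lemma cube_locally_integrable: "locally_integrable unit_cube g"
  unfolding locally_integrable_def set_integrable_def
proof (intro allI impI)
  fix K :: "'a set" assume K: "compact K \<and> K \<subseteq> unit_cube"
  then have Km: "K \<in> sets borel" by (auto intro: borel_compact)
  have i: "integrable lborel (\<lambda>x. indicator K x *\<^sub>R V x)"
  proof (rule integrable_bounded_support[where B="\<bar>M\<bar>" and r="real DIM('a)"])
    show "(\<lambda>x. indicator K x *\<^sub>R V x) \<in> borel_measurable borel"
      using V Km by measurable
    show "norm (indicator K z *\<^sub>R V z) \<le> \<bar>M\<bar>" for z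
      using bound[of z] K by (auto simp: indicator_def)
    show "real DIM('a) < norm z \<Longrightarrow> indicator K z *\<^sub>R V z = 0" for z
      using cube_norm_bound[of z] K by (auto simp: indicator_def)
  qed
  then have Km': "(\<lambda>x. indicator K x *\<^sub>R V x) \<in> borel_measurable borel" by auto
  have Kl: "(\<lambda>x. indicator K x *\<^sub>R V x) \<in> borel_measurable lebesgue"
    using Km' by (simp add: measurable_completion)
  have ae: "AE x in lebesgue. indicator K x *\<^sub>R V x = indicator K x *\<^sub>R g x"
    using eq by eventually_elim (use K in \<open>auto simp: indicator_def\<close>)
  have "integrable lebesgue (\<lambda>x. indicator K x *\<^sub>R V x)"
    using i Km' by (simp add: integrable_completion)
  then show "integrable lebesgue (\<lambda>x. indicator K x *\<^sub>R g x)"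
    using integrable_cong_AE[OF Kl borel_measurable_AE[OF Kl ae] ae] by blast
qed

lemma cube_test_integral:
  assumes \<psi>: "test_function unit_cube \<psi>"
  shows "(LINT x|lebesgue_on unit_cube. \<psi> x *\<^sub>R g x) = (LINT x|lborel. \<psi> x *\<^sub>R V x)"
proof (rule test_function_bounds[OF \<psi>])
  let ?Q = "unit_cube :: 'a set"
  fix B r assume z: "\<And>x. x \<notin> ?Q \<Longrightarrow> \<psi> x = 0" and \<psi>m: "\<psi> \<in> borel_measurable borel"
  then have \<psi>l: "\<psi> \<in> borel_measurable lebesgue" by (simp add: measurable_completion)
  have "(LINT x|lebesgue_on ?Q. \<psi> x *\<^sub>R g x) = (LINT x|lebesgue. indicator ?Q x *\<^sub>R (\<psi> x *\<^sub>R g x))"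
    by (rule integral_restrict_space) auto
  also have "\<dots> = (LINT x|lebesgue. \<psi> x *\<^sub>R (indicator ?Q x *\<^sub>R g x))"
    by (simp only: scaleR_left_commute)
  also have "\<dots> = (LINT x|lebesgue. \<psi> x *\<^sub>R V x)"
  proof (rule integral_cong_AE)
    show "(\<lambda>x. \<psi> x *\<^sub>R (indicator ?Q x *\<^sub>R g x)) \<in> borel_measurable lebesgue"
      by (rule borel_measurable_scaleR[OF \<psi>l cube_measurable])
    show "(\<lambda>x. \<psi> x *\<^sub>R V x) \<in> borel_measurable lebesgue"
      by (rule borel_measurable_scaleR[OF \<psi>l]) (use V in \<open>simp add: measurable_completion\<close>)
    show "AE x in lebesgue. \<psi> x *\<^sub>R (indicator ?Q x *\<^sub>R g x) = \<psi> x *\<^sub>R V x"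
      using eq by eventually_elim (auto simp: indicator_def z)
  qed
  also have "\<dots> = (LINT x|lborel. \<psi> x *\<^sub>R V x)"
    using V \<psi>m by (intro integral_completion) simp
  finally show ?thesis .
qed

end

lemma multi_index_list:
  fixes \<alpha> :: "'a::euclidean_space multiset"
  assumes "\<alpha> \<in> multi_indices m"
  shows "set (SOME bs. mset bs = \<alpha>) \<subseteq> Basis" "length (SOME bs. mset bs = \<alpha>) = size \<alpha>" "size \<alpha> \<le> m"
proof -
  have *: "mset (SOME bs. mset bs = \<alpha>) = \<alpha>" by (rule someI_ex[OF ex_mset])
  show "size \<alpha> \<le> m" using assms by (simp add: multi_indices_def)
  show "length (SOME bs. mset bs = \<alpha>) = size \<alpha>" by (metis * size_mset)
  have "set (SOME bs. mset bs = \<alpha>) = set_mset \<alpha>" by (metis * set_mset_mset)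
  then show "set (SOME bs. mset bs = \<alpha>) \<subseteq> Basis" using assms by (simp add: multi_indices_def)
qed

lemma Lp_norm_powr:
  assumes p: "1 \<le> p"
  shows "Lp_norm p \<Omega> w powr p = (LINT x|lebesgue_on \<Omega>. norm (w x) powr p)"
proof -
  have "0 \<le> (LINT x|lebesgue_on \<Omega>. norm (w x) powr p)" by (intro integral_nonneg_AE AE_I2) simp
  then show ?thesis using p by (simp add: Lp_norm_def powr_powr)
qed

context
  fixes k m :: nat and M p :: real and V :: "'a::euclidean_space list \<Rightarrow> 'a \<Rightarrow> complex" and u :: "'a \<Rightarrow> complex"
  assumes V: "smooth_family k M V" and u: "AE x in lebesgue. x \<in> unit_cube \<longrightarrow> u x = V [] x"
    and p: "1 \<le> p" and m: "m \<le> k"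
begin

lemma smooth_family_has_weak_deriv:
  assumes \<alpha>: "\<alpha> \<in> multi_indices m"
  shows "has_weak_deriv unit_cube \<alpha> u (V (SOME bs. mset bs = \<alpha>))"
proof -
  define bs where "bs = (SOME bs. mset bs = \<alpha>)"
  have bs: "set bs \<subseteq> Basis" "length bs \<le> k" "length bs = size \<alpha>"
    using multi_index_list[OF \<alpha>] m by (auto simp: bs_def)
  have nil: "set [] \<subseteq> (Basis :: 'a set)" "length ([] :: 'a list) \<le> k" by auto
  note V0 = smooth_family_measurable[OF V nil] smooth_family_bound[OF V nil]
  note V1 = smooth_family_measurable[OF V bs(1,2)] smooth_family_bound[OF V bs(1,2)]
  have refl_AE: "AE x in lebesgue. x \<in> unit_cube \<longrightarrow> V bs x = V bs x" by simp
  have "has_weak_deriv unit_cube \<alpha> u (V bs)"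
    unfolding has_weak_deriv_def
  proof (intro conjI allI impI)
    show "locally_integrable unit_cube u" by (rule cube_locally_integrable[OF V0 u])
    show "locally_integrable unit_cube (V bs)" by (rule cube_locally_integrable[OF V1 refl_AE])
    fix \<psi> :: "'a \<Rightarrow> real" assume \<psi>: "test_function unit_cube \<psi>"
    have "(LINT x|lebesgue_on unit_cube. partial_deriv \<alpha> \<psi> x *\<^sub>R u x) = (LINT x|lborel. iter_partial bs \<psi> x *\<^sub>R V [] x)"
      unfolding partial_deriv_def bs_def[symmetric]
      by (rule cube_test_integral[OF V0 u test_function_iter_partial[OF \<psi> bs(1)]])
    also have "\<dots> = (-1) ^ size \<alpha> * (LINT x|lborel. \<psi> x *\<^sub>R V bs x)"
      using smooth_family_weak[OF V bs(1,2) \<psi>] by (simp only: bs(3))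
    also have "(LINT x|lborel. \<psi> x *\<^sub>R V bs x) = (LINT x|lebesgue_on unit_cube. \<psi> x *\<^sub>R V bs x)"
      by (rule cube_test_integral[OF V1 refl_AE \<psi>, symmetric])
    finally show "(LINT x|lebesgue_on unit_cube. partial_deriv \<alpha> \<psi> x *\<^sub>R u x) =
        (-1) ^ size \<alpha> * (LINT x|lebesgue_on unit_cube. \<psi> x *\<^sub>R V bs x)" .
  qed
  then show ?thesis by (simp only: bs_def)
qed

lemma smooth_family_sobolev_space: "u \<in> sobolev_space m p unit_cube"
proof -
  have nil: "set [] \<subseteq> (Basis :: 'a set)" "length ([] :: 'a list) \<le> k" by auto
  have "u \<in> Lp_space p unit_cube"
    by (rule cube_Lp(1)[OF smooth_family_measurable[OF V nil] smooth_family_bound[OF V nil] u p])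
  moreover have "V (SOME bs. mset bs = \<alpha>) \<in> Lp_space p unit_cube" if \<alpha>: "\<alpha> \<in> multi_indices m" for \<alpha>
  proof -
    have bs: "set (SOME bs. mset bs = \<alpha>) \<subseteq> Basis" "length (SOME bs. mset bs = \<alpha>) \<le> k"
      using multi_index_list[OF \<alpha>] m by auto
    have r: "AE x in lebesgue. x \<in> unit_cube \<longrightarrow> V (SOME bs. mset bs = \<alpha>) x = V (SOME bs. mset bs = \<alpha>) x"
      by (intro AE_I2 impI refl)
    show ?thesis
      by (rule cube_Lp(1)[OF smooth_family_measurable[OF V bs] smooth_family_bound[OF V bs] r p])
  qed
  ultimately show ?thesis
    unfolding sobolev_space_def using smooth_family_has_weak_deriv by blast
qed

lemma smooth_family_weak_deriv_norm:
  assumes \<alpha>: "\<alpha> \<in> multi_indices m"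
  shows "Lp_norm p unit_cube (weak_deriv unit_cube \<alpha> u) powr p = cube_power p (V (SOME bs. mset bs = \<alpha>))"
proof -
  note d = smooth_family_has_weak_deriv[OF \<alpha>]
  have bs: "set (SOME bs. mset bs = \<alpha>) \<subseteq> Basis" "length (SOME bs. mset bs = \<alpha>) \<le> k"
    using multi_index_list[OF \<alpha>] m by auto
  have "has_weak_deriv unit_cube \<alpha> u (weak_deriv unit_cube \<alpha> u)"
    unfolding weak_deriv_def by (rule someI[of "has_weak_deriv unit_cube \<alpha> u", OF d])
  from has_weak_deriv_unique[OF open_box this d]
  have "AE x in lebesgue. x \<in> unit_cube \<longrightarrow> weak_deriv unit_cube \<alpha> u x = V (SOME bs. mset bs = \<alpha>) x" .
  from cube_Lp(2)[OF smooth_family_measurable[OF V bs] smooth_family_bound[OF V bs] this p]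
  show ?thesis by (simp only: Lp_norm_powr[OF p])
qed

end

lemma cube_power_le:
  fixes V :: "'a::euclidean_space list \<Rightarrow> 'a \<Rightarrow> complex"
  assumes V: "smooth_family k M V" and bs: "set bs \<subseteq> Basis" "length bs \<le> k" and p: "0 \<le> p"
  shows "cube_power p (V bs) \<le> M powr p"
proof -
  have "cube_power p (V bs) \<le> (LINT x|lborel. indicator (unit_cube :: 'a set) x * M powr p)"
    unfolding cube_power_def
  proof (rule integral_mono)
    show "integrable lborel (\<lambda>x. indicator unit_cube x * norm (V bs x) powr p)"
      by (rule cube_power_integrable[OF smooth_family_measurable[OF V bs] smooth_family_bound[OF V bs] p])
    show "integrable lborel (\<lambda>x::'a. indicator unit_cube x * M powr p)"
      by (rule integrable_cube[where B="M powr p"]) auto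
    show "indicator unit_cube x * norm (V bs x) powr p \<le> indicator unit_cube x * M powr p" for x
      using smooth_family_bound[OF V bs, of x] p by (auto simp: indicator_def intro!: powr_mono2)
  qed
  also have "\<dots> = M powr p" by simp
  finally show ?thesis .
qed

text \<open>For \<open>h < 1\<close> the choice of \<open>\<epsilon>\<close> proportional to \<open>h powr (1 / k)\<close> makes both terms of the interpolation
  inequality of size \<open>h powr p\<close>. For \<open>h \<ge> 1\<close>, and for derivatives of order \<open>k\<close>, the bound \<open>M\<close> suffices.\<close>

lemma interpolation_rate:
  assumes p: "1 \<le> p" and k: "1 \<le> k" and G: "0 \<le> G"
  shows "\<exists>H\<ge>0. \<forall>(V :: 'a::euclidean_space list \<Rightarrow> 'a \<Rightarrow> complex) h bs m. smooth_family k M V \<longrightarrow> set bs \<subseteq> Basis \<longrightarrow>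
    length bs \<le> m \<longrightarrow> m \<le> k \<longrightarrow> 0 < h \<longrightarrow> cube_power p (V []) \<le> G * h powr p \<longrightarrow>
    cube_power p (V bs) \<le> H * h powr (p * (real (k - m) / real k))"
proof -
  define P where "P l H \<longleftrightarrow> 0 \<le> H \<and> (\<forall>(V :: 'a list \<Rightarrow> 'a \<Rightarrow> complex) h bs m. smooth_family k M V \<longrightarrow> set bs \<subseteq> Basis \<longrightarrow>
    length bs = l \<longrightarrow> l \<le> m \<longrightarrow> m \<le> k \<longrightarrow> 0 < h \<longrightarrow> cube_power p (V []) \<le> G * h powr p \<longrightarrow>
    cube_power p (V bs) \<le> H * h powr (p * (real (k - m) / real k)))" for l :: nat and H :: real
  have "\<exists>H. P l H" if l: "l \<in> {..k}" for l
  proof (cases "l = k")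
    case True
    have "P l (M powr p)"
      unfolding P_def
    proof (intro conjI allI impI)
      fix V :: "'a list \<Rightarrow> 'a \<Rightarrow> complex" and h :: real and bs :: "'a list" and m
      assume a: "smooth_family k M V" "set bs \<subseteq> Basis" "length bs = l" "l \<le> m" "m \<le> k" "0 < h"
      then show "cube_power p (V bs) \<le> M powr p * h powr (p * (real (k - m) / real k))"
        using cube_power_le[OF a(1,2)] True p by simp
    qed simp
    then show ?thesis ..
  next
    case False
    then have lk: "l < k" using l by simp
    obtain A e where A: "0 < A" and e: "0 < e" and
      ip: "\<forall>M (V :: 'a list \<Rightarrow> 'a \<Rightarrow> complex) bs \<epsilon>. smooth_family k M V \<longrightarrow> set bs \<subseteq> Basis \<longrightarrow>
       length bs = l \<longrightarrow> 0 < \<epsilon> \<longrightarrow> \<epsilon> \<le> e \<longrightarrow>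
       (\<epsilon> ^ l) powr p * cube_power p (V bs) \<le> A * (cube_power p (V []) + (\<epsilon> ^ k * M) powr p)"
      using interpolation[OF p lk, where 'a='a] by (elim exE conjE) (rule that)
    define H where "H = M powr p + A * (G + (e ^ k * M) powr p) / (e ^ l) powr p"
    have H2: "0 \<le> A * (G + (e ^ k * M) powr p) / (e ^ l) powr p" using A G by simp
    have "P l H"
      unfolding P_def
    proof (intro conjI allI impI)
      show "0 \<le> H" using H2 by (simp add: H_def)
      fix V :: "'a list \<Rightarrow> 'a \<Rightarrow> complex" and h :: real and bs :: "'a list" and m
      assume a: "smooth_family k M V" "set bs \<subseteq> Basis" "length bs = l" "l \<le> m" "m \<le> k" "0 < h"
        and small: "cube_power p (V []) \<le> G * h powr p"
      have M: "0 \<le> M" by (rule smooth_family_nonneg[OF a(1)])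
      let ?ex = "p * (real (k - m) / real k)"
      have ex: "0 \<le> ?ex" using p by simp
      show "cube_power p (V bs) \<le> H * h powr ?ex"
      proof (cases "1 \<le> h")
        case True
        have "cube_power p (V bs) \<le> M powr p * 1"
          using cube_power_le[OF a(1,2)] a p by simp
        also have "\<dots> \<le> H * h powr ?ex"
          using H2 True ex by (intro mult_mono ge_one_powr_ge_zero) (auto simp: H_def)
        finally show ?thesis .
      next
        case False
        define \<epsilon> where "\<epsilon> = e * h powr (1 / real k)"
        have hk: "h powr (1 / real k) \<le> 1" using False a(6) k by (intro powr_le1) auto
        have \<epsilon>: "0 < \<epsilon>" "\<epsilon> \<le> e" using e a(6) hk by (auto simp: \<epsilon>_def mult_left_le)
        have \<epsilon>k: "\<epsilon> ^ k = e ^ k * h"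
          using k a(6) by (simp add: \<epsilon>_def power_mult_distrib powr_power)
        have \<epsilon>l: "(\<epsilon> ^ l) powr p = (e ^ l) powr p * h powr (p * (real l / real k))"
        proof -
          have "(h powr (1 / real k)) ^ l = (h powr (1 / real k)) powr real l"
            using a(6) by (intro powr_realpow[symmetric]) simp
          then have "\<epsilon> ^ l = e ^ l * h powr (real l / real k)"
            by (simp add: \<epsilon>_def power_mult_distrib powr_powr)
          then show ?thesis by (simp add: powr_mult powr_powr mult.commute)
        qed
        have "(\<epsilon> ^ l) powr p * cube_power p (V bs) \<le> A * (cube_power p (V []) + (\<epsilon> ^ k * M) powr p)"
          using ip a \<epsilon> by blast
        also have "\<dots> \<le> A * (G * h powr p + (\<epsilon> ^ k * M) powr p)"
          using small A by (intro mult_left_mono add_right_mono) auto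
        also have "(\<epsilon> ^ k * M) powr p = (e ^ k * M) powr p * h powr p"
          unfolding \<epsilon>k by (simp add: powr_mult mult_ac)
        finally have "(e ^ l) powr p * h powr (p * (real l / real k)) * cube_power p (V bs) \<le> A * (G + (e ^ k * M) powr p) * h powr p"
          unfolding \<epsilon>l by (simp add: algebra_simps)
        then have "cube_power p (V bs) \<le> A * (G + (e ^ k * M) powr p) * h powr p / ((e ^ l) powr p * h powr (p * (real l / real k)))"
          using e a(6) by (simp add: pos_le_divide_eq mult_ac)
        also have "\<dots> = A * (G + (e ^ k * M) powr p) / (e ^ l) powr p * h powr (p - p * (real l / real k))"
          by (simp add: powr_diff)
        also have "\<dots> \<le> A * (G + (e ^ k * M) powr p) / (e ^ l) powr p * h powr ?ex"
        proof (rule mult_left_mono[OF _ H2])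
          have "real (k - m) / real k \<le> 1 - real l / real k"
            using a(4,5) k by (simp add: field_simps of_nat_diff)
          then have "?ex \<le> p * (1 - real l / real k)" using p by (intro mult_left_mono) auto
          also have "\<dots> = p - p * (real l / real k)" by (simp add: algebra_simps)
          finally show "h powr (p - p * (real l / real k)) \<le> h powr ?ex"
            using False a(6) by (intro powr_mono') auto
        qed
        also have "\<dots> \<le> H * h powr ?ex"
          by (intro mult_right_mono) (auto simp: H_def)
        finally show ?thesis .
      qed
    qed
    then show ?thesis ..
  qed
  then have "\<forall>l\<in>{..k}. \<exists>H. P l H" by blast
  from bchoice[OF this] obtain F where F: "\<forall>l\<in>{..k}. P l (F l)" ..
  have F0: "0 \<le> F l" if "l \<in> {..k}" for l using F that by (simp add: P_def)
  define H where "H = (\<Sum>l\<in>{..k}. F l)"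
  have FH: "F l \<le> H" if "l \<in> {..k}" for l
    unfolding H_def using F0 that by (intro member_le_sum) auto
  show ?thesis
  proof (intro exI[of _ H] conjI allI impI)
    show "0 \<le> H" unfolding H_def using F0 by (rule sum_nonneg)
    fix V :: "'a list \<Rightarrow> 'a \<Rightarrow> complex" and h :: real and bs :: "'a list" and m
    assume a: "smooth_family k M V" "set bs \<subseteq> Basis" "length bs \<le> m" "m \<le> k" "0 < h" "cube_power p (V []) \<le> G * h powr p"
    have l: "length bs \<in> {..k}" using a by simp
    then have "P (length bs) (F (length bs))" using F by blast
    then have "cube_power p (V bs) \<le> F (length bs) * h powr (p * (real (k - m) / real k))"
      using a unfolding P_def by blast
    also have "\<dots> \<le> H * h powr (p * (real (k - m) / real k))"
      using FH[OF l] by (intro mult_right_mono) auto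
    finally show "cube_power p (V bs) \<le> H * h powr (p * (real (k - m) / real k))" .
  qed
qed

text \<open>A factor \<open>2 powr p\<close> replaces the triangle inequality, which is harmless since the constant in the
  rate is arbitrary.\<close>

lemma Lp_space_diff:
  assumes p: "1 \<le> p" and g: "g \<in> Lp_space p \<Omega>" and h: "h \<in> Lp_space p \<Omega>"
  shows "(\<lambda>x. g x - h x) \<in> Lp_space p \<Omega>"
    "(LINT x|lebesgue_on \<Omega>. norm (g x - h x) powr p) \<le>
       2 powr p * ((LINT x|lebesgue_on \<Omega>. norm (g x) powr p) + (LINT x|lebesgue_on \<Omega>. norm (h x) powr p))"
proof -
  have [measurable]: "g \<in> borel_measurable (lebesgue_on \<Omega>)" "h \<in> borel_measurable (lebesgue_on \<Omega>)"
    and i: "integrable (lebesgue_on \<Omega>) (\<lambda>x. norm (g x) powr p)" "integrable (lebesgue_on \<Omega>) (\<lambda>x. norm (h x) powr p)"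
    using g h by (auto simp: Lp_space_def)
  have pw: "norm (g x - h x) powr p \<le> 2 powr p * (norm (g x) powr p + norm (h x) powr p)" for x
  proof -
    have "norm (g x - h x) powr p \<le> (\<Sum>b\<in>(UNIV::bool set). if b then norm (g x) else norm (h x)) powr p"
      using p norm_triangle_ineq4[of "g x" "h x"] by (intro powr_mono2) (auto simp: UNIV_bool)
    also have "\<dots> \<le> real (card (UNIV :: bool set)) powr p * (\<Sum>b\<in>UNIV. (if b then norm (g x) else norm (h x)) powr p)"
      using p by (intro powr_sum_le) auto
    finally show ?thesis by (simp add: UNIV_bool add.commute)
  qed
  have i2: "integrable (lebesgue_on \<Omega>) (\<lambda>x. 2 powr p * (norm (g x) powr p + norm (h x) powr p))"
    using i by (intro integrable_mult_right Bochner_Integration.integrable_add)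
  have i3: "integrable (lebesgue_on \<Omega>) (\<lambda>x. norm (g x - h x) powr p)"
    by (rule Bochner_Integration.integrable_bound[OF i2]) (measurable, intro AE_I2, simp add: order_trans[OF pw])
  then show "(\<lambda>x. g x - h x) \<in> Lp_space p \<Omega>" by (simp add: Lp_space_def)
  have "(LINT x|lebesgue_on \<Omega>. norm (g x - h x) powr p) \<le> (LINT x|lebesgue_on \<Omega>. 2 powr p * (norm (g x) powr p + norm (h x) powr p))"
    by (rule integral_mono[OF i3 i2 pw])
  also have "\<dots> = 2 powr p * ((LINT x|lebesgue_on \<Omega>. norm (g x) powr p) + (LINT x|lebesgue_on \<Omega>. norm (h x) powr p))"
    using i by simp
  finally show "(LINT x|lebesgue_on \<Omega>. norm (g x - h x) powr p) \<le>
       2 powr p * ((LINT x|lebesgue_on \<Omega>. norm (g x) powr p) + (LINT x|lebesgue_on \<Omega>. norm (h x) powr p))" .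
qed

section \<open>The rate of convergence\<close>

theorem theorem3p4:
  fixes p c c' :: real and k :: nat
    and \<sigma> :: "real \<Rightarrow> complex" and \<phi> :: "real \<Rightarrow> real"
    and f :: "'a::euclidean_space \<Rightarrow> complex"
    and \<rho> :: "('a \<times> real) set \<Rightarrow> complex"
    and fn :: "nat \<Rightarrow> 'a network" and r :: "nat \<Rightarrow> real"
  assumes p: "1 \<le> p" and k: "1 \<le> k"
    and activation: "\<sigma> \<in> borel_measurable borel"
    and sobolev: "\<sigma> \<in> sobolev_loc1 k UNIV"
    and norm_function: "norm_function \<sigma> \<phi>"
    and unbounded: "filterlim \<phi> at_top at_top"
    and derivatives: "\<exists>C>0. \<forall>m\<le>k. AE x in lebesgue.
                        norm (weak_deriv_real m \<sigma> x) \<le> C * damped \<phi> m \<bar>x\<bar>"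
    and damped_mono: "mono_on {0..} (damped \<phi> k)"
    and damped_pos: "\<forall>x\<ge>0. 0 < damped \<phi> k x"
    and f: "f \<in> barron_space \<sigma> \<phi> unit_cube"
    and \<rho>: "representing_measure \<sigma> \<phi> unit_cube \<rho> f"
    and fn: "\<And>n. 1 \<le> n \<Longrightarrow> fn n \<in> networks n"
    and fn_approx: "\<And>n. 1 \<le> n \<Longrightarrow> Lp_norm p unit_cube (\<lambda>x. f x - realize \<sigma> (fn n) x) \<le> r n"
    and fn_cost: "\<And>n. 1 \<le> n \<Longrightarrow> network_cost \<phi> (fn n) \<le> barron_cost \<phi> \<rho>"
    and asymp_consts: "0 < c" "0 < c'"
  shows "\<exists>C\<^sub>1. \<forall>n \<delta> lam f\<^sub>\<delta> \<theta>.
           1 \<le> n \<longrightarrow> 0 < lam \<longrightarrow>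
           c * lam powr (1 / p) \<le> \<delta> + r n \<longrightarrow> \<delta> + r n \<le> c' * lam powr (1 / p) \<longrightarrow>
           f\<^sub>\<delta> \<in> Lp_space p unit_cube \<longrightarrow>
           Lp_norm p unit_cube (\<lambda>x. f x - f\<^sub>\<delta> x) \<le> \<delta> \<longrightarrow>
           is_arg_min (tikhonov \<sigma> \<phi> p unit_cube lam f\<^sub>\<delta>) (\<lambda>\<eta>. \<eta> \<in> networks n) \<theta> \<longrightarrow>
           (\<forall>m\<le>k. (\<lambda>x. f x - realize \<sigma> \<theta> x) \<in> sobolev_space m p unit_cube \<and>
                  sobolev_norm m p unit_cube (\<lambda>x. f x - realize \<sigma> \<theta> x)
                    \<le> C\<^sub>1 * (\<delta> + r n) powr (real (k - m) / real k))"
proof -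
  obtain S :: "nat \<Rightarrow> real \<Rightarrow> complex" and C :: real where data: "activation_data \<sigma> \<phi> k S C"
  proof (rule activation_representatives[OF activation sobolev norm_function derivatives damped_mono damped_pos])
    fix S :: "nat \<Rightarrow> real \<Rightarrow> complex" and C :: real
    assume "0 < C" "\<And>j. j \<le> k \<Longrightarrow> S j \<in> borel_measurable borel"
      "1 \<le> k \<Longrightarrow> AE y in lborel. \<sigma> y = S 0 y"
      "\<And>y. norm (\<sigma> y) \<le> C * \<phi> \<bar>y\<bar>"
      "\<And>j c h. j < k \<Longrightarrow> S j (c + h) - S j c = h *\<^sub>R (LINT t|lborel. indicator {0..1} t *\<^sub>R S (Suc j) (c + t * h))"
      "\<And>j y R. j \<le> k \<Longrightarrow> \<bar>y\<bar> < R \<Longrightarrow> norm (S j y) \<le> C * damped \<phi> j R"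
    then have "activation_data \<sigma> \<phi> k S C"
      using k activation norm_function unfolding activation_data_def norm_function_def by blast
    then show thesis by (rule that)
  qed
  interpret activation_data \<sigma> \<phi> k S C by (rule data)
  let ?Q = "unit_cube :: 'a set"
  define E where "E g = (LINT x|lebesgue_on ?Q. norm (g x) powr p)" for g :: "'a \<Rightarrow> complex"
  have p0: "0 \<le> p" using p by simp
  have E0: "0 \<le> E g" for g unfolding E_def by (intro integral_nonneg_AE AE_I2) simp
  have EL: "Lp_norm p ?Q g powr p = E g" for g
    unfolding E_def by (rule Lp_norm_powr[OF p])
  have L0: "0 \<le> Lp_norm p ?Q g" for g by (simp add: Lp_norm_def)
  define K where "K = barron_cost \<phi> \<rho>"
  obtain Vf where Vf: "smooth_family k (4 * C * K) Vf"
    and Vf_eq: "AE x in lborel. complex_integral \<rho> (\<lambda>(w, b). \<sigma> (w \<bullet> x + b)) = Vf [] x"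
  proof (rule barron_smooth_family)
    show "\<rho> \<in> barron_measures \<phi>" using \<rho> by (simp add: representing_measure_def)
  qed (auto simp: K_def intro: that)
  have f_eq: "AE x in lebesgue. x \<in> ?Q \<longrightarrow> f x = Vf [] x"
  proof -
    have "AE x in lebesgue_on ?Q. f x = complex_integral \<rho> (\<lambda>(w, b). \<sigma> (w \<bullet> x + b))"
      using \<rho> by (simp add: representing_measure_def)
    then have "AE x in lebesgue. x \<in> ?Q \<longrightarrow> f x = complex_integral \<rho> (\<lambda>(w, b). \<sigma> (w \<bullet> x + b))"
      by (subst (asm) AE_restrict_space_iff) auto
    with AE_completion[OF Vf_eq] show ?thesis by eventually_elim simp
  qed
  have nil: "set [] \<subseteq> (Basis :: 'a set)" "length ([] :: 'a list) \<le> k" by auto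
  have f_Lp: "f \<in> Lp_space p ?Q"
    by (rule cube_Lp(1)[OF smooth_family_measurable[OF Vf nil] smooth_family_bound[OF Vf nil] f_eq p])
  have net: "\<exists>V. smooth_family k (C * network_cost \<phi> \<theta>) V \<and> (AE x in lebesgue. x \<in> ?Q \<longrightarrow> realize \<sigma> \<theta> x = V [] x)"
    for \<theta> :: "'a network"
  proof -
    obtain V where V: "smooth_family k (C * network_cost \<phi> \<theta>) V" and eq: "AE x in lborel. realize \<sigma> \<theta> x = V [] x"
      using network_smooth_family[of \<theta>] by (elim exE conjE)
    have "AE x in lebesgue. x \<in> ?Q \<longrightarrow> realize \<sigma> \<theta> x = V [] x"
      using AE_completion[OF eq] by eventually_elim simp
    with V show ?thesis by (intro exI[of _ V] conjI)
  qed
  have net_Lp: "realize \<sigma> \<theta> \<in> Lp_space p ?Q" for \<theta> :: "'a network"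
  proof -
    obtain V where V: "smooth_family k (C * network_cost \<phi> \<theta>) V" and eq: "AE x in lebesgue. x \<in> ?Q \<longrightarrow> realize \<sigma> \<theta> x = V [] x"
      using net[of \<theta>] by (elim exE conjE)
    show ?thesis
      by (rule cube_Lp(1)[OF smooth_family_measurable[OF V nil] smooth_family_bound[OF V nil] eq p])
  qed
  have K0: "0 \<le> K"
    using network_cost_nonneg[of "fn 1"] fn_cost[of 1] by (simp add: K_def)
  \<comment> \<open>\<open>T\<close> bounds the \<open>p\<close>-th power of the cost of the minimizer, \<open>M\<close> the derivatives of its difference to
    \<open>f\<close>, and \<open>G\<close> the \<open>p\<close>-th power of the \<open>L\<^sup>p\<close> norm of this difference in units of \<open>\<delta> + r n\<close>.\<close>
  define T where "T = 2 powr p * 2 * c' powr p + K powr p"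
  define M where "M = 4 * C * K + C * T powr (1 / p)"
  define G where "G = 2 powr p * (1 + (2 powr p * 2 + K powr p / c powr p))"
  have G0: "0 \<le> G" by (simp add: G_def)
  obtain H where H0: "0 \<le> H" and H: "\<forall>(V :: 'a list \<Rightarrow> 'a \<Rightarrow> complex) h bs m. smooth_family k M V \<longrightarrow> set bs \<subseteq> Basis \<longrightarrow>
    length bs \<le> m \<longrightarrow> m \<le> k \<longrightarrow> 0 < h \<longrightarrow> cube_power p (V []) \<le> G * h powr p \<longrightarrow>
    cube_power p (V bs) \<le> H * h powr (p * (real (k - m) / real k))"
    using interpolation_rate[OF p k G0, of M, where 'a='a] by (elim exE conjE)
  define B where "B m = (real (card (multi_indices m :: 'a multiset set)) * H) powr (1 / p)" for m
  define C1 where "C1 = (\<Sum>m\<le>k. B m)"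
  have BC: "B m \<le> C1" if "m \<le> k" for m
    unfolding C1_def using that by (intro member_le_sum) (auto simp: B_def)
  have main: "(\<lambda>x. f x - realize \<sigma> \<theta> x) \<in> sobolev_space m p ?Q \<and>
      sobolev_norm m p ?Q (\<lambda>x. f x - realize \<sigma> \<theta> x) \<le> C1 * (\<delta> + r n) powr (real (k - m) / real k)"
    if n: "1 \<le> n" and lam: "0 < lam" and lower: "c * lam powr (1 / p) \<le> \<delta> + r n"
      and upper: "\<delta> + r n \<le> c' * lam powr (1 / p)" and fd: "fd \<in> Lp_space p ?Q"
      and fd_dist: "Lp_norm p ?Q (\<lambda>x. f x - fd x) \<le> \<delta>"
      and min: "is_arg_min (tikhonov \<sigma> \<phi> p ?Q lam fd) (\<lambda>\<eta>. \<eta> \<in> networks n) \<theta>" and m: "m \<le> k"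
    for n \<delta> lam fd \<theta> m
  proof -
    define h where "h = \<delta> + r n"
    have \<delta>0: "0 \<le> \<delta>" using L0 fd_dist order_trans by blast
    have r0: "0 \<le> r n" using L0 fn_approx[OF n] order_trans by blast
    have h: "0 < h" using lower lam asymp_consts(1) by (auto simp: h_def intro: less_le_trans[rotated])
    have hp: "0 < h powr p" using h by simp
    have lamp: "(a * lam powr (1 / p)) powr p = a powr p * lam" for a
      using lam p by (simp add: powr_mult powr_powr)
    have lam_le: "c powr p * lam \<le> h powr p"
      using powr_mono2[OF p0 _ lower] asymp_consts(1) unfolding lamp h_def by simp
    have le_lam: "h powr p \<le> c' powr p * lam"
      using powr_mono2[OF p0 _ upper] h unfolding lamp h_def by simp
    have Efd: "E (\<lambda>x. f x - fd x) \<le> h powr p"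
      unfolding EL[symmetric] using fd_dist r0 L0 p0 by (intro powr_mono2) (auto simp: h_def)
    have Efn: "E (\<lambda>x. f x - realize \<sigma> (fn n) x) \<le> h powr p"
      unfolding EL[symmetric] using fn_approx[OF n] \<delta>0 L0 p0 by (intro powr_mono2) (auto simp: h_def)
    note Lp_fd = Lp_space_diff(1)[OF p f_Lp fd]
    have "E (\<lambda>x. (f x - fd x) - (f x - realize \<sigma> (fn n) x)) \<le> 2 powr p * (E (\<lambda>x. f x - fd x) + E (\<lambda>x. f x - realize \<sigma> (fn n) x))"
      unfolding E_def by (rule Lp_space_diff(2)[OF p Lp_fd Lp_space_diff(1)[OF p f_Lp net_Lp]])
    also have "\<dots> \<le> 2 powr p * (h powr p + h powr p)"
      using Efd Efn by (intro mult_left_mono add_mono) auto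
    finally have fn_fd: "E (\<lambda>x. realize \<sigma> (fn n) x - fd x) \<le> 2 powr p * 2 * h powr p" by simp
    have J: "tikhonov \<sigma> \<phi> p ?Q lam fd \<eta> = E (\<lambda>x. realize \<sigma> \<eta> x - fd x) + lam * network_cost \<phi> \<eta> powr p" for \<eta>
      by (simp add: tikhonov_def regularizer_def EL)
    have "tikhonov \<sigma> \<phi> p ?Q lam fd \<theta> \<le> tikhonov \<sigma> \<phi> p ?Q lam fd (fn n)"
      using min fn[OF n] by (auto simp: is_arg_min_def not_less)
    also have "\<dots> \<le> 2 powr p * 2 * h powr p + lam * K powr p"
      unfolding J using fn_fd fn_cost[OF n] network_cost_nonneg p0 lam
      by (intro add_mono mult_left_mono powr_mono2) (auto simp: K_def)
    finally have J\<theta>: "E (\<lambda>x. realize \<sigma> \<theta> x - fd x) + lam * network_cost \<phi> \<theta> powr p \<le> 2 powr p * 2 * h powr p + lam * K powr p"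
      unfolding J .
    have "lam * network_cost \<phi> \<theta> powr p \<le> 2 powr p * 2 * h powr p + lam * K powr p"
      using J\<theta> E0 by (meson add_increasing order_refl order_trans)
    also have "\<dots> \<le> 2 powr p * 2 * (c' powr p * lam) + lam * K powr p"
      using le_lam by (intro add_right_mono mult_left_mono) auto
    also have "\<dots> = lam * T" by (simp add: T_def algebra_simps)
    finally have "network_cost \<phi> \<theta> powr p \<le> T" using lam by simp
    then have "(network_cost \<phi> \<theta> powr p) powr (1 / p) \<le> T powr (1 / p)"
      using p by (intro powr_mono2) auto
    then have cost: "network_cost \<phi> \<theta> \<le> T powr (1 / p)"
      using p network_cost_nonneg[of \<theta>] by (simp add: powr_powr)
    have "E (\<lambda>x. realize \<sigma> \<theta> x - fd x) \<le> 2 powr p * 2 * h powr p + lam * K powr p"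
      using J\<theta> lam by (meson add_increasing2 mult_nonneg_nonneg less_imp_le order_refl order_trans powr_ge_zero)
    also have "lam * K powr p \<le> h powr p / c powr p * K powr p"
      using lam_le asymp_consts(1) by (intro mult_right_mono) (auto simp: field_simps)
    finally have \<theta>_fd: "E (\<lambda>x. realize \<sigma> \<theta> x - fd x) \<le> (2 powr p * 2 + K powr p / c powr p) * h powr p"
      by (simp add: algebra_simps)
    have "E (\<lambda>x. (f x - fd x) - (realize \<sigma> \<theta> x - fd x)) \<le> 2 powr p * (E (\<lambda>x. f x - fd x) + E (\<lambda>x. realize \<sigma> \<theta> x - fd x))"
      unfolding E_def by (rule Lp_space_diff(2)[OF p Lp_fd Lp_space_diff(1)[OF p net_Lp fd]])
    also have "\<dots> \<le> 2 powr p * (h powr p + (2 powr p * 2 + K powr p / c powr p) * h powr p)"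
      using Efd \<theta>_fd by (intro mult_left_mono add_mono) auto
    also have "\<dots> = G * h powr p" by (simp add: G_def algebra_simps)
    finally have Eu: "E (\<lambda>x. f x - realize \<sigma> \<theta> x) \<le> G * h powr p" by simp
    let ?u = "\<lambda>x. f x - realize \<sigma> \<theta> x"
    obtain V\<theta> where V\<theta>: "smooth_family k (C * network_cost \<phi> \<theta>) V\<theta>" and \<theta>_eq: "AE x in lebesgue. x \<in> ?Q \<longrightarrow> realize \<sigma> \<theta> x = V\<theta> [] x"
      using net[of \<theta>] by (elim exE conjE)
    \<comment> \<open>\<open>U\<close> consists of the derivatives of \<open>f - realize \<sigma> \<theta>\<close>; its bound \<open>M\<close> does not depend on
      \<open>n\<close>, \<open>\<delta>\<close> or \<open>lam\<close>.\<close>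
    define U where "U bs x = Vf bs x + (- 1) * V\<theta> bs x" for bs x
    have U: "smooth_family k M U"
    proof (rule smooth_family_mono)
      show "smooth_family k (4 * C * K + norm (- 1 :: complex) * (C * network_cost \<phi> \<theta>)) U"
        unfolding U_def by (intro smooth_family_add smooth_family_mult Vf V\<theta>)
      show "4 * C * K + norm (- 1 :: complex) * (C * network_cost \<phi> \<theta>) \<le> M"
        using cost C by (simp add: M_def)
    qed
    have U_eq: "AE x in lebesgue. x \<in> ?Q \<longrightarrow> ?u x = U [] x"
      using f_eq \<theta>_eq by eventually_elim (simp add: U_def)
    have "cube_power p (U []) = E ?u"
      unfolding E_def by (rule cube_Lp(2)[OF smooth_family_measurable[OF U nil] smooth_family_bound[OF U nil] U_eq p, symmetric])
    with Eu have small: "cube_power p (U []) \<le> G * h powr p" by simp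
    let ?ex = "real (k - m) / real k"
    have term_bound: "Lp_norm p ?Q (weak_deriv ?Q \<alpha> ?u) powr p \<le> H * h powr (p * ?ex)" if \<alpha>: "\<alpha> \<in> multi_indices m" for \<alpha>
    proof -
      have "cube_power p (U (SOME bs. mset bs = \<alpha>)) \<le> H * h powr (p * ?ex)"
        using H U multi_index_list[OF \<alpha>] m h small by simp
      then show ?thesis
        by (simp only: smooth_family_weak_deriv_norm[OF U U_eq p m \<alpha>])
    qed
    have "(\<Sum>\<alpha>\<in>multi_indices m. Lp_norm p ?Q (weak_deriv ?Q \<alpha> ?u) powr p) \<le>
        real (card (multi_indices m :: 'a multiset set)) * (H * h powr (p * ?ex))"
      using sum_bounded_above[of "multi_indices m" "\<lambda>\<alpha>. Lp_norm p ?Q (weak_deriv ?Q \<alpha> ?u) powr p"] term_bound by simp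
    then have "sobolev_norm m p ?Q ?u \<le> (real (card (multi_indices m :: 'a multiset set)) * (H * h powr (p * ?ex))) powr (1 / p)"
      unfolding sobolev_norm_def using p by (intro powr_mono2 sum_nonneg) auto
    also have "\<dots> = B m * h powr ?ex"
      using p by (simp add: B_def powr_mult powr_powr flip: mult.assoc)
    also have "\<dots> \<le> C1 * h powr ?ex"
      using BC[OF m] by (intro mult_right_mono) auto
    finally show ?thesis
      using smooth_family_sobolev_space[OF U U_eq p m] by (simp add: h_def)
  qed
  show ?thesis
    by (intro exI[of _ C1] allI impI main) 
qed

end
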